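(* Let $m_0\in\mathcal P(\mathbb T^d)$ and, for $\delta>0$, let $(m_\delta,\alpha_\delta)$ be an optimal trajectory for $\bar{\mathcal V}_\delta(m_0)$, and let $\nu_\delta^{m_0}\in\mathcal P(\mathcal P(\mathbb T^d)\times E)$ be the probability measure defined by $$\int_{\mathcal P(\mathbb T^d)\times E}f(m,\alpha)\,\nu_\delta^{m_0}(dm,d\alpha)=\delta\int_0^\infty e^{-\delta s}f(m_\delta(s),\alpha_\delta(s,\cdot))\,ds.$$ Suppose $\bar\nu\in\mathcal P(\mathcal P(\mathbb T^d)\times E)$ is a weak limit of $\nu_{\delta}^{m_0}$ as $\delta\to0$, possibly along a subsequence. Let $\mu$ be the first marginal of $\bar\nu$, let $\bar\nu=\bar\nu_m(d\alpha)\mu(dm)$ be the disintegration of $\bar\nu$ with respect to $\mu$, and let $p_1$ be the $\mathbb R^d$-valued measure on $\mathcal P(\mathbb T^d)\times\mathbb T^d$ given by $$p_1(dm,dy)=\int_E\alpha(y)\,m(dy)\,\bar\nu_m(d\alpha)\,\mu(dm).$$ Then $(\mu,p_1)$ is a Mather measure.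
   Context: **Setting.** $\mathbb T^d=\mathbb R^d/\mathbb Z^d$; $\mathcal P(\mathbb T^d)$ is the set of Borel probability measures on $\mathbb T^d$ with the $1$-Wasserstein distance $\mathbf d$. A function $\Phi:\mathcal P(\mathbb T^d)\to\mathbb R$ is $C^1$ if there is a continuous $\frac{\delta\Phi}{\delta m}:\mathcal P(\mathbb T^d)\times\mathbb T^d\to\mathbb R$ with $\Phi(m_2)-\Phi(m_1)=\int_0^1\int_{\mathbb T^d}\frac{\delta\Phi}{\delta m}((1-t)m_1+tm_2,x)(m_2-m_1)(dx)dt$ for all $m_1,m_2$, normalized by $\int\frac{\delta\Phi}{\delta m}(m,x)m(dx)=0$. When $\frac{\delta\Phi}{\delta m}$ is differentiable in $x$, $D_m\Phi(m,x)=D_x\frac{\delta\Phi}{\delta m}(m,x)$. $\Phi\in C^{1,1}(\mathcal P(\mathbb T^d))$ means that $\Phi$ is $C^1$, $D_m\Phi$ is well defined and $D_m\Phi$ is smooth in the second variable (the derivatives in the second variable being understood as continuous on $\mathcal P(\mathbb T^d)\times\mathbb T^d$). **Standing assumptions.** (1) $H:\mathbb T^d\times\mathbb R^d\to\mathbb R$ is $C^2$, $p\mapsto D_{pp}H(x,p)$ is Lipschitz uniformly in $x$; there is $\bar C>0$ with $\bar C^{-1}I_d\le D_{pp}H(x,p)\le\bar CI_d$ for all $(x,p)$; there are $\theta\in(0,1)$, $C>0$ with $|D_{xx}H(x,p)|\le C(1+|p|)^{1+\theta}$ and $|D_{x,p}H(x,p)|\le C(1+|p|)^\theta$ for all $(x,p)$.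 (2) $\mathcal F:\mathcal P(\mathbb T^d)\to\mathbb R$ is $C^2$ (in the sense of the derivative $\frac{\delta}{\delta m}$ on $\mathcal P(\mathbb T^d)$), its derivative $F(x,m)=\frac{\delta\mathcal F}{\delta m}(m,x)$ is twice differentiable in $x$ and $D^2_{xx}F$ is bounded. $H^*(x,a)=\sup_p\{a\cdot p-H(x,p)\}$. **Discounted problem.** For $\delta>0$, $\mathcal V_\delta(m_0)=\inf_{(m,\alpha)}\int_0^\infty e^{-\delta t}\big(\int_{\mathbb T^d}H^*(x,\alpha(t,x))m(t,dx)+\mathcal F(m(t))\big)dt$, over $m\in C^0([0,\infty),\mathcal P(\mathbb T^d))$ and $\alpha:[0,\infty)\times\mathbb T^d\to\mathbb R^d$ square integrable with respect to $e^{-\delta t}m(t,dx)dt$, solving in the sense of distributions $-\partial_tm+\Delta m+\mathrm{div}(m\alpha)=0$, $m(0)=m_0$. It is known that $\delta\mathcal V_\delta\to-\lambda$ uniformly as $\delta\to0$ for a unique constant $\lambda\in\mathbb R$ (the critical value). Set $\bar{\mathcal V}_\delta=\mathcal V_\delta+\lambda/\delta$. **Optimal trajectories.** For every $m_0,\delta$ the problem $\mathcal V_\delta(m_0)$ has minimizers (called optimal trajectories for $\bar{\mathcal V}_\delta(m_0)$), and it is known that each minimizer $(m_\delta,\alpha_\delta)$ may be taken with $\alpha_\delta$ continuous and $\alpha_\delta(t,\cdot)\in E$ for all $t$, where $E=\{\alpha\in W^{1,\infty}(\mathbb T^d,\mathbb R^d):\|\alpha\|_\infty+\|D\alpha\|_\infty\le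 C\}$ with $C$ fixed independently of $\delta,m_0$; $E$ carries the (compact) topology of uniform convergence. **Mather measures.** Consider couples $(\mu,p_1)$ with $\mu\in\mathcal P(\mathcal P(\mathbb T^d))$ and $p_1$ an $\mathbb R^d$-valued Borel measure on $\mathcal P(\mathbb T^d)\times\mathbb T^d$ absolutely continuous with respect to $dm\otimes\mu:=m(dy)\mu(dm)$. The couple is closed if for every $\Phi\in C^{1,1}(\mathcal P(\mathbb T^d))$ $$-\int_{\mathcal P(\mathbb T^d)\times\mathbb T^d}D_m\Phi(m,y)\cdot p_1(dm,dy)+\int_{\mathcal P(\mathbb T^d)\times\mathbb T^d}\mathrm{div}_yD_m\Phi(m,y)\,m(dy)\mu(dm)=0.$$ A Mather measure is a closed couple $(\mu,p_1)$ that minimizes $\int_{\mathcal P(\mathbb T^d)}\big(\int_{\mathbb T^d}H^*\big(y,\frac{dp_1}{dm\otimes\mu}\big)m(dy)+\mathcal F(m)\big)\mu(dm)$ among all closed couples. It is known that the minimum value equals $-\lambda$. *)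

theory Defs
  imports "HOL-Probability.Probability"
begin

section \<open>The flat torus\<close>

definition lattice_equiv :: "real ^ 'n \<Rightarrow> real ^ 'n \<Rightarrow> bool" where
  "lattice_equiv x y \<longleftrightarrow> (\<forall>i. x $ i - y $ i \<in> \<int>)"

lemma equivp_lattice_equiv: "equivp lattice_equiv"
proof (rule equivpI)
  show "reflp lattice_equiv" by (simp add: reflp_def lattice_equiv_def)
  show "symp lattice_equiv"
    unfolding symp_def lattice_equiv_def by (metis Ints_minus minus_diff_eq)
  show "transp lattice_equiv"
    unfolding transp_def lattice_equiv_def
  proof (intro allI impI)
    fix x y z :: "real ^ 'n" and i
    assume "\<forall>i. x $ i - y $ i \<in> \<int>" "\<forall>i. y $ i - z $ i \<in> \<int>"
    then have "(x $ i - y $ i) + (y $ i - z $ i) \<in> \<int>" by (intro Ints_add) auto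
    then show "x $ i - z $ i \<in> \<int>" by simp
  qed
qed

quotient_type 'n torus = "real ^ 'n" / lattice_equiv
  by (rule equivp_lattice_equiv)

abbreviation to_torus :: "real ^ 'n \<Rightarrow> 'n torus" where
  "to_torus \<equiv> abs_torus"

lemma to_torus_eq_iff: "to_torus x = to_torus y \<longleftrightarrow> lattice_equiv x y"
  by (rule torus.abs_eq_iff)

lemma to_torus_rep [simp]: "to_torus (rep_torus X) = X"
  by (rule Quotient3_abs_rep [OF Quotient3_torus])

lemma setdist_fibre:
  "setdist {x'. to_torus x' = to_torus x} {y. to_torus y = Y} = infdist x {y. to_torus y = Y}"
    (is "setdist ?A ?B = _")
proof (rule antisym)
  have neB: "?B \<noteq> {}" using to_torus_rep by blast
  have "setdist ?A ?B \<le> dist x y" if "y \<in> ?B" for y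
    using setdist_le_dist [of x ?A y ?B] that by simp
  then show "setdist ?A ?B \<le> infdist x ?B"
    using neB by (auto simp: infdist_notempty intro!: cINF_greatest)
  show "infdist x ?B \<le> setdist ?A ?B"
  proof (rule le_setdistI)
    show "?A \<noteq> {}" by blast
    show "?B \<noteq> {}" by (rule neB)
    fix x' y assume x': "x' \<in> ?A" and y: "y \<in> ?B"
    have "lattice_equiv (y + (x - x')) y"
      using x' by (simp add: to_torus_eq_iff lattice_equiv_def)
        (metis Ints_minus minus_diff_eq)
    then have "y + (x - x') \<in> ?B" using y by (simp flip: to_torus_eq_iff)
    then have "infdist x ?B \<le> dist x (y + (x - x'))" by (rule infdist_le)
    also have "\<dots> = dist x' y" by (simp add: dist_norm algebra_simps)
    finally show "infdist x ?B \<le> dist x' y" .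
  qed
qed

lemma closed_fibre: "closed {y. to_torus y = Y}"
proof -
  have "{y. to_torus y = Y} = (\<Inter>i. (\<lambda>y. y $ i - rep_torus Y $ i) -` \<int>)"
    using to_torus_eq_iff [of _ "rep_torus Y"] by (auto simp: lattice_equiv_def)
  also have "closed \<dots>"
    by (intro closed_INT ballI closed_vimage continuous_intros) auto
  finally show ?thesis .
qed

instantiation torus :: (finite) metric_space
begin

definition dist_torus :: "'a torus \<Rightarrow> 'a torus \<Rightarrow> real" where
  "dist_torus X Y = setdist {x. to_torus x = X} {y. to_torus y = Y}"

definition uniformity_torus :: "('a torus \<times> 'a torus) filter" where
  "uniformity_torus = (INF e\<in>{0 <..}. principal {(x, y). dist x y < e})"

definition open_torus :: "'a torus set \<Rightarrow> bool" where
  "open_torus U = (\<forall>x\<in>U. \<forall>\<^sub>F (x', y) in uniformity. x' = x \<longrightarrow> y \<in> U)"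

instance
proof
  fix X Y Z :: "'a torus"
  have infd: "dist (to_torus x) W = infdist x {y. to_torus y = W}" for x :: "real ^ 'a" and W
    unfolding dist_torus_def by (rule setdist_fibre)
  have ne: "{y. to_torus y = W} \<noteq> {}" for W :: "'a torus" using to_torus_rep by blast
  have sym: "dist V W = dist W V" for V W :: "'a torus"
    by (simp add: dist_torus_def setdist_sym)
  show "dist X Y = 0 \<longleftrightarrow> X = Y"
  proof
    assume "dist X Y = 0"
    then have "infdist (rep_torus X) {y. to_torus y = Y} = 0" by (simp flip: infd)
    then have "rep_torus X \<in> {y. to_torus y = Y}"
      using in_closed_iff_infdist_zero [OF closed_fibre ne] by blast
    then show "X = Y" by simp
  next
    assume "X = Y"
    then show "dist X Y = 0"
      using infd [of "rep_torus X" Y] by simp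
  qed
  show "dist X Y \<le> dist X Z + dist Y Z"
  proof -
    have "dist X Y - dist Z Y \<le> dist (rep_torus X) z" if "to_torus z = Z" for z
      using infdist_triangle [of "rep_torus X" "{y. to_torus y = Y}" z] infd [of "rep_torus X" Y]
        infd [of z Y] that by simp
    then have "dist X Y - dist Z Y \<le> infdist (rep_torus X) {z. to_torus z = Z}"
      using ne by (auto simp: infdist_notempty intro!: cINF_greatest)
    then show ?thesis using infd [of "rep_torus X" Z] by (simp add: sym [of Y Z])
  qed
qed (simp_all add: uniformity_torus_def open_torus_def)

end


section \<open>Derivatives\<close>

primrec Ck :: "nat \<Rightarrow> ('a::euclidean_space \<Rightarrow> real) \<Rightarrow> bool" where
  "Ck 0 f \<longleftrightarrow> continuous_on UNIV f"
| "Ck (Suc k) f \<longleftrightarrow> (\<forall>x. f differentiable (at x)) \<and>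
     (\<forall>b\<in>Basis. Ck k (\<lambda>x. frechet_derivative f (at x) b))"

definition smooth :: "('a::euclidean_space \<Rightarrow> real) \<Rightarrow> bool" where
  "smooth f \<longleftrightarrow> (\<forall>k. Ck k f)"

definition grad :: "(real ^ 'n::finite \<Rightarrow> real) \<Rightarrow> real ^ 'n \<Rightarrow> real ^ 'n" where
  "grad f x = (\<chi> i. frechet_derivative f (at x) (axis i 1))"

definition hess :: "(real ^ 'n::finite \<Rightarrow> real) \<Rightarrow> real ^ 'n \<Rightarrow> real ^ 'n ^ 'n" where
  "hess f x = (\<chi> i. grad (\<lambda>y. grad f y $ i) x)"

text \<open>Functions on the torus are differentiated through their periodic lifts; by periodicity
  the choice of the representative is irrelevant.\<close>

definition tdifferentiable :: "('n::finite torus \<Rightarrow> real) \<Rightarrow> bool" where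
  "tdifferentiable g \<longleftrightarrow> (\<forall>z. (\<lambda>y. g (to_torus y)) differentiable (at z))"

definition tgrad :: "('n::finite torus \<Rightarrow> real) \<Rightarrow> 'n torus \<Rightarrow> real ^ 'n" where
  "tgrad g x = grad (\<lambda>y. g (to_torus y)) (rep_torus x)"

definition thess :: "('n::finite torus \<Rightarrow> real) \<Rightarrow> 'n torus \<Rightarrow> real ^ 'n ^ 'n" where
  "thess g x = hess (\<lambda>y. g (to_torus y)) (rep_torus x)"

definition tdiv :: "('n::finite torus \<Rightarrow> real ^ 'n) \<Rightarrow> 'n torus \<Rightarrow> real" where
  "tdiv G x = (\<Sum>i\<in>UNIV. tgrad (\<lambda>y. G y $ i) x $ i)"

definition tlap :: "('n::finite torus \<Rightarrow> real) \<Rightarrow> 'n torus \<Rightarrow> real" where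
  "tlap g = tdiv (tgrad g)"

text \<open>All space derivatives up to order \<open>k\<close> exist and are continuous jointly in the parameter
  and the space variable.\<close>

primrec Ck_space :: "nat \<Rightarrow> ('a::topological_space \<Rightarrow> 'n::finite torus \<Rightarrow> real) \<Rightarrow> bool" where
  "Ck_space 0 g \<longleftrightarrow> continuous_on UNIV (\<lambda>(m, x). g m x)"
| "Ck_space (Suc k) g \<longleftrightarrow> (\<forall>m. tdifferentiable (g m)) \<and>
     (\<forall>i. Ck_space k (\<lambda>m x. tgrad (g m) x $ i))"


section \<open>Probability measures on the torus\<close>

typedef (overloaded) 'n ptorus = "{M :: 'n::finite torus measure. prob_space M \<and> sets M = sets borel}"
  morphisms meas Abs_ptorus
  by (rule exI [of _ "return borel undefined"]) (simp add: prob_space_return)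

definition couplings :: "'n::finite ptorus \<Rightarrow> 'n ptorus \<Rightarrow> ('n torus \<times> 'n torus) measure set" where
  "couplings m1 m2 = {\<pi>. sets \<pi> = sets borel \<and>
     distr \<pi> borel fst = meas m1 \<and> distr \<pi> borel snd = meas m2}"

definition wasserstein :: "'n::finite ptorus \<Rightarrow> 'n ptorus \<Rightarrow> ennreal" where
  "wasserstein m1 m2 = (INF \<pi>\<in>couplings m1 m2. \<integral>\<^sup>+z. ennreal (dist (fst z) (snd z)) \<partial>\<pi>)"

text \<open>The metric topology of the 1-Wasserstein distance, in terms of its balls.\<close>

instantiation ptorus :: (finite) topological_space
begin

definition open_ptorus :: "'a ptorus set \<Rightarrow> bool" where
  "open_ptorus U \<longleftrightarrow> (\<forall>m\<in>U. \<exists>e>0. \<forall>m'. wasserstein m m' < ennreal e \<longrightarrow> m' \<in> U)"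

instance
proof
  show "open (UNIV :: 'a ptorus set)"
    by (auto simp: open_ptorus_def intro: exI [of _ 1])
next
  fix S T :: "'a ptorus set" assume S: "open S" and T: "open T"
  show "open (S \<inter> T)"
    unfolding open_ptorus_def
  proof
    fix m assume "m \<in> S \<inter> T"
    then obtain e e' where "e > 0" "\<forall>m'. wasserstein m m' < ennreal e \<longrightarrow> m' \<in> S"
      and "e' > 0" "\<forall>m'. wasserstein m m' < ennreal e' \<longrightarrow> m' \<in> T"
      using S T unfolding open_ptorus_def by blast
    then show "\<exists>e>0. \<forall>m'. wasserstein m m' < ennreal e \<longrightarrow> m' \<in> S \<inter> T"
      by (metis IntI ennreal_leI min.cobounded1 min.cobounded2 min_less_iff_conj order.strict_trans2)
  qed
next
  fix K :: "'a ptorus set set" assume K: "\<forall>S\<in>K. open S"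
  show "open (\<Union>K)"
    unfolding open_ptorus_def
  proof
    fix m assume "m \<in> \<Union>K"
    then obtain S where "S \<in> K" "m \<in> S" by blast
    moreover from this K obtain e where "e > 0" "\<forall>m'. wasserstein m m' < ennreal e \<longrightarrow> m' \<in> S"
      unfolding open_ptorus_def by blast
    ultimately show "\<exists>e>0. \<forall>m'. wasserstein m m' < ennreal e \<longrightarrow> m' \<in> \<Union>K"
      by blast
  qed
qed

end

text \<open>The convex combination \<open>(1 - t) m\<^sub>1 + t m\<^sub>2\<close>, for \<open>0 \<le> t \<le> 1\<close>.\<close>

definition convex_comb :: "real \<Rightarrow> 'n::finite ptorus \<Rightarrow> 'n ptorus \<Rightarrow> 'n ptorus" where
  "convex_comb t m1 m2 = Abs_ptorus (measure_of UNIV (sets borel)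
     (\<lambda>A. ennreal (1 - t) * emeasure (meas m1) A + ennreal t * emeasure (meas m2) A))"

definition is_flat_deriv ::
    "('n::finite ptorus \<Rightarrow> real) \<Rightarrow> ('n ptorus \<Rightarrow> 'n torus \<Rightarrow> real) \<Rightarrow> bool" where
  "is_flat_deriv \<Phi> g \<longleftrightarrow>
     continuous_on UNIV (\<lambda>(m, x). g m x) \<and>
     (\<forall>m1 m2. \<Phi> m2 - \<Phi> m1 = (LINT t:{0..1}|lborel.
        (LINT x|meas m2. g (convex_comb t m1 m2) x) - (LINT x|meas m1. g (convex_comb t m1 m2) x))) \<and>
     (\<forall>m. (LINT x|meas m. g m x) = 0)"

definition C1 :: "('n::finite ptorus \<Rightarrow> real) \<Rightarrow> bool" where
  "C1 \<Phi> \<longleftrightarrow> (\<exists>g. is_flat_deriv \<Phi> g)"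

text \<open>The normalization makes the derivative unique.\<close>

definition flat_deriv :: "('n::finite ptorus \<Rightarrow> real) \<Rightarrow> 'n ptorus \<Rightarrow> 'n torus \<Rightarrow> real" where
  "flat_deriv \<Phi> = (SOME g. is_flat_deriv \<Phi> g)"

definition C2 :: "('n::finite ptorus \<Rightarrow> real) \<Rightarrow> bool" where
  "C2 \<Phi> \<longleftrightarrow> C1 \<Phi> \<and> (\<exists>g2. continuous_on UNIV (\<lambda>(m, x, y). g2 m x y) \<and>
     (\<forall>x. is_flat_deriv (\<lambda>m. flat_deriv \<Phi> m x) (\<lambda>m y. g2 m x y)))"

definition Dm :: "('n::finite ptorus \<Rightarrow> real) \<Rightarrow> 'n ptorus \<Rightarrow> 'n torus \<Rightarrow> real ^ 'n" where
  "Dm \<Phi> m x = tgrad (flat_deriv \<Phi> m) x"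

definition C11 :: "('n::finite ptorus \<Rightarrow> real) \<Rightarrow> bool" where
  "C11 \<Phi> \<longleftrightarrow> C1 \<Phi> \<and> (\<forall>m. tdifferentiable (flat_deriv \<Phi> m)) \<and>
     (\<forall>i k. Ck_space k (\<lambda>m x. Dm \<Phi> m x $ i))"


section \<open>Standing assumptions\<close>

definition Hamiltonian_assms :: "('n::finite torus \<Rightarrow> real ^ 'n \<Rightarrow> real) \<Rightarrow> bool" where
  "Hamiltonian_assms H \<longleftrightarrow>
     Ck 2 (\<lambda>(z :: real ^ 'n, p). H (to_torus z) p) \<and>
     (\<exists>L. \<forall>x p q. norm (hess (H x) p - hess (H x) q) \<le> L * norm (p - q)) \<and>
     (\<exists>Cb>0. \<forall>x p \<xi>. inverse Cb * (\<xi> \<bullet> \<xi>) \<le> \<xi> \<bullet> (hess (H x) p *v \<xi>) \<and>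
        \<xi> \<bullet> (hess (H x) p *v \<xi>) \<le> Cb * (\<xi> \<bullet> \<xi>)) \<and>
     (\<exists>\<theta> K. 0 < \<theta> \<and> \<theta> < 1 \<and> 0 < K \<and> (\<forall>x p.
        norm (thess (\<lambda>y. H y p) x) \<le> K * (1 + norm p) powr (1 + \<theta>) \<and>
        norm (\<chi> i. tgrad (\<lambda>y. grad (H y) p $ i) x) \<le> K * (1 + norm p) powr \<theta>))"

definition potential_assms :: "('n::finite ptorus \<Rightarrow> real) \<Rightarrow> bool" where
  "potential_assms F \<longleftrightarrow> C2 F \<and>
     (\<forall>m. tdifferentiable (flat_deriv F m) \<and>
        (\<forall>i. tdifferentiable (\<lambda>x. tgrad (flat_deriv F m) x $ i))) \<and>
     (\<exists>K. \<forall>m x. norm (thess (flat_deriv F m) x) \<le> K)"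

definition Hstar :: "('n::finite torus \<Rightarrow> real ^ 'n \<Rightarrow> real) \<Rightarrow> 'n torus \<Rightarrow> real ^ 'n \<Rightarrow> real" where
  "Hstar H x a = (SUP p. a \<bullet> p - H x p)"


section \<open>The discounted problem\<close>

text \<open>Test functions in \<open>C\<^sub>c\<^sup>\<infinity>((0,\<infinity>) \<times> T\<^sup>d)\<close>.\<close>

definition test_function :: "(real \<Rightarrow> 'n::finite torus \<Rightarrow> real) \<Rightarrow> bool" where
  "test_function \<phi> \<longleftrightarrow> smooth (\<lambda>(t, z :: real ^ 'n). \<phi> t (to_torus z)) \<and>
     (\<exists>a b. 0 < a \<and> (\<forall>t x. t \<notin> {a..b} \<longrightarrow> \<phi> t x = 0))"

text \<open>Distributional solutions of \<open>-\<partial>\<^sub>t m + \<Delta> m + div(m \<alpha>) = 0\<close> on \<open>(0,\<infinity>) \<times> T\<^sup>d\<close>.\<close>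

definition fokker_planck ::
    "(real \<Rightarrow> 'n::finite ptorus) \<Rightarrow> (real \<Rightarrow> 'n torus \<Rightarrow> real ^ 'n) \<Rightarrow> bool" where
  "fokker_planck m \<alpha> \<longleftrightarrow> (\<forall>\<phi>. test_function \<phi> \<longrightarrow>
     (LINT t:{0..}|lborel. (LINT x|meas (m t).
        deriv (\<lambda>s. \<phi> s x) t + tlap (\<phi> t) x - tgrad (\<phi> t) x \<bullet> \<alpha> t x)) = 0)"

definition admissible :: "real \<Rightarrow> 'n::finite ptorus \<Rightarrow>
    (real \<Rightarrow> 'n ptorus) \<Rightarrow> (real \<Rightarrow> 'n torus \<Rightarrow> real ^ 'n) \<Rightarrow> bool" where
  "admissible \<delta> m0 m \<alpha> \<longleftrightarrow>
     continuous_on {0..} m \<and>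
     (\<lambda>(t, x). \<alpha> t x) \<in> borel_measurable (restrict_space borel ({0..} \<times> UNIV)) \<and>
     (\<integral>\<^sup>+t\<in>{0..}. (\<integral>\<^sup>+x. ennreal (exp (- \<delta> * t) * (norm (\<alpha> t x))\<^sup>2) \<partial>meas (m t)) \<partial>lborel) < \<infinity> \<and>
     fokker_planck m \<alpha> \<and> m 0 = m0"

definition discounted_cost :: "('n::finite torus \<Rightarrow> real ^ 'n \<Rightarrow> real) \<Rightarrow> ('n ptorus \<Rightarrow> real) \<Rightarrow>
    real \<Rightarrow> (real \<Rightarrow> 'n ptorus) \<Rightarrow> (real \<Rightarrow> 'n torus \<Rightarrow> real ^ 'n) \<Rightarrow> real" where
  "discounted_cost H F \<delta> m \<alpha> = (LINT t:{0..}|lborel.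
     exp (- \<delta> * t) * ((LINT x|meas (m t). Hstar H x (\<alpha> t x)) + F (m t)))"

definition discounted_value :: "('n::finite torus \<Rightarrow> real ^ 'n \<Rightarrow> real) \<Rightarrow> ('n ptorus \<Rightarrow> real) \<Rightarrow>
    real \<Rightarrow> 'n ptorus \<Rightarrow> real" where
  "discounted_value H F \<delta> m0 = Inf {discounted_cost H F \<delta> m \<alpha> | m \<alpha>. admissible \<delta> m0 m \<alpha>}"

definition minimizer :: "('n::finite torus \<Rightarrow> real ^ 'n \<Rightarrow> real) \<Rightarrow> ('n ptorus \<Rightarrow> real) \<Rightarrow>
    real \<Rightarrow> 'n ptorus \<Rightarrow> (real \<Rightarrow> 'n ptorus) \<Rightarrow> (real \<Rightarrow> 'n torus \<Rightarrow> real ^ 'n) \<Rightarrow> bool" where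
  "minimizer H F \<delta> m0 m \<alpha> \<longleftrightarrow> admissible \<delta> m0 m \<alpha> \<and>
     (\<forall>m' \<alpha>'. admissible \<delta> m0 m' \<alpha>' \<longrightarrow> discounted_cost H F \<delta> m \<alpha> \<le> discounted_cost H F \<delta> m' \<alpha>')"

definition critical_value :: "('n::finite torus \<Rightarrow> real ^ 'n \<Rightarrow> real) \<Rightarrow> ('n ptorus \<Rightarrow> real) \<Rightarrow>
    real \<Rightarrow> bool" where
  "critical_value H F lam \<longleftrightarrow>
     uniform_limit UNIV (\<lambda>\<delta> m0. \<delta> * discounted_value H F \<delta> m0) (\<lambda>_. - lam) (at_right 0)"


section \<open>The compact set of feedbacks\<close>

definition weak_jacobian ::
    "('n::finite torus \<Rightarrow> real ^ 'n) \<Rightarrow> ('n torus \<Rightarrow> real ^ 'n ^ 'n) \<Rightarrow> bool" where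
  "weak_jacobian u G \<longleftrightarrow> (\<forall>\<phi> :: real ^ 'n \<Rightarrow> real. smooth \<phi> \<and> (\<exists>R. \<forall>z. R < norm z \<longrightarrow> \<phi> z = 0) \<longrightarrow>
     (\<forall>i j. (LINT z|lborel. u (to_torus z) $ i * grad \<phi> z $ j) =
        - (LINT z|lborel. G (to_torus z) $ i $ j * \<phi> z)))"

text \<open>Elements of \<open>W\<^sup>1\<^sup>,\<^sup>\<infinity>\<close> are identified with their continuous representatives. The norm of
  \<^typ>\<open>'a \<Rightarrow>\<^sub>C 'b\<close> is the supremum norm, so its topology is that of uniform convergence.\<close>

definition feedbacks :: "real \<Rightarrow> ('n::finite torus \<Rightarrow>\<^sub>C (real ^ 'n)) set" where
  "feedbacks C = {\<alpha>. \<exists>G \<in> borel_measurable borel. weak_jacobian (apply_bcontfun \<alpha>) G \<and>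
     ereal (norm \<alpha>) + esssup lborel (\<lambda>z. ereal (norm (G (to_torus z)))) \<le> ereal C}"

definition PE_borel :: "real \<Rightarrow> ('n::finite ptorus \<times> ('n torus \<Rightarrow>\<^sub>C (real ^ 'n))) measure" where
  "PE_borel C = restrict_space borel (UNIV \<times> feedbacks C)"

definition occupation :: "real \<Rightarrow> real \<Rightarrow> (real \<Rightarrow> 'n::finite ptorus) \<Rightarrow>
    (real \<Rightarrow> ('n torus \<Rightarrow>\<^sub>C (real ^ 'n))) \<Rightarrow> ('n ptorus \<times> ('n torus \<Rightarrow>\<^sub>C (real ^ 'n))) measure" where
  "occupation C \<delta> m a = distr (density (restrict_space lborel {0..}) (\<lambda>s. ennreal (\<delta> * exp (- \<delta> * s))))
     (PE_borel C) (\<lambda>s. (m s, a s))"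

definition weak_limit :: "real \<Rightarrow> (nat \<Rightarrow> ('n::finite ptorus \<times> ('n torus \<Rightarrow>\<^sub>C (real ^ 'n))) measure) \<Rightarrow>
    ('n ptorus \<times> ('n torus \<Rightarrow>\<^sub>C (real ^ 'n))) measure \<Rightarrow> bool" where
  "weak_limit C \<nu>s \<nu> \<longleftrightarrow> (\<forall>f :: _ \<Rightarrow> real. continuous_on (UNIV \<times> feedbacks C) f \<and>
     bounded (f ` (UNIV \<times> feedbacks C)) \<longrightarrow>
     (\<lambda>k. LINT z|\<nu>s k. f z) \<longlonglongrightarrow> (LINT z|\<nu>. f z))"

definition disintegration :: "real \<Rightarrow> ('n::finite ptorus \<times> ('n torus \<Rightarrow>\<^sub>C (real ^ 'n))) measure \<Rightarrow>
    'n ptorus measure \<Rightarrow> ('n ptorus \<Rightarrow> ('n torus \<Rightarrow>\<^sub>C (real ^ 'n)) measure) \<Rightarrow> bool" where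
  "disintegration C \<nu> \<mu> \<kappa> \<longleftrightarrow>
     \<kappa> \<in> borel \<rightarrow>\<^sub>M prob_algebra (restrict_space borel (feedbacks C)) \<and>
     (\<forall>A\<in>sets (PE_borel C). emeasure \<nu> A = (\<integral>\<^sup>+m. emeasure (\<kappa> m) {\<alpha>. (m, \<alpha>) \<in> A} \<partial>\<mu>))"


section \<open>Mather measures\<close>

text \<open>The measure \<open>m(dy) \<mu>(dm)\<close>.\<close>

definition dm_otimes :: "'n::finite ptorus measure \<Rightarrow> ('n ptorus \<times> 'n torus) measure" where
  "dm_otimes \<mu> = \<mu> \<bind> (\<lambda>m. distr (meas m) borel (\<lambda>y. (m, y)))"

definition vector_measure :: "'a measure \<Rightarrow> ('a set \<Rightarrow> 'b::real_normed_vector) \<Rightarrow> bool" where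
  "vector_measure M p \<longleftrightarrow> p {} = 0 \<and>
     (\<forall>A :: nat \<Rightarrow> 'a set. range A \<subseteq> sets M \<and> disjoint_family A \<longrightarrow>
        (\<lambda>i. p (A i)) sums p (\<Union>i. A i))"

definition abs_continuous :: "'a measure \<Rightarrow> ('a set \<Rightarrow> 'b::real_normed_vector) \<Rightarrow> bool" where
  "abs_continuous M p \<longleftrightarrow> (\<forall>A\<in>null_sets M. p A = 0)"

text \<open>The Radon-Nikodym derivative of a vector measure; it is determined up to a null set.\<close>

definition vec_RN_deriv :: "'a measure \<Rightarrow> ('a set \<Rightarrow> 'b::{banach, second_countable_topology}) \<Rightarrow> 'a \<Rightarrow> 'b" where
  "vec_RN_deriv M p = (SOME w. integrable M w \<and> (\<forall>A\<in>sets M. p A = (LINT x:A|M. w x)))"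

text \<open>In the closedness condition, integration against \<open>p\<close> is integration against its density.\<close>

definition closed_couple ::
    "'n::finite ptorus measure \<Rightarrow> (('n ptorus \<times> 'n torus) set \<Rightarrow> real ^ 'n) \<Rightarrow> bool" where
  "closed_couple \<mu> p \<longleftrightarrow>
     prob_space \<mu> \<and> sets \<mu> = sets borel \<and>
     vector_measure borel p \<and> abs_continuous (dm_otimes \<mu>) p \<and>
     (\<forall>\<Phi>. C11 \<Phi> \<longrightarrow>
        - (LINT z|dm_otimes \<mu>. Dm \<Phi> (fst z) (snd z) \<bullet> vec_RN_deriv (dm_otimes \<mu>) p z)
        + (LINT z|dm_otimes \<mu>. tdiv (Dm \<Phi> (fst z)) (snd z)) = 0)"

text \<open>The Lebesgue integral with values in the extended reals, needed because \<open>H\<^sup>*\<close> grows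
  quadratically while the density of \<open>p\<close> is only integrable: the action may be \<open>\<infinity>\<close>.
  As \<open>H\<^sup>*\<close> is bounded below, \<open>\<infinity> - \<infinity>\<close> does not occur.\<close>

definition ext_integral :: "'a measure \<Rightarrow> ('a \<Rightarrow> ereal) \<Rightarrow> ereal" where
  "ext_integral M f = enn2ereal (\<integral>\<^sup>+x. e2ennreal (f x) \<partial>M) - enn2ereal (\<integral>\<^sup>+x. e2ennreal (- f x) \<partial>M)"

definition action :: "('n::finite torus \<Rightarrow> real ^ 'n \<Rightarrow> real) \<Rightarrow> ('n ptorus \<Rightarrow> real) \<Rightarrow>
    'n ptorus measure \<Rightarrow> (('n ptorus \<times> 'n torus) set \<Rightarrow> real ^ 'n) \<Rightarrow> ereal" where
  "action H F \<mu> p = ext_integral \<mu> (\<lambda>m.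
     ext_integral (meas m) (\<lambda>y. ereal (Hstar H y (vec_RN_deriv (dm_otimes \<mu>) p (m, y)))) + ereal (F m))"

definition Mather_measure :: "('n::finite torus \<Rightarrow> real ^ 'n \<Rightarrow> real) \<Rightarrow> ('n ptorus \<Rightarrow> real) \<Rightarrow>
    'n ptorus measure \<Rightarrow> (('n ptorus \<times> 'n torus) set \<Rightarrow> real ^ 'n) \<Rightarrow> bool" where
  "Mather_measure H F \<mu> p \<longleftrightarrow> closed_couple \<mu> p \<and>
     (\<forall>\<mu>' p'. closed_couple \<mu>' p' \<longrightarrow> action H F \<mu> p \<le> action H F \<mu>' p')"

definition min_action :: "('n::finite torus \<Rightarrow> real ^ 'n \<Rightarrow> real) \<Rightarrow> ('n ptorus \<Rightarrow> real) \<Rightarrow> ereal" where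
  "min_action H F = Inf {action H F \<mu> p | \<mu> p. closed_couple \<mu> p}"

definition limit_flux :: "'n::finite ptorus measure \<Rightarrow>
    ('n ptorus \<Rightarrow> ('n torus \<Rightarrow>\<^sub>C (real ^ 'n)) measure) \<Rightarrow> ('n ptorus \<times> 'n torus) set \<Rightarrow> real ^ 'n" where
  "limit_flux \<mu> \<kappa> A = (LINT m|\<mu>. (LINT \<alpha>|\<kappa> m. (LINT y|meas m.
     indicator A (m, y) *\<^sub>R apply_bcontfun \<alpha> y)))"

end

theory Submission
  imports Defs
begin

text \<open>
  The occupation measure of an optimal trajectory records its
  discounted average position in \<open>P(T\<^sup>d) \<times> E\<close>. Two averages along the trajectory are known up to an error
  that vanishes with \<open>\<delta>\<close>, and both survive in the weak limit \<open>\<nu>\<close>.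

  The limit couple is closed for the following reason. For \<open>\<Phi>\<close> of class \<open>C\<^sup>1\<^sup>,\<^sup>1\<close>, the function \<open>t \<mapsto> \<Phi>(m(t))\<close> has the derivative \<open>L\<Phi>(m(t), \<alpha>(t))\<close> with
  \<open>L\<Phi>(m, \<alpha>) = \<integral> (div D\<^sub>m\<Phi>(m, y) - D\<^sub>m\<Phi>(m, y) \<bullet> \<alpha>(y)) m(dy)\<close> (\<open>chain_rule\<close>). Integration by parts shows that its
  discounted average is at most \<open>2 \<delta> sup \<bar>\<Phi>\<bar>\<close> (\<open>discounted_derivative_bound\<close>), so \<open>\<integral> L\<Phi> d\<nu> = 0\<close>. Since \<open>L\<Phi>\<close> is
  affine in \<open>\<alpha>\<close>, the feedback may be replaced by its mean over the fibre \<open>\<nu>\<^sub>m\<close>, which is the density of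
  the flux \<open>p\<^sub>1\<close>; this is the closedness identity (\<open>closedness_defect\<close>).

  It is also minimal. The discounted average of the running cost is \<open>\<delta> V\<^sub>\<delta>(m\<^sub>0)\<close> and tends to \<open>- \<lambda>\<close>. In the limit,
  \<open>\<integral> (\<integral> H\<^sup>*(y, \<alpha>(y)) m(dy) + F(m)) d\<nu> = - \<lambda>\<close>. As \<open>H\<^sup>*\<close> is convex in \<open>\<alpha>\<close>, passing to the mean feedback cannot
  increase the cost (\<open>action_limit_flux_le\<close>), so the action of the limit couple is at most \<open>- \<lambda>\<close>, the
  minimum over all closed couples.

  Weak convergence applies to bounded continuous integrands. Boundedness rests on the sequential
  compactness of \<open>P(T\<^sup>d)\<close> (\<open>ptorus_seq_compact\<close>), which is transported from the real line by a space-filling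
  curve with a Borel right inverse: on the line, the theorems of Helly and Skorohod provide couplings
  of vanishing cost. Continuity of \<open>H\<^sup>*\<close> comes from the uniform convexity of \<open>H\<close> (\<open>continuous_Hstar\<close>).

  The chain rule uses the distributional Fokker-Planck equation only for products of a function of time and
  a function \<open>\<psi>\<close> of space: then \<open>\<integral> \<psi> dm(t)\<close> has a continuous weak derivative, hence is continuously
  differentiable (\<open>fokker_planck_derivative\<close>). The flat derivatives of \<open>\<Phi>\<close> at convex combinations of \<open>m(t)\<close>
  and \<open>m(s)\<close> serve as \<open>\<psi>\<close>, and all these combinations tend to \<open>m(t)\<close> as \<open>s\<close> tends to \<open>t\<close>.
\<close>

section \<open>Topology of the torus\<close>

lemma dist_to_torus: "dist (to_torus x) W = infdist x {y. to_torus y = W}"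
  unfolding dist_torus_def by (rule setdist_fibre)

lemma dist_to_torus_le: "dist (to_torus x) (to_torus y) \<le> dist x y"
  unfolding dist_to_torus by (rule infdist_le) simp

lemma dist_to_torus_less_lift:
  assumes "dist (to_torus x) W < e"
  obtains y where "to_torus y = W" "dist x y < e"
proof -
  have ne: "{y. to_torus y = W} \<noteq> {}" using to_torus_rep by blast
  have "(INF y\<in>{y. to_torus y = W}. dist x y) < e"
    using assms ne unfolding dist_to_torus by (simp add: infdist_notempty)
  then obtain y where "y \<in> {y. to_torus y = W}" "dist x y < e"
    using ne by (subst (asm) cINF_less_iff) auto
  then show thesis using that by blast
qed

lemma continuous_to_torus: "continuous_on S to_torus"
  unfolding continuous_on_iff by (meson dist_to_torus_le order_le_less_trans)

text \<open>The distance on the quotient is an infimum over all lifts, so a point at distance less than \<open>e\<close>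
  from \<open>to_torus x\<close> has a lift at distance less than \<open>e\<close> from \<open>x\<close>. Hence the projection is open as
  well as continuous, and topological questions on the torus become questions on Euclidean space.\<close>

lemma open_to_torus_image:
  assumes "open U"
  shows "open (to_torus ` U)"
  unfolding open_dist
proof safe
  fix x assume "x \<in> U"
  then obtain e where e: "e > 0" "ball x e \<subseteq> U" using assms openE by blast
  have "Y \<in> to_torus ` U" if "dist Y (to_torus x) < e" for Y
  proof -
    have "dist (to_torus x) Y < e" using that by (simp add: dist_commute)
    then obtain y where "to_torus y = Y" "dist x y < e" by (rule dist_to_torus_less_lift)
    then show ?thesis using e by force
  qed
  then show "\<exists>e>0. \<forall>Y. dist Y (to_torus x) < e \<longrightarrow> Y \<in> to_torus ` U" using e by blast
qed

lemma to_torus_frac: "to_torus (\<chi> i. frac (x $ i)) = to_torus x"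
  by (simp add: to_torus_eq_iff lattice_equiv_def frac_def)

lemma compact_torus: "compact (UNIV :: 'n::finite torus set)"
proof -
  have "X \<in> to_torus ` cbox 0 1" for X :: "'n torus"
  proof
    show "X = to_torus (\<chi> i. frac (rep_torus X $ i))" by (simp add: to_torus_frac)
    show "(\<chi> i. frac (rep_torus X $ i)) \<in> cbox 0 1"
      by (auto simp: mem_box_cart less_imp_le frac_lt_1)
  qed
  then have "(UNIV :: 'n torus set) = to_torus ` cbox 0 1" by blast
  then show ?thesis
    by (metis compact_cbox compact_continuous_image continuous_to_torus)
qed

instance torus :: (finite) second_countable_topology
proof
  obtain B :: "(real ^ 'a) set set" where B: "countable B" "topological_basis B"
    using ex_countable_basis by blast
  have "topological_basis ((`) to_torus ` B :: 'a torus set set)"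
  proof (rule topological_basisI)
    show "open U" if "U \<in> (`) to_torus ` B" for U :: "'a torus set"
      using that B(2) open_to_torus_image topological_basis_open by blast
    fix O' :: "'a torus set" and x assume O': "open O'" "x \<in> O'"
    have "open (to_torus -` O')"
      using O'(1) continuous_to_torus open_vimage by blast
    moreover have "rep_torus x \<in> to_torus -` O'" using O' by simp
    ultimately obtain U where "U \<in> B" "rep_torus x \<in> U" "U \<subseteq> to_torus -` O'"
      using B(2) topological_basisE by blast
    then show "\<exists>B'\<in>(`) to_torus ` B. x \<in> B' \<and> B' \<subseteq> O'"
      by (intro bexI [of _ "to_torus ` U"]) (auto intro: rev_image_eqI)
  qed
  then have "open = generate_topology ((`) to_torus ` B :: 'a torus set set)"
    by (intro ext) (metis topological_basis_imp_subbasis)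
  then show "\<exists>B::'a torus set set. countable B \<and> open = generate_topology B"
    using B(1) by blast
qed

text \<open>If one factor has a countable basis, an open set is a countable union of open rectangles: for each
  basis element take the union of all open sets whose product with it stays inside. The first factor
  will be a space of measures or of functions, about which only its topology enters.\<close>

lemma sets_borel_Times:
  "sets (borel :: ('a::topological_space \<times> 'b::second_countable_topology) measure)
    = sets (borel \<Otimes>\<^sub>M borel)"
proof
  obtain B :: "'b set set" where B: "countable B" "topological_basis B"
    using ex_countable_basis by blast
  have opens: "U \<in> sets (borel \<Otimes>\<^sub>M borel)" if U: "open U" for U :: "('a \<times> 'b) set"
  proof -
    define V where "V b = \<Union> {A. open A \<and> A \<times> b \<subseteq> U}" for b
    have "U = (\<Union>b\<in>B. V b \<times> b)"
    proof
      show "U \<subseteq> (\<Union>b\<in>B. V b \<times> b)"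
      proof
        fix z assume "z \<in> U"
        then obtain P Q where PQ: "open P" "open Q" "z \<in> P \<times> Q" "P \<times> Q \<subseteq> U"
          using U open_prod_elim by metis
        then have "snd z \<in> Q" by (simp add: mem_Times_iff)
        then obtain b where b: "b \<in> B" "snd z \<in> b" "b \<subseteq> Q"
          using topological_basisE [OF B(2) PQ(2)] by blast
        then have "P \<times> b \<subseteq> U" using PQ(4) by (meson Sigma_mono order_refl order_trans)
        then have "fst z \<in> V b"
          using PQ(1,3) unfolding V_def by (intro UnionI [of P]) (auto simp: mem_Times_iff)
        then show "z \<in> (\<Union>b\<in>B. V b \<times> b)"
          using b by (intro UN_I [of b]) (auto simp: mem_Times_iff)
      qed
      show "(\<Union>b\<in>B. V b \<times> b) \<subseteq> U" unfolding V_def by blast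
    qed
    moreover have "open (V b)" for b unfolding V_def by blast
    then have "V b \<times> b \<in> sets (borel \<Otimes>\<^sub>M borel)" if "b \<in> B" for b
      using topological_basis_open [OF B(2) that] by (intro pair_measureI borel_open)
    then have "(\<Union>b\<in>B. V b \<times> b) \<in> sets (borel \<Otimes>\<^sub>M borel)"
      using B(1) by (rule sets.countable_UN'' [rotated])
    ultimately show ?thesis by simp
  qed
  have "sigma_sets UNIV {U :: ('a \<times> 'b) set. open U} \<subseteq> sets (borel \<Otimes>\<^sub>M borel)"
    using opens sets.sigma_sets_subset [of "{U. open U}" "borel \<Otimes>\<^sub>M borel :: ('a \<times> 'b) measure"]
    by (simp add: space_pair_measure subset_iff)
  then show "sets (borel :: ('a \<times> 'b) measure) \<subseteq> sets (borel \<Otimes>\<^sub>M borel)"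
    unfolding sets_borel [where 'a = "'a \<times> 'b"] .
  have "fst \<in> (borel :: ('a \<times> 'b) measure) \<rightarrow>\<^sub>M borel" "snd \<in> (borel :: ('a \<times> 'b) measure) \<rightarrow>\<^sub>M borel"
    by (intro borel_measurable_continuous_onI continuous_intros)+
  then have "(\<lambda>z. (fst z, snd z)) \<in> (borel :: ('a \<times> 'b) measure) \<rightarrow>\<^sub>M borel \<Otimes>\<^sub>M borel"
    by (rule measurable_Pair)
  then have id: "(\<lambda>z. z) \<in> (borel :: ('a \<times> 'b) measure) \<rightarrow>\<^sub>M borel \<Otimes>\<^sub>M borel" by simp
  show "sets (borel \<Otimes>\<^sub>M borel) \<subseteq> sets (borel :: ('a \<times> 'b) measure)"
  proof
    show "A \<in> sets borel" if "A \<in> sets (borel \<Otimes>\<^sub>M borel)" for A :: "('a \<times> 'b) set"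
      using measurable_sets [OF id that] by simp
  qed
qed

section \<open>Integrals as functions of the measure\<close>

lemma prob_space_meas: "prob_space (meas m)"
  and sets_meas [simp, measurable_cong]: "sets (meas m) = sets borel"
  using meas [of m] by simp_all

lemma space_meas [simp]: "space (meas m) = UNIV"
  using sets_eq_imp_space_eq [OF sets_meas] by simp

lemma prob_meas_UNIV [simp]: "measure (meas m) UNIV = 1"
  using prob_space.prob_space [OF prob_space_meas, of m] by simp

lemma torus_bounded:
  fixes f :: "'n::finite torus \<Rightarrow> 'b::real_normed_vector"
  assumes "continuous_on UNIV f"
  obtains B where "B \<ge> 0" "\<And>x. norm (f x) \<le> B"
proof -
  have "bounded (range f)"
    using assms compact_torus compact_continuous_image compact_imp_bounded by blast
  then obtain B where B: "\<And>x. norm (f x) \<le> B" unfolding bounded_iff by auto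
  then have "B \<ge> 0" using norm_ge_zero order_trans by blast
  then show thesis using B that by blast
qed

lemma measurable_torus:
  fixes f :: "'n::finite torus \<Rightarrow> 'b::topological_space"
  assumes "continuous_on UNIV f"
  shows "f \<in> meas m \<rightarrow>\<^sub>M borel"
  using borel_measurable_continuous_onI [OF assms] by simp

lemma integrable_meas:
  fixes f :: "'n::finite torus \<Rightarrow> 'b::{banach, second_countable_topology}"
  assumes "continuous_on UNIV f"
  shows "integrable (meas m) f"
proof -
  interpret prob_space "meas m" by (rule prob_space_meas)
  obtain B where "\<And>x. norm (f x) \<le> B" using torus_bounded [OF assms] by blast
  then show ?thesis
    using measurable_torus [OF assms] by (intro integrable_const_bound [of _ B]) auto
qed

lemma abs_integral_meas_le:
  fixes f :: "'n::finite torus \<Rightarrow> real"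
  assumes "continuous_on UNIV f" "\<And>x. \<bar>f x\<bar> \<le> B"
  shows "\<bar>LINT x|meas m. f x\<bar> \<le> B"
proof -
  interpret prob_space "meas m" by (rule prob_space_meas)
  have "\<bar>LINT x|meas m. f x\<bar> \<le> (LINT x|meas m. \<bar>f x\<bar>)" by (rule integral_abs_bound)
  also have "\<dots> \<le> (LINT x|meas m. B)"
    using assms by (intro integral_mono integrable_abs integrable_meas) auto
  finally show ?thesis by simp
qed

text \<open>On the torus \<open>f\<close> is uniformly continuous and bounded, so \<open>\<bar>f y - f x\<bar> \<le> \<epsilon> + K * dist x y\<close>: the first
  summand covers nearby points and the second one distant points. The bound follows by integration
  against a coupling of almost minimal cost.\<close>

lemma wasserstein_integral_bound:
  fixes f :: "'n::finite torus \<Rightarrow> real"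
  assumes f: "continuous_on UNIV f" and "\<epsilon> > 0"
  obtains K where "K \<ge> 0"
    "\<And>m m' e. e > 0 \<Longrightarrow> wasserstein m m' < ennreal e \<Longrightarrow> 
       \<bar>(LINT x|meas m'. f x) - (LINT x|meas m. f x)\<bar> \<le> \<epsilon> + K * e"
proof -
  obtain B where B: "B \<ge> 0" "\<And>x. norm (f x) \<le> B" using torus_bounded [OF f] by blast
  have "uniformly_continuous_on UNIV f"
    using f compact_torus compact_uniformly_continuous by blast
  then obtain d where d: "d > 0" "\<And>x y. dist x y < d \<Longrightarrow> dist (f x) (f y) < \<epsilon>"
    using \<open>\<epsilon> > 0\<close> unfolding uniformly_continuous_on_def by (metis UNIV_I)
  define K where "K = 2 * B / d"
  have K: "K \<ge> 0" using B d by (simp add: K_def)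
  have le: "\<bar>f y - f x\<bar> \<le> \<epsilon> + K * dist x y" for x y
  proof (cases "dist x y < d")
    case True
    then have "\<bar>f y - f x\<bar> < \<epsilon>" using d(2) [of x y] by (simp add: dist_real_def abs_minus_commute)
    moreover have "K * dist x y \<ge> 0" using K by simp
    ultimately show ?thesis by linarith
  next
    case False
    then have "2 * B \<le> K * dist x y"
      using d(1) B(1) by (simp add: K_def field_simps mult_left_mono)
    then show ?thesis using B(2) [of x] B(2) [of y] \<open>\<epsilon> > 0\<close> by (simp add: abs_if split: if_splits)
  qed
  have "\<bar>(LINT x|meas m'. f x) - (LINT x|meas m. f x)\<bar> \<le> \<epsilon> + K * e"
    if "e > 0" and W: "wasserstein m m' < ennreal e" for m m' e
  proof -
    obtain \<pi> where \<pi>: "\<pi> \<in> couplings m m'"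
      and lt: "(\<integral>\<^sup>+z. ennreal (dist (fst z) (snd z)) \<partial>\<pi>) < ennreal e"
      using W unfolding wasserstein_def by (auto simp: INF_less_iff)
    have sets[measurable_cong]: "sets \<pi> = sets borel"
      and d1: "meas m = distr \<pi> borel fst" and d2: "meas m' = distr \<pi> borel snd"
      using \<pi> by (auto simp: couplings_def)
    have [simp]: "space \<pi> = UNIV" using sets_eq_imp_space_eq [OF sets] by simp
    have m1: "fst \<in> \<pi> \<rightarrow>\<^sub>M borel" and m2: "snd \<in> \<pi> \<rightarrow>\<^sub>M borel"
      unfolding measurable_cong_sets [OF sets refl]
      by (intro borel_measurable_continuous_onI continuous_intros)+
    have "prob_space (distr \<pi> borel fst)" using d1 prob_space_meas by metis
    then interpret prob_space \<pi> using prob_space_distrD [OF m1] by blast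
    have md: "(\<lambda>z. dist (fst z) (snd z)) \<in> borel_measurable \<pi>"
      unfolding measurable_cong_sets [OF sets refl]
      by (intro borel_measurable_continuous_onI continuous_intros)
    have id: "integrable \<pi> (\<lambda>z. dist (fst z) (snd z))"
    proof (rule integrableI_bounded [OF md])
      show "(\<integral>\<^sup>+z. ennreal (norm (dist (fst z) (snd z))) \<partial>\<pi>) < \<infinity>"
        using order.strict_trans [OF lt] by simp
    qed
    have ld: "(LINT z|\<pi>. dist (fst z) (snd z)) \<le> e"
    proof -
      have "ennreal (LINT z|\<pi>. dist (fst z) (snd z)) < ennreal e"
        using lt nn_integral_eq_integral [OF id] by simp
      then show ?thesis using \<open>e > 0\<close> by (simp add: ennreal_less_iff)
    qed
    have b: "f \<in> borel_measurable borel" using f by (rule borel_measurable_continuous_onI)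
    have i1: "integrable \<pi> (\<lambda>z. f (fst z))" "integrable \<pi> (\<lambda>z. f (snd z))"
      using B(2) m1 m2 b by (auto intro!: integrable_const_bound [of _ B] measurable_compose [OF _ b])
    have "(LINT x|meas m'. f x) - (LINT x|meas m. f x) = (LINT z|\<pi>. f (snd z) - f (fst z))"
      unfolding d1 d2 using i1 m1 m2 b by (simp add: integral_distr)
    also have "\<bar>\<dots>\<bar> \<le> (LINT z|\<pi>. \<epsilon> + K * dist (fst z) (snd z))"
      using i1 id le by (intro order_trans [OF integral_abs_bound] integral_mono) auto
    also have "\<dots> = \<epsilon> + K * (LINT z|\<pi>. dist (fst z) (snd z))"
      using id prob_space by simp
    also have "\<dots> \<le> \<epsilon> + K * e" using ld K by (simp add: mult_left_mono)
    finally show ?thesis .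
  qed
  then show thesis using that K by blast
qed

lemma continuous_on_ptorusI:
  fixes F :: "'n::finite ptorus \<Rightarrow> real"
  assumes "\<And>m \<epsilon>. \<epsilon> > 0 \<Longrightarrow> \<exists>e>0. \<forall>m'. wasserstein m m' < ennreal e \<longrightarrow> \<bar>F m' - F m\<bar> < \<epsilon>"
  shows "continuous_on UNIV F"
  unfolding continuous_on_open_vimage [OF open_UNIV]
proof safe
  fix V :: "real set" assume V: "open V"
  show "open (F -` V \<inter> UNIV)"
    unfolding open_ptorus_def
  proof safe
    fix m assume "F m \<in> V"
    then obtain \<epsilon> where \<epsilon>: "\<epsilon> > 0" "\<And>y. dist y (F m) < \<epsilon> \<Longrightarrow> y \<in> V"
      using V unfolding open_dist by blast
    then show "\<exists>e>0. \<forall>m'. wasserstein m m' < ennreal e \<longrightarrow> m' \<in> F -` V \<inter> UNIV"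
      using assms [of \<epsilon> m] by (auto simp: dist_real_def)
  qed
qed

lemma continuous_integral_meas:
  fixes f :: "'n::finite torus \<Rightarrow> real"
  assumes "continuous_on UNIV f"
  shows "continuous_on UNIV (\<lambda>m. LINT x|meas m. f x)"
proof (rule continuous_on_ptorusI)
  fix m :: "'n ptorus" and \<epsilon> :: real assume \<epsilon>: "\<epsilon> > 0"
  obtain K where K: "K \<ge> 0" "\<And>m m' e. e > 0 \<Longrightarrow> wasserstein m m' < ennreal e \<Longrightarrow> 
       \<bar>(LINT x|meas m'. f x) - (LINT x|meas m. f x)\<bar> \<le> \<epsilon> / 3 + K * e"
    using wasserstein_integral_bound [OF assms, of "\<epsilon> / 3"] \<epsilon> by auto
  define e where "e = \<epsilon> / (3 * (K + 1))"
  have "e > 0" using K \<epsilon> by (simp add: e_def)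
  have "K * e \<le> \<epsilon> / 3" using K \<epsilon> by (simp add: e_def field_simps)
  then show "\<exists>e>0. \<forall>m'. wasserstein m m' < ennreal e \<longrightarrow>
      \<bar>(LINT x|meas m'. f x) - (LINT x|meas m. f x)\<bar> < \<epsilon>"
    using \<open>e > 0\<close> \<epsilon> by (intro exI [of _ e]) (auto dest!: K(2) [OF \<open>e > 0\<close>])
qed

lemma open_indicator_limit:
  fixes U :: "'a::metric_space set"
  assumes "open U"
  obtains f :: "nat \<Rightarrow> 'a \<Rightarrow> real" where "\<And>n. continuous_on UNIV (f n)"
    "\<And>n x. 0 \<le> f n x" "\<And>n x. f n x \<le> 1" "\<And>x. (\<lambda>n. f n x) \<longlonglongrightarrow> indicator U x"
proof (cases "U = UNIV")
  case True
  show thesis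
    by (rule that [of "\<lambda>_ _. 1"]) (use True in auto)
next
  case False
  define f where "f n x = min 1 (real n * infdist x (- U))" for n x
  show thesis
  proof (rule that [of f])
    show "continuous_on UNIV (f n)" for n unfolding f_def by (intro continuous_intros)
    show "0 \<le> f n x" for n x unfolding f_def by (simp add: infdist_nonneg)
    show "f n x \<le> 1" for n x unfolding f_def by simp
    show "(\<lambda>n. f n x) \<longlonglongrightarrow> indicator U x" for x
    proof (cases "x \<in> U")
      case True
      have "infdist x (- U) \<noteq> 0"
        using in_closed_iff_infdist_zero [of "- U" x] assms True \<open>U \<noteq> UNIV\<close> by auto
      then have pos: "infdist x (- U) > 0" using infdist_nonneg [of x "- U"] by linarith
      obtain N :: nat where N: "1 / infdist x (- U) \<le> real N" using real_arch_simple by blast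
      have "f n x = 1" if "n \<ge> N" for n
      proof -
        have "1 / infdist x (- U) \<le> real n" using N that by (meson of_nat_mono order_trans)
        then have "1 \<le> real n * infdist x (- U)" using pos by (simp add: field_simps)
        then show ?thesis by (simp add: f_def)
      qed
      then have "eventually (\<lambda>n. f n x = indicator U x) sequentially"
        using True unfolding eventually_sequentially by auto
      then show ?thesis by (rule tendsto_eventually)
    next
      case False
      then have "f n x = indicator U x" for n by (simp add: f_def)
      then show ?thesis by simp
    qed
  qed
qed

lemma measure_open_limit:
  fixes f :: "nat \<Rightarrow> 'n::finite torus \<Rightarrow> real"
  assumes U: "open U" and c: "\<And>n. continuous_on UNIV (f n)"
    and f: "\<And>n x. 0 \<le> f n x" "\<And>n x. f n x \<le> 1" "\<And>x. (\<lambda>n. f n x) \<longlonglongrightarrow> indicator U x"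
  shows "(\<lambda>n. LINT x|meas m. f n x) \<longlonglongrightarrow> measure (meas m) U"
proof -
  interpret prob_space "meas m" by (rule prob_space_meas)
  have [measurable]: "U \<in> sets (meas m)" using U by simp
  have "(\<lambda>n. LINT x|meas m. f n x) \<longlonglongrightarrow> (LINT x|meas m. indicator U x)"
    by (rule integral_dominated_convergence [where w = "\<lambda>_. 1"])
       (use f in \<open>auto intro: measurable_torus c borel_measurable_indicator\<close>)
  then show ?thesis using U by simp
qed

lemma Int_stable_open: "Int_stable {U. open U}"
  by (auto simp: Int_stable_def)

text \<open>Integrals of continuous functions approximate the measures of open sets, which form a
  generator of the Borel sets that is stable under intersection.\<close>

lemma ptorus_eqI:
  assumes "\<And>f :: 'n::finite torus \<Rightarrow> real. continuous_on UNIV f \<Longrightarrow> (LINT x|meas m. f x) = (LINT x|meas m'. f x)"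
  shows "m = m'"
proof -
  interpret m: prob_space "meas m" by (rule prob_space_meas)
  interpret m': prob_space "meas m'" by (rule prob_space_meas)
  have "meas m = meas m'"
  proof (rule measure_eqI_generator_eq [where E = "{U. open U}" and \<Omega> = UNIV and A = "\<lambda>_. UNIV"])
    fix U :: "'n torus set" assume "U \<in> {U. open U}"
    then have U: "open U" by simp
    then obtain f :: "nat \<Rightarrow> 'n torus \<Rightarrow> real" where f: "\<And>n. continuous_on UNIV (f n)"
      "\<And>n x. 0 \<le> f n x" "\<And>n x. f n x \<le> 1" "\<And>x. (\<lambda>n. f n x) \<longlonglongrightarrow> indicator U x"
      using open_indicator_limit by blast
    have "measure (meas m) U = measure (meas m') U"
      using measure_open_limit [OF U f, of m] measure_open_limit [OF U f, of m']
      using assms [OF f(1)] LIMSEQ_unique by fastforce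
    then show "emeasure (meas m) U = emeasure (meas m') U"
      by (simp add: m.emeasure_eq_measure m'.emeasure_eq_measure)
  qed (auto simp: Int_stable_open sets_borel)
  then show ?thesis by (simp add: meas_inject)
qed

text \<open>The measure of an open set is a pointwise limit of the continuous functions \<open>m \<mapsto> \<integral> f\<^sub>n dm\<close>, so it is a
  Borel function of the measure. This turns a random measure into a kernel, which makes iterated
  integrals such as \<open>m(dy) \<mu>(dm)\<close> available.\<close>

lemma measurable_meas: "meas \<in> borel \<rightarrow>\<^sub>M prob_algebra (borel :: 'n::finite torus measure)"
proof (rule measurable_prob_algebraI)
  show "meas \<in> borel \<rightarrow>\<^sub>M subprob_algebra (borel :: 'n torus measure)"
  proof (rule measurable_subprob_algebra_generated [where \<Omega> = UNIV and G = "{U. open U}"])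
    show "subprob_space (meas a)" for a :: "'n ptorus"
      using prob_space_meas prob_space_imp_subprob_space by blast
    have *: "(\<lambda>a. emeasure (meas a) U) \<in> borel_measurable borel" if U: "open U" for U :: "'n torus set"
    proof -
      obtain f :: "nat \<Rightarrow> 'n torus \<Rightarrow> real" where f: "\<And>n. continuous_on UNIV (f n)"
        "\<And>n x. 0 \<le> f n x" "\<And>n x. f n x \<le> 1" "\<And>x. (\<lambda>n. f n x) \<longlonglongrightarrow> indicator U x"
        using open_indicator_limit U by blast
      have "(\<lambda>a. measure (meas a) U) \<in> borel_measurable borel"
        by (rule borel_measurable_LIMSEQ_metric [where f = "\<lambda>n a. LINT x|meas a. f n x"])
          (use f in \<open>auto intro!: borel_measurable_continuous_onI continuous_integral_meas measure_open_limit U\<close>)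
      then have "(\<lambda>a. ennreal (measure (meas a) U)) \<in> borel_measurable borel" by simp
      moreover have "ennreal (measure (meas a) U) = emeasure (meas a) U" for a
        using finite_measure.emeasure_eq_measure [OF prob_space.finite_measure [OF prob_space_meas]] by metis
      ultimately show ?thesis by simp
    qed
    show "(\<lambda>a. emeasure (meas a) A) \<in> borel_measurable borel" if "A \<in> {U. open U}" for A :: "'n torus set"
      using that by (intro *) simp
    show "(\<lambda>a. emeasure (meas a) (UNIV :: 'n torus set)) \<in> borel_measurable borel"
      by (rule * [OF open_UNIV])
  qed (auto simp: Int_stable_open sets_borel)
qed (rule prob_space_meas)

lemma tendsto_ptorusI:
  assumes "\<And>e. e > 0 \<Longrightarrow> eventually (\<lambda>x. wasserstein L (M x) < ennreal e) F"
  shows "(M \<longlongrightarrow> L) F"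
proof (rule topological_tendstoI)
  fix U assume "open U" "L \<in> U"
  then obtain e where "e > 0" "\<forall>m'. wasserstein L m' < ennreal e \<longrightarrow> m' \<in> U"
    unfolding open_ptorus_def by blast
  then show "eventually (\<lambda>x. M x \<in> U) F"
    using assms [of e] by (auto elim: eventually_mono)
qed

text \<open>If continuity fails at \<open>m\<close>, there are measures at distance below \<open>1 / n\<close> from \<open>m\<close>, hence converging to
  \<open>m\<close>, that witness the failure. This reduces continuity to arguments with sequences, to which
  sequential compactness applies.\<close>

lemma continuous_on_ptorus_sequentiallyI:
  fixes F :: "'n::finite ptorus \<Rightarrow> real"
  assumes "\<And>M L. M \<longlonglongrightarrow> L \<Longrightarrow> (\<lambda>n. F (M n)) \<longlonglongrightarrow> F L"
  shows "continuous_on UNIV F"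
proof (rule continuous_on_ptorusI, rule ccontr)
  fix m and \<epsilon> :: real
  assume "\<epsilon> > 0" and neg: "\<not> (\<exists>e>0. \<forall>m'. wasserstein m m' < ennreal e \<longrightarrow> \<bar>F m' - F m\<bar> < \<epsilon>)"
  have "\<exists>m'. wasserstein m m' < ennreal (inverse (Suc n)) \<and> \<bar>F m' - F m\<bar> \<ge> \<epsilon>" for n
    using neg by (metis inverse_positive_iff_positive not_less of_nat_0_less_iff zero_less_Suc)
  then obtain M where M: "\<And>n. wasserstein m (M n) < ennreal (inverse (Suc n))"
    "\<And>n. \<bar>F (M n) - F m\<bar> \<ge> \<epsilon>" by metis
  have "M \<longlonglongrightarrow> m"
  proof (rule tendsto_ptorusI)
    fix e :: real assume "e > 0"
    then have "eventually (\<lambda>n. inverse (real (Suc n)) < e) sequentially"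
      using LIMSEQ_inverse_real_of_nat order_tendstoD(2) by blast
    then show "eventually (\<lambda>n. wasserstein m (M n) < ennreal e) sequentially"
      by eventually_elim (use M(1) in \<open>meson ennreal_leI less_imp_le order.strict_trans2\<close>)
  qed
  then have "(\<lambda>n. F (M n)) \<longlonglongrightarrow> F m" by (rule assms)
  then have "eventually (\<lambda>n. dist (F (M n)) (F m) < \<epsilon>) sequentially"
    using \<open>\<epsilon> > 0\<close> tendstoD by blast
  then show False using M(2) by (auto simp: dist_real_def eventually_sequentially not_less [symmetric])
qed

lemma continuous_on_slice:
  assumes "continuous_on UNIV (\<lambda>(a, y). g a y)"
  shows "continuous_on UNIV (g a)"
proof -
  have "continuous_on UNIV (\<lambda>y. (a, y))" by (intro continuous_on_Pair continuous_on_const continuous_on_id)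
  from continuous_on_compose2 [OF assms this] show ?thesis by simp
qed

text \<open>The pairs where the distance is less than \<open>\<epsilon>\<close> form an open set containing the compact fibre over \<open>a\<close>,
  hence a tube around that fibre.\<close>

lemma tube_uniform:
  fixes g :: "'a::topological_space \<Rightarrow> 'b::topological_space \<Rightarrow> 'c::metric_space"
  assumes g: "continuous_on UNIV (\<lambda>(a, y). g a y)" and K: "compact (UNIV :: 'b set)" and "\<epsilon> > 0"
  shows "\<exists>A. open A \<and> a \<in> A \<and> (\<forall>a'\<in>A. \<forall>y. dist (g a' y) (g a y) < \<epsilon>)"
proof -
  have g1: "continuous_on UNIV (\<lambda>z. g (fst z) (snd z))" using g by (simp add: case_prod_beta')
  have c: "continuous_on UNIV (\<lambda>z. dist (g (fst z) (snd z)) (g a (snd z)))"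
    using continuous_on_compose2 [OF continuous_on_slice [OF g] continuous_on_snd [OF continuous_on_id]]
    by (intro continuous_on_dist g1) auto
  have op: "open {z. dist (g (fst z) (snd z)) (g a (snd z)) < \<epsilon>}"
    using open_Collect_less [OF c continuous_on_const] .
  have sub: "{a} \<times> UNIV \<subseteq> {z. dist (g (fst z) (snd z)) (g a (snd z)) < \<epsilon>}"
    using \<open>\<epsilon> > 0\<close> by auto
  obtain A where "a \<in> A" "open A" "A \<times> UNIV \<subseteq> {z. dist (g (fst z) (snd z)) (g a (snd z)) < \<epsilon>}"
    using Elementary_Topology.tube_lemma [OF K op sub] by blast
  then have "dist (g a' y) (g a y) < \<epsilon>" if "a' \<in> A" for a' y
  proof -
    have "(a', y) \<in> {z. dist (g (fst z) (snd z)) (g a (snd z)) < \<epsilon>}"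
      by (rule subsetD [OF \<open>A \<times> UNIV \<subseteq> _\<close>]) (simp add: that)
    then show ?thesis by simp
  qed
  then show ?thesis using \<open>a \<in> A\<close> \<open>open A\<close> by blast
qed

text \<open>Costs, generators and flat derivatives are all integrals of this form. Near a parameter the integrand
  changes little uniformly on the torus, and the integral of the fixed integrand changes
  little because it is continuous in the measure.\<close>

lemma continuous_integral_param:
  fixes g :: "'a::topological_space \<Rightarrow> 'n::finite torus \<Rightarrow> real"
  assumes g: "continuous_on UNIV (\<lambda>(a, y). g a y)" and M: "continuous_on UNIV M"
  shows "continuous_on UNIV (\<lambda>a. LINT y|meas (M a). g a y)"
  unfolding continuous_on_def
proof safe
  fix a
  have ga: "continuous_on UNIV (g a)" for a
    using g by (rule continuous_on_slice)
  show "((\<lambda>a. LINT y|meas (M a). g a y) \<longlongrightarrow> (LINT y|meas (M a). g a y)) (at a within UNIV)"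
  proof (rule tendstoI)
    fix \<epsilon> :: real assume \<epsilon>: "\<epsilon> > 0"
    obtain A where A: "open A" "a \<in> A" "\<And>a' y. a' \<in> A \<Longrightarrow> dist (g a' y) (g a y) < \<epsilon> / 3"
      using tube_uniform [OF g compact_torus, of "\<epsilon> / 3" a] \<epsilon> by auto
    have "continuous_on UNIV (\<lambda>a'. LINT y|meas (M a'). g a y)"
      using continuous_on_compose2 [OF continuous_integral_meas [OF ga] M] by auto
    then have "((\<lambda>a'. LINT y|meas (M a'). g a y) \<longlongrightarrow> (LINT y|meas (M a). g a y)) (at a)"
      by (simp add: continuous_on_def)
    then have "eventually (\<lambda>a'. dist (LINT y|meas (M a'). g a y) (LINT y|meas (M a). g a y) < \<epsilon> / 3) (at a)"
      using \<epsilon> by (intro tendstoD) auto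
    moreover have "eventually (\<lambda>a'. a' \<in> A) (at a)"
      using A eventually_at_topological by blast
    ultimately show "eventually (\<lambda>a'. dist (LINT y|meas (M a'). g a' y) (LINT y|meas (M a). g a y) < \<epsilon>) (at a within UNIV)"
    proof eventually_elim
      case (elim a')
      have "\<bar>(LINT y|meas (M a'). g a' y) - (LINT y|meas (M a'). g a y)\<bar> = \<bar>LINT y|meas (M a'). g a' y - g a y\<bar>"
        using ga by (simp add: integrable_meas)
      also have "\<dots> \<le> \<epsilon> / 3"
        using A(3) [OF elim(2)] ga
        by (intro abs_integral_meas_le continuous_intros) (auto simp: dist_real_def less_imp_le)
      finally show ?case using elim(1) \<epsilon> unfolding dist_real_def by linarith
    qed
  qed
qed

section \<open>Compactness of the space of measures\<close>

definition bit_of :: "nat \<Rightarrow> real \<Rightarrow> real" where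
  "bit_of k x = of_int (\<lfloor>2 ^ Suc k * x\<rfloor> - 2 * \<lfloor>2 ^ k * x\<rfloor>)"

lemma bit_of_cases: "bit_of k x = 0 \<or> bit_of k x = 1"
proof -
  have "\<lfloor>2 ^ Suc k * x\<rfloor> - 2 * \<lfloor>2 ^ k * x\<rfloor> \<in> {0, 1}"
  proof -
    have "2 ^ Suc k * x = 2 * (2 ^ k * x)" by simp
    then show ?thesis by (simp only: insert_iff) linarith
  qed
  then show ?thesis unfolding bit_of_def by auto
qed

lemma sum_bit_of: "(\<Sum>k<n. bit_of k x / 2 ^ Suc k) = of_int \<lfloor>2 ^ n * x\<rfloor> / 2 ^ n - of_int \<lfloor>x\<rfloor>"
  by (induction n) (simp_all add: bit_of_def field_simps)

lemma bit_of_sums: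
  assumes "0 \<le> x" "x < 1"
  shows "(\<lambda>k. bit_of k x / 2 ^ Suc k) sums x"
proof -
  have fl: "\<lfloor>x\<rfloor> = 0" using assms by linarith
  have "(\<lambda>n. x - (1 / 2) ^ n) \<longlonglongrightarrow> x - 0"
    by (intro tendsto_intros LIMSEQ_power_zero) auto
  then have l: "(\<lambda>n. x - (1 / 2) ^ n) \<longlonglongrightarrow> x" by simp
  have "(\<lambda>n. of_int \<lfloor>2 ^ n * x\<rfloor> / 2 ^ n) \<longlonglongrightarrow> x"
  proof (rule tendsto_sandwich [OF always_eventually always_eventually l tendsto_const], safe)
    fix n
    have p: "(2::real) ^ n > 0" by simp
    have "2 ^ n * x - 1 \<le> of_int \<lfloor>2 ^ n * x\<rfloor>" by linarith
    then have "(2 ^ n * x - 1) / 2 ^ n \<le> of_int \<lfloor>2 ^ n * x\<rfloor> / 2 ^ n"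
      using p by (intro divide_right_mono) auto
    then show "x - (1 / 2) ^ n \<le> of_int \<lfloor>2 ^ n * x\<rfloor> / 2 ^ n"
      by (simp add: diff_divide_distrib power_one_over)
    have "of_int \<lfloor>2 ^ n * x\<rfloor> \<le> 2 ^ n * x" by linarith
    then show "of_int \<lfloor>2 ^ n * x\<rfloor> / 2 ^ n \<le> x" using p by (simp add: field_simps)
  qed
  then show ?thesis unfolding sums_def sum_bit_of fl by simp
qed

text \<open>For \<open>a\<^sub>j\<close> in \<open>{0, 1}\<close>, the point of the Cantor set with ternary digits \<open>2 a\<^sub>j\<close>.\<close>

definition cantor_point :: "(nat \<Rightarrow> real) \<Rightarrow> real" where
  "cantor_point a = (\<Sum>j. 2 * a j / 3 ^ Suc j)"

text \<open>A continuous function of period 2 that is 0 on \<open>[0, 1/3]\<close> and 1 on \<open>[2/3, 1]\<close>; on the Cantor set it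
  reads off half of the leading ternary digit.\<close>

definition schoenberg :: "real \<Rightarrow> real" where
  "schoenberg t = max 0 (min 1 (1 / 2 - cos (pi * t)))"

lemma ternary_sums: "(\<lambda>j. 2 / 3 ^ Suc j) sums (1 :: real)"
proof -
  have "(\<lambda>j. (2 / 3) * (1 / 3 :: real) ^ j) sums ((2 / 3) * (1 / (1 - 1 / 3)))"
    by (intro sums_mult geometric_sums) simp
  then show ?thesis by (simp add: power_one_over field_simps)
qed

lemma cantor_summable:
  assumes "\<And>j. a j = 0 \<or> a j = (1 :: real)"
  shows "summable (\<lambda>j. 2 * a j / 3 ^ Suc j)"
proof (rule summable_comparison_test' [OF sums_summable [OF ternary_sums]])
  show "norm (2 * a j / 3 ^ Suc j) \<le> 2 / 3 ^ Suc j" for j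
    using assms [of j] by auto
qed

lemma cantor_point_bounds:
  assumes "\<And>j. a j = 0 \<or> a j = (1 :: real)"
  shows "0 \<le> cantor_point a" "cantor_point a \<le> 1"
proof -
  have "0 \<le> 2 * a j / 3 ^ Suc j" for j using assms [of j] by auto
  then show "0 \<le> cantor_point a"
    unfolding cantor_point_def by (rule suminf_nonneg [OF cantor_summable [of a, OF assms]])
  have "cantor_point a \<le> (\<Sum>j. 2 / 3 ^ Suc j)"
    unfolding cantor_point_def
  proof (rule suminf_le [OF _ cantor_summable [of a, OF assms] sums_summable [OF ternary_sums]])
    show "2 * a j / 3 ^ Suc j \<le> 2 / 3 ^ Suc j" for j using assms [of j] by auto
  qed
  then show "cantor_point a \<le> 1" using sums_unique [OF ternary_sums] by simp
qed

lemma cantor_point_shift: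
  assumes "\<And>j. a j = 0 \<or> a j = (1 :: real)"
  shows "3 * cantor_point a = 2 * a 0 + cantor_point (\<lambda>j. a (Suc j))"
proof -
  have s: "summable (\<lambda>j. 2 * a (Suc j) / 3 ^ Suc j)" by (rule cantor_summable) (rule assms)
  have "cantor_point a = 2 * a 0 / 3 + (\<Sum>j. 2 * a (Suc j) / 3 ^ Suc (Suc j))"
    using suminf_split_head [OF cantor_summable [of a, OF assms]] by (simp add: cantor_point_def)
  also have "(\<Sum>j. 2 * a (Suc j) / 3 ^ Suc (Suc j)) = (\<Sum>j. (1 / 3) * (2 * a (Suc j) / 3 ^ Suc j))"
    by simp
  also have "\<dots> = 1 / 3 * cantor_point (\<lambda>j. a (Suc j))"
    unfolding cantor_point_def by (rule suminf_mult [OF s])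
  finally show ?thesis by simp
qed

lemma schoenberg_low: "0 \<le> t \<Longrightarrow> t \<le> 1 / 3 \<Longrightarrow> schoenberg t = 0"
proof -
  assume t: "0 \<le> t" "t \<le> 1 / 3"
  have "cos (pi / 3) \<le> cos (pi * t)" using t by (intro cos_monotone_0_pi_le) (auto simp: field_simps)
  then show ?thesis by (simp add: schoenberg_def cos_60)
qed

lemma schoenberg_high: "2 / 3 \<le> t \<Longrightarrow> t \<le> 1 \<Longrightarrow> schoenberg t = 1"
proof -
  assume t: "2 / 3 \<le> t" "t \<le> 1"
  have "cos (pi * t) \<le> cos (2 * pi / 3)" using t by (intro cos_monotone_0_pi_le) (auto simp: field_simps)
  also have "cos (2 * pi / 3) = - 1 / 2" by (rule cos_120)
  finally show ?thesis by (simp add: schoenberg_def)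
qed

lemma schoenberg_shift: "schoenberg (2 * of_int j + t) = schoenberg t"
proof -
  have "cos (pi * (2 * of_int j + t)) = cos (pi * t + of_int j * (2 * pi))"
    by (simp add: algebra_simps)
  also have "\<dots> = cos (pi * t)"
    using cos_int_2pin [of j] sin_int_2pin [of j] by (simp add: cos_add mult.commute)
  finally show ?thesis by (simp add: schoenberg_def)
qed

text \<open>Multiplication by \<open>3 ^ j\<close> turns the first \<open>j\<close> digits into an even integer, which the period absorbs.
  What remains is a point of the Cantor set with leading digit \<open>2 a\<^sub>j\<close>.\<close>

lemma schoenberg_cantor_point:
  assumes "\<And>j. a j = 0 \<or> a j = (1 :: real)"
  shows "schoenberg (3 ^ j * cantor_point a) = a j"
  using assms
proof (induction j arbitrary: a)
  case 0
  have b: "0 \<le> cantor_point (\<lambda>j. a (Suc j))" "cantor_point (\<lambda>j. a (Suc j)) \<le> 1"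
    using 0 by (intro cantor_point_bounds; blast)+
  have e: "cantor_point a = (2 * a 0 + cantor_point (\<lambda>j. a (Suc j))) / 3"
    using cantor_point_shift [of a, OF 0] by simp
  from 0 [of 0] show ?case
  proof
    assume "a 0 = 0" then show ?thesis using e b by (auto intro!: schoenberg_low)
  next
    assume "a 0 = 1" then show ?thesis using e b by (auto intro!: schoenberg_high)
  qed
next
  case (Suc j)
  obtain i :: int where i: "a 0 = of_int i" using Suc.prems [of 0] of_int_0 of_int_1 by metis
  have "3 ^ Suc j * cantor_point a = 3 ^ j * (2 * a 0 + cantor_point (\<lambda>j. a (Suc j)))"
    using cantor_point_shift [of a, OF Suc.prems] by simp
  also have "\<dots> = 2 * of_int (3 ^ j * i) + 3 ^ j * cantor_point (\<lambda>j. a (Suc j))"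
    using i by (simp add: algebra_simps)
  finally have "schoenberg (3 ^ Suc j * cantor_point a) = schoenberg (3 ^ j * cantor_point (\<lambda>j. a (Suc j)))"
    by (simp only: schoenberg_shift)
  also have "\<dots> = a (Suc j)" by (rule Suc.IH) (rule Suc.prems)
  finally show ?case .
qed

lemma schoenberg_bounds: "0 \<le> schoenberg t" "schoenberg t \<le> 1"
  by (auto simp: schoenberg_def)

lemma continuous_schoenberg: "continuous_on UNIV schoenberg"
  unfolding schoenberg_def by (intro continuous_intros)

text \<open>Schoenberg's space-filling curve: place \<open>to_nat (k, i)\<close> of the ternary expansion holds the binary
  digit \<open>k\<close> of the coordinate \<open>i\<close>.\<close>

definition torus_curve :: "real \<Rightarrow> 'n::finite torus" where
  "torus_curve t = to_torus (\<chi> i. \<Sum>k. schoenberg (3 ^ to_nat (k, i) * t) / 2 ^ Suc k)"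

lemma continuous_torus_curve: "continuous_on UNIV (torus_curve :: real \<Rightarrow> 'n::finite torus)"
proof -
  have h: "(\<lambda>k. 1 / 2 ^ Suc k) sums (1 :: real)"
    using power_half_series by (simp add: power_one_over)
  have "continuous_on UNIV (\<lambda>t. \<Sum>k. schoenberg (3 ^ to_nat (k, i) * t) / 2 ^ Suc k)" for i :: 'n
  proof (rule uniform_limit_theorem [OF _ Weierstrass_m_test])
    show "\<forall>\<^sub>F n in sequentially. continuous_on UNIV (\<lambda>t. \<Sum>k<n. schoenberg (3 ^ to_nat (k, i) * t) / 2 ^ Suc k)"
      by (intro always_eventually allI continuous_intros continuous_on_compose2 [OF continuous_schoenberg]) auto
    show "summable (\<lambda>k. 1 / 2 ^ Suc k :: real)" using h by (rule sums_summable)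
    show "norm (schoenberg (3 ^ to_nat (k, i) * t) / 2 ^ Suc k) \<le> 1 / 2 ^ Suc k" for k t
      using schoenberg_bounds by (simp add: divide_right_mono)
  qed simp
  then have "continuous_on UNIV (\<lambda>t. \<chi> i :: 'n. \<Sum>k. schoenberg (3 ^ to_nat (k, i) * t) / 2 ^ Suc k)"
    by (intro continuous_on_vec_lambda)
  from continuous_on_compose2 [OF continuous_to_torus [of UNIV] this] show ?thesis
    unfolding torus_curve_def [abs_def] by simp
qed

text \<open>The fractional part is the same for all lifts, unlike the lift itself, whose choice need not be
  measurable.\<close>

definition torus_coord :: "'n::finite torus \<Rightarrow> 'n \<Rightarrow> real" where
  "torus_coord X i = frac (rep_torus X $ i)"

lemma torus_coord_to_torus: "torus_coord (to_torus z) i = frac (z $ i)"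
proof -
  have "lattice_equiv (rep_torus (to_torus z)) z"
    using to_torus_rep [of "to_torus z"] by (simp only: to_torus_eq_iff)
  then have "rep_torus (to_torus z) $ i - z $ i \<in> \<int>" by (simp add: lattice_equiv_def)
  then obtain j :: int where "rep_torus (to_torus z) $ i - z $ i = of_int j" by (auto elim: Ints_cases)
  then have "rep_torus (to_torus z) $ i = z $ i + of_int j" by linarith
  then show ?thesis by (simp add: torus_coord_def frac_def)
qed

text \<open>The coordinate is continuous on the open set where it does not vanish, and constant on the complement.\<close>

lemma measurable_torus_coord: "(\<lambda>X. torus_coord X i) \<in> borel_measurable (borel :: 'n::finite torus measure)"
proof (rule borel_measurableI)
  fix V :: "real set" assume V: "open V"
  define W where "W S = {z :: real ^ 'n. z $ i \<notin> \<int> \<and> frac (z $ i) \<in> S}" for S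
  have W: "open (W S)" if "open S" for S
  proof -
    have "continuous_on {z :: real ^ 'n. z $ i \<notin> \<int>} (\<lambda>z. frac (z $ i))"
      by (intro continuous_at_imp_continuous_on ballI continuous_at_compose [of _ "\<lambda>z. z $ i" frac, unfolded o_def])
        (auto intro!: continuous_frac continuous_intros)
    moreover have "open {z :: real ^ 'n. z $ i \<notin> \<int>}"
    proof -
      have "closed ((\<lambda>z :: real ^ 'n. z $ i) -` \<int>)"
        by (intro closed_vimage continuous_intros) auto
      then show ?thesis by (simp add: closed_def vimage_def Collect_neg_eq [symmetric])
    qed
    ultimately have "open ((\<lambda>z. frac (z $ i)) -` S \<inter> {z :: real ^ 'n. z $ i \<notin> \<int>})"
      using that continuous_on_open_vimage by blast
    then show ?thesis by (simp add: W_def vimage_def Int_def conj_commute)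
  qed
  have eq: "(\<lambda>X :: 'n torus. torus_coord X i) -` V
     = to_torus ` W V \<union> (if 0 \<in> V then - to_torus ` W UNIV else {})" (is "?L = ?R")
  proof (rule set_eqI)
    fix X :: "'n torus"
    define z where "z = rep_torus X"
    have X: "X = to_torus z" by (simp add: z_def)
    have c: "to_torus y = X \<Longrightarrow> frac (y $ i) = torus_coord X i" for y
      using torus_coord_to_torus by metis
    have "X \<in> to_torus ` W S \<longleftrightarrow> torus_coord X i \<noteq> 0 \<and> torus_coord X i \<in> S" for S
    proof
      assume "X \<in> to_torus ` W S"
      then obtain y where "X = to_torus y" "y \<in> W S" by blast
      then show "torus_coord X i \<noteq> 0 \<and> torus_coord X i \<in> S"
        using c [of y] by (auto simp: W_def)
    next
      assume "torus_coord X i \<noteq> 0 \<and> torus_coord X i \<in> S"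
      then have "frac (z $ i) \<noteq> 0" "frac (z $ i) \<in> S" using c [of z] X by auto
      then have "z \<in> W S" by (simp add: W_def)
      then show "X \<in> to_torus ` W S" using X by blast
    qed
    then show "X \<in> ?L \<longleftrightarrow> X \<in> ?R" by auto
  qed
  have "to_torus ` W V \<in> sets borel" "- to_torus ` W UNIV \<in> sets borel"
    using open_to_torus_image [OF W [OF V]] open_to_torus_image [OF W [OF open_UNIV]]
    by (auto intro: borel_open borel_closed)
  then show "(\<lambda>X :: 'n torus. torus_coord X i) -` V \<inter> space borel \<in> sets borel"
    unfolding eq by auto
qed

text \<open>A Borel right inverse of the curve: the binary digits of all coordinates are interleaved into one
  point of the Cantor set.\<close>

definition torus_code :: "'n::finite torus \<Rightarrow> real" where
  "torus_code X = cantor_point (\<lambda>j. case from_nat j of (k, i) \<Rightarrow> bit_of k (torus_coord X i))"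

lemma torus_code_bits: "(case from_nat j of (k, i) \<Rightarrow> bit_of k (torus_coord X i)) = 0 \<or>
    (case from_nat j of (k, i) \<Rightarrow> bit_of k (torus_coord X i)) = 1"
  using bit_of_cases by (simp split: prod.split)

lemma torus_curve_code: "torus_curve (torus_code X) = (X :: 'n::finite torus)"
proof -
  have "(\<Sum>k. schoenberg (3 ^ to_nat (k, i) * torus_code X) / 2 ^ Suc k) = torus_coord X i" for i :: 'n
  proof -
    have "schoenberg (3 ^ to_nat (k, i) * torus_code X) = bit_of k (torus_coord X i)" for k
      unfolding torus_code_def
      by (subst schoenberg_cantor_point [OF torus_code_bits]) simp
    moreover have "(\<lambda>k. bit_of k (torus_coord X i) / 2 ^ Suc k) sums torus_coord X i"
      by (rule bit_of_sums) (auto simp: torus_coord_def frac_lt_1)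
    ultimately show ?thesis by (simp add: sums_unique [symmetric])
  qed
  then have "torus_curve (torus_code X) = to_torus (\<chi> i. torus_coord X i)"
    by (simp only: torus_curve_def)
  also have "\<dots> = X" using to_torus_frac [of "rep_torus X"] by (simp add: torus_coord_def)
  finally show ?thesis .
qed

lemma measurable_torus_code: "torus_code \<in> borel_measurable (borel :: 'n::finite torus measure)"
proof -
  have bit: "bit_of k \<in> borel_measurable borel" for k
    unfolding bit_of_def [abs_def] by measurable
  have "(\<lambda>X :: 'n torus. case from_nat j of (k, i) \<Rightarrow> bit_of k (torus_coord X i)) \<in> borel_measurable borel" for j
  proof (cases "from_nat j :: nat \<times> 'n")
    case (Pair k i)
    then show ?thesis using measurable_compose [OF measurable_torus_coord bit] by simp
  qed
  then show ?thesis unfolding torus_code_def cantor_point_def by measurable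
qed

lemma torus_code_bounds: "0 \<le> torus_code X" "torus_code X \<le> 1"
  unfolding torus_code_def by (rule cantor_point_bounds [OF torus_code_bits])+

text \<open>The Borel code transports the measures to the interval \<open>[0, 1]\<close>, where Helly's theorem extracts a weakly
  convergent subsequence. Skorohod's theorem realizes it by pointwise convergent random
  variables on one probability space, and the continuous curve carries these back to the torus.
  Their joint laws are couplings, with costs tending to 0 by dominated convergence.\<close>

lemma ptorus_seq_compact:
  fixes M :: "nat \<Rightarrow> 'n::finite ptorus"
  obtains r :: "nat \<Rightarrow> nat" and L where "strict_mono r" "(\<lambda>k. M (r k)) \<longlonglongrightarrow> L"
proof -
  define \<mu> where "\<mu> k = distr (meas (M k)) borel torus_code" for k
  have code: "torus_code \<in> meas (M k) \<rightarrow>\<^sub>M borel" for k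
    unfolding measurable_cong_sets [OF sets_meas refl] by (rule measurable_torus_code)
  have rd: "real_distribution (\<mu> k)" for k
    unfolding \<mu>_def using prob_space.real_distribution_distr [OF prob_space_meas code] .
  have "tight \<mu>"
    unfolding tight_def
  proof (intro conjI allI impI rd)
    fix \<epsilon> :: real assume "\<epsilon> > 0"
    have "measure (\<mu> n) {-1<..1} = 1" for n
    proof -
      have "torus_code X \<in> {-1<..1}" for X :: "'n torus"
        using torus_code_bounds [of X] by simp
      then have "torus_code -` {-1<..1} = (UNIV :: 'n torus set)" by blast
      then show ?thesis unfolding \<mu>_def by (simp add: measure_distr [OF code])
    qed
    then show "\<exists>a b. a < b \<and> (\<forall>n. 1 - \<epsilon> < measure (\<mu> n) {a<..b})"
      using \<open>\<epsilon> > 0\<close> by (intro exI [of _ "-1"] exI [of _ 1]) simp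
  qed
  then obtain r N where r: "strict_mono r" and N: "real_distribution N" "weak_conv_m (\<mu> \<circ> id \<circ> r) N"
    using tight_imp_convergent_subsubsequence [OF _ strict_mono_id, of \<mu>] by blast
  have rd': "real_distribution ((\<mu> \<circ> id \<circ> r) k)" for k using rd by simp
  obtain \<Omega> :: "real measure" and Y Z where S: "prob_space \<Omega> \<and> (\<forall>k. Y k \<in> borel_measurable \<Omega>) \<and>
      (\<forall>k. distr \<Omega> borel (Y k) = (\<mu> \<circ> id \<circ> r) k) \<and> Z \<in> measurable \<Omega> lborel \<and>
      distr \<Omega> borel Z = N \<and> (\<forall>x\<in>space \<Omega>. (\<lambda>k. Y k x) \<longlonglongrightarrow> Z x)"
    using Skorohod [OF rd' N] by blast
  then have \<Omega>: "prob_space \<Omega>" and Y: "\<And>k. Y k \<in> borel_measurable \<Omega>" "\<And>k. distr \<Omega> borel (Y k) = \<mu> (r k)"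
    and Z: "Z \<in> borel_measurable \<Omega>" "distr \<Omega> borel Z = N"
    and lim: "\<And>x. x \<in> space \<Omega> \<Longrightarrow> (\<lambda>k. Y k x) \<longlonglongrightarrow> Z x"
    by auto
  interpret \<Omega>: prob_space \<Omega> by (rule \<Omega>)
  define h where "h = (torus_curve :: real \<Rightarrow> 'n torus)"
  have ch: "continuous_on UNIV h" unfolding h_def by (rule continuous_torus_curve)
  then have h: "h \<in> borel \<rightarrow>\<^sub>M borel" by (rule borel_measurable_continuous_onI)
  have hZ: "(\<lambda>x. h (Z x)) \<in> \<Omega> \<rightarrow>\<^sub>M borel" and hY: "(\<lambda>x. h (Y k x)) \<in> \<Omega> \<rightarrow>\<^sub>M borel" for k
    using measurable_compose [OF Z(1) h] measurable_compose [OF Y(1) h] by auto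
  define L where "L = Abs_ptorus (distr \<Omega> borel (\<lambda>x. h (Z x)))"
  have L: "meas L = distr \<Omega> borel (\<lambda>x. h (Z x))"
    unfolding L_def by (intro Abs_ptorus_inverse) (simp add: \<Omega>.prob_space_distr [OF hZ])
  have My: "distr \<Omega> borel (\<lambda>x. h (Y k x)) = meas (M (r k))" for k
  proof -
    have "distr \<Omega> borel (\<lambda>x. h (Y k x)) = distr (distr \<Omega> borel (Y k)) borel h"
      by (simp add: distr_distr [OF h Y(1)] o_def)
    also have "\<dots> = distr (meas (M (r k))) borel (h \<circ> torus_code)"
      unfolding Y(2) \<mu>_def by (rule distr_distr [OF h code])
    also have "\<dots> = distr (meas (M (r k))) borel (\<lambda>X. X)"
      by (intro distr_cong) (simp_all add: h_def torus_curve_code)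
    also have "\<dots> = meas (M (r k))" by (intro distr_id2) simp
    finally show ?thesis .
  qed
  have mp: "(\<lambda>x. (h (Z x), h (Y k x))) \<in> \<Omega> \<rightarrow>\<^sub>M borel" for k
    unfolding measurable_cong_sets [OF refl sets_borel_Times] using hZ hY by (rule measurable_Pair)
  have coup: "distr \<Omega> borel (\<lambda>x. (h (Z x), h (Y k x))) \<in> couplings L (M (r k))" for k
  proof -
    have f: "fst \<in> (borel :: ('n torus \<times> 'n torus) measure) \<rightarrow>\<^sub>M borel"
      and s: "snd \<in> (borel :: ('n torus \<times> 'n torus) measure) \<rightarrow>\<^sub>M borel"
      by (intro borel_measurable_continuous_onI continuous_intros)+
    show ?thesis
      unfolding couplings_def L My [symmetric]
      by (simp add: distr_distr [OF f mp] distr_distr [OF s mp] o_def)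
  qed
  have md: "(\<lambda>z. dist (fst z) (snd z)) \<in> borel_measurable (borel :: ('n torus \<times> 'n torus) measure)"
    by (intro borel_measurable_continuous_onI continuous_intros)
  then have mdist: "(\<lambda>x. dist (h (Z x)) (h (Y k x))) \<in> borel_measurable \<Omega>" for k
    using measurable_compose [OF mp md] by simp
  obtain D where D: "\<And>X. norm (dist X (undefined :: 'n torus)) \<le> D"
    by (rule torus_bounded [of "\<lambda>X :: 'n torus. dist X undefined"]) (auto intro!: continuous_intros)
  have bd: "dist X X' \<le> 2 * D" for X X' :: "'n torus"
    using dist_triangle2 [of X X' undefined] D [of X] D [of X'] by simp
  have "(\<lambda>k. LINT x|\<Omega>. dist (h (Z x)) (h (Y k x))) \<longlonglongrightarrow> (LINT x|\<Omega>. 0)"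
  proof (rule integral_dominated_convergence [where w = "\<lambda>_. 2 * D"])
    show "AE x in \<Omega>. (\<lambda>k. dist (h (Z x)) (h (Y k x))) \<longlonglongrightarrow> 0"
    proof (rule AE_I2)
      fix x assume "x \<in> space \<Omega>"
      then have "(\<lambda>k. h (Y k x)) \<longlonglongrightarrow> h (Z x)"
        using continuous_on_tendsto_compose [OF ch lim] by simp
      then show "(\<lambda>k. dist (h (Z x)) (h (Y k x))) \<longlonglongrightarrow> 0"
        by (subst (asm) tendsto_dist_iff) (simp add: dist_commute)
    qed
  qed (use mdist bd in auto)
  then have to0: "(\<lambda>k. LINT x|\<Omega>. dist (h (Z x)) (h (Y k x))) \<longlonglongrightarrow> 0" by simp
  have Wle: "wasserstein L (M (r k)) \<le> ennreal (LINT x|\<Omega>. dist (h (Z x)) (h (Y k x)))" for k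
  proof -
    have "wasserstein L (M (r k)) \<le> (\<integral>\<^sup>+z. ennreal (dist (fst z) (snd z)) \<partial>distr \<Omega> borel (\<lambda>x. (h (Z x), h (Y k x))))"
      unfolding wasserstein_def by (rule INF_lower [OF coup])
    also have "\<dots> = (\<integral>\<^sup>+x. ennreal (dist (h (Z x)) (h (Y k x))) \<partial>\<Omega>)"
      using md by (subst nn_integral_distr [OF mp]) simp_all
    also have "\<dots> = ennreal (LINT x|\<Omega>. dist (h (Z x)) (h (Y k x)))"
      using mdist bd by (intro nn_integral_eq_integral \<Omega>.integrable_const_bound [of _ "2 * D"]) auto
    finally show ?thesis .
  qed
  have "(\<lambda>k. M (r k)) \<longlonglongrightarrow> L"
  proof (rule tendsto_ptorusI)
    fix e :: real assume "e > 0"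
    then have "eventually (\<lambda>k. (LINT x|\<Omega>. dist (h (Z x)) (h (Y k x))) < e) sequentially"
      using order_tendstoD(2) [OF to0] by blast
    then show "eventually (\<lambda>k. wasserstein L (M (r k)) < ennreal e) sequentially"
    proof eventually_elim
      case (elim k)
      have "wasserstein L (M (r k)) \<le> ennreal (LINT x|\<Omega>. dist (h (Z x)) (h (Y k x)))" by (rule Wle)
      also have "\<dots> < ennreal e" using elim \<open>e > 0\<close> by (simp add: ennreal_lessI)
      finally show ?case .
    qed
  qed
  then show thesis using that r by blast
qed

text \<open>By compactness a subsequence staying outside a neighbourhood of \<open>L\<close> would have a limit point; its integrals
  are those of \<open>L\<close>, so it is \<open>L\<close>.\<close>

lemma tendsto_ptorus_weakI:
  fixes M :: "nat \<Rightarrow> 'n::finite ptorus"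
  assumes "\<And>f :: 'n torus \<Rightarrow> real. continuous_on UNIV f \<Longrightarrow>
     (\<lambda>k. LINT x|meas (M k). f x) \<longlonglongrightarrow> (LINT x|meas L. f x)"
  shows "M \<longlonglongrightarrow> L"
proof (rule topological_tendstoI, rule ccontr)
  fix U assume U: "open U" "L \<in> U" and neg: "\<not> eventually (\<lambda>k. M k \<in> U) sequentially"
  then have "infinite {k. M k \<notin> U}"
    by (simp add: cofinite_eq_sequentially [symmetric] eventually_cofinite)
  then obtain s :: "nat \<Rightarrow> nat" where s: "strict_mono s" "\<And>k. M (s k) \<notin> U"
    using infinite_enumerate by blast
  obtain r L' where r: "strict_mono r" and L': "(\<lambda>k. M (s (r k))) \<longlonglongrightarrow> L'"
    using ptorus_seq_compact [of "\<lambda>k. M (s k)"] by blast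
  have "L' = L"
  proof (rule ptorus_eqI)
    fix f :: "'n torus \<Rightarrow> real" assume f: "continuous_on UNIV f"
    have "(\<lambda>k. LINT x|meas (M (s (r k))). f x) \<longlonglongrightarrow> (LINT x|meas L'. f x)"
      using continuous_on_tendsto_compose [OF continuous_integral_meas [OF f] L'] by simp
    moreover have "(\<lambda>k. LINT x|meas (M (s (r k))). f x) \<longlonglongrightarrow> (LINT x|meas L. f x)"
      using LIMSEQ_subseq_LIMSEQ [OF assms [OF f] strict_mono_compose [OF s(1) r]] by (simp add: o_def)
    ultimately show "(LINT x|meas L'. f x) = (LINT x|meas L. f x)" by (rule LIMSEQ_unique)
  qed
  then have "eventually (\<lambda>k. M (s (r k)) \<in> U) sequentially"
    using L' U topological_tendstoD by blast
  then show False using s(2) by (auto simp: eventually_sequentially)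
qed

lemma ptorus_bounded:
  fixes g :: "'n::finite ptorus \<Rightarrow> 'n torus \<Rightarrow> real"
  assumes g: "continuous_on UNIV (\<lambda>(m, y). g m y)"
  obtains B where "B \<ge> 0" "\<And>m y. \<bar>g m y\<bar> \<le> B"
proof -
  have "\<exists>B. \<forall>m y. \<bar>g m y\<bar> \<le> B"
  proof (rule ccontr)
    assume "\<not> ?thesis"
    then have "\<exists>m y. \<bar>g m y\<bar> > real k" for k by (meson not_le)
    then obtain M y where big: "\<And>k. \<bar>g (M k) (y k)\<bar> > real k" by metis
    obtain r L where r: "strict_mono r" "(\<lambda>k. M (r k)) \<longlonglongrightarrow> L" using ptorus_seq_compact by blast
    obtain r' Y where r': "strict_mono r'" "(\<lambda>k. y (r (r' k))) \<longlonglongrightarrow> Y"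
      using compact_torus [unfolded compact_def, rule_format, of "\<lambda>k. y (r k)"] by (auto simp: o_def)
    have "(\<lambda>k. M (r (r' k))) \<longlonglongrightarrow> L"
      using LIMSEQ_subseq_LIMSEQ [OF r(2) r'(1)] by (simp add: o_def)
    then have "(\<lambda>k. g (M (r (r' k))) (y (r (r' k)))) \<longlonglongrightarrow> g L Y"
      using continuous_on_tendsto_compose [OF g tendsto_Pair [OF _ r'(2)]] by simp
    then have "Bseq (\<lambda>k. g (M (r (r' k))) (y (r (r' k))))" by (rule convergentI [THEN convergent_imp_Bseq])
    then obtain K where K: "\<And>k. \<bar>g (M (r (r' k))) (y (r (r' k)))\<bar> \<le> K" by (auto simp: Bseq_def)
    obtain k :: nat where "K < real k" using reals_Archimedean2 by blast
    moreover have "k \<le> r (r' k)" using r(1) r'(1) seq_suble le_trans by metis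
    ultimately show False using big [of "r (r' k)"] K [of k] by (simp add: le_less_trans)
  qed
  then obtain B where B: "\<And>m y. \<bar>g m y\<bar> \<le> B" by blast
  then have "B \<ge> 0" using abs_ge_zero order_trans by blast
  then show thesis using B that by blast
qed

section \<open>Smooth functions and weak derivatives on the line\<close>

lemma frechet_derivative_eqI: "(f has_derivative f') (at x) \<Longrightarrow> frechet_derivative f (at x) = f'"
  using frechet_derivative_at by metis

lemma Ck_SucI:
  assumes "\<And>x. (f has_derivative f' x) (at x)" "\<And>b. b \<in> Basis \<Longrightarrow> Ck k (\<lambda>x. f' x b)"
  shows "Ck (Suc k) f"
proof -
  have "(\<lambda>x. frechet_derivative f (at x) b) = (\<lambda>x. f' x b)" for b
    using frechet_derivative_eqI [OF assms(1)] by simp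
  then show ?thesis using assms by (auto simp: differentiable_def)
qed

lemma Ck_SucD:
  assumes "Ck (Suc k) f"
  shows "(f has_derivative frechet_derivative f (at x)) (at x)"
    "b \<in> Basis \<Longrightarrow> Ck k (\<lambda>x. frechet_derivative f (at x) b)"
  using assms frechet_derivative_works by auto

lemma Ck_imp_continuous: "Ck k f \<Longrightarrow> continuous_on UNIV f"
  by (cases k) (auto intro!: differentiable_imp_continuous_on simp: differentiable_on_def)

lemma Ck_mono_Suc: "Ck (Suc k) f \<Longrightarrow> Ck k f"
proof (induction k arbitrary: f)
  case 0 then show ?case using Ck_imp_continuous by (metis Ck.simps(1))
next
  case (Suc k) then show ?case by (metis Ck.simps(2))
qed

lemma Ck_const: "Ck k (\<lambda>_. c)"
  by (induction k arbitrary: c) (auto intro!: Ck_SucI [OF has_derivative_const])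

lemma Ck_add: "Ck k f \<Longrightarrow> Ck k g \<Longrightarrow> Ck k (\<lambda>x. f x + g x)"
proof (induction k arbitrary: f g)
  case 0 then show ?case by (auto intro: continuous_on_add)
next
  case (Suc k)
  show ?case
    by (rule Ck_SucI [OF has_derivative_add [OF Ck_SucD(1) [OF Suc.prems(1)] Ck_SucD(1) [OF Suc.prems(2)]]])
      (intro Suc.IH Ck_SucD(2) Suc.prems)
qed

lemma Ck_mult: "Ck k f \<Longrightarrow> Ck k g \<Longrightarrow> Ck k (\<lambda>x. f x * g x)"
proof (induction k arbitrary: f g)
  case 0 then show ?case by (auto intro: continuous_on_mult)
next
  case (Suc k)
  show ?case
    by (rule Ck_SucI [OF has_derivative_mult [OF Ck_SucD(1) [OF Suc.prems(1)] Ck_SucD(1) [OF Suc.prems(2)]]])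
      (intro Suc.IH Ck_add Ck_SucD(2) Suc.prems Ck_mono_Suc; assumption)
qed

lemma Ck_sum: "(\<And>i. i \<in> I \<Longrightarrow> Ck k (f i)) \<Longrightarrow> Ck k (\<lambda>x. \<Sum>i\<in>I. f i x)"
  by (induction I rule: infinite_finite_induct) (auto intro: Ck_const Ck_add)

text \<open>The partial derivatives of the composition are linear combinations of compositions of partial
  derivatives of \<open>f\<close>, so the induction closes for all \<open>f\<close> simultaneously.\<close>

lemma Ck_compose_affine:
  fixes f :: "'b::euclidean_space \<Rightarrow> real" and L :: "'a::euclidean_space \<Rightarrow> 'b"
  assumes L: "bounded_linear L"
  shows "Ck k f \<Longrightarrow> Ck k (\<lambda>x. f (L x + c))"
proof (induction k arbitrary: f)
  case 0
  have "continuous_on UNIV (\<lambda>x. L x + c)"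
    using linear_continuous_on [OF L] by (intro continuous_intros)
  then show ?case using 0 by (auto intro: continuous_on_compose2)
next
  case (Suc k)
  let ?D = "\<lambda>x. frechet_derivative f (at x)"
  have d: "((\<lambda>x. f (L x + c)) has_derivative (\<lambda>h. ?D (L x + c) (L h))) (at x)" for x
    by (rule has_derivative_compose [OF _ Ck_SucD(1) [OF Suc.prems], of "\<lambda>x. L x + c"])
      (auto intro!: derivative_eq_intros bounded_linear_imp_has_derivative [OF L])
  have "(\<lambda>x. ?D (L x + c) (L b)) = (\<lambda>x. \<Sum>i\<in>Basis. (L b \<bullet> i) * ?D (L x + c) i)" for b
  proof
    fix x
    have "linear (?D (L x + c))"
      using Ck_SucD(1) [OF Suc.prems] has_derivative_linear by blast
    then have "?D (L x + c) (\<Sum>i\<in>Basis. (L b \<bullet> i) *\<^sub>R i) = (\<Sum>i\<in>Basis. (L b \<bullet> i) * ?D (L x + c) i)"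
      by (simp add: linear_sum linear_cmul o_def)
    then show "?D (L x + c) (L b) = (\<Sum>i\<in>Basis. (L b \<bullet> i) * ?D (L x + c) i)"
      by (simp add: euclidean_representation)
  qed
  then have "Ck k (\<lambda>x. ?D (L x + c) (L b))" for b
    using Suc.IH [OF Ck_SucD(2) [OF Suc.prems]] by (auto intro!: Ck_sum Ck_mult Ck_const)
  then show ?case by (rule Ck_SucI [OF d])
qed

lemma Ck_Suc_realI:
  fixes f :: "real \<Rightarrow> real"
  assumes "\<And>x. (f has_real_derivative f' x) (at x)" "Ck k f'"
  shows "Ck (Suc k) f"
  by (rule Ck_SucI [OF assms(1) [unfolded has_field_derivative_def]]) (simp add: assms(2))

text \<open>The factors \<open>x\<^sup>-\<^sup>k\<close> make the family closed under differentiation up to linear combinations, so that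
  smoothness at 0 follows by induction for all \<open>k\<close> simultaneously.\<close>

definition flat_exp :: "nat \<Rightarrow> real \<Rightarrow> real" where
  "flat_exp k x = (if x > 0 then (1 / x) ^ k * exp (- (1 / x)) else 0)"

lemma flat_exp_tendsto_0: "(flat_exp k \<longlongrightarrow> 0) (at_right 0)"
proof -
  have "((\<lambda>y. y ^ k / exp y) \<longlongrightarrow> 0) (at_top :: real filter)" by (rule tendsto_power_div_exp_0)
  then have "((\<lambda>x. inverse x ^ k / exp (inverse x)) \<longlongrightarrow> 0) (at_right (0 :: real))"
    by (rule filterlim_compose) (rule filterlim_inverse_at_top_right)
  then show ?thesis
    by (rule filterlim_cong [THEN iffD1, rotated -1])
      (auto simp: flat_exp_def eventually_at_filter exp_minus field_simps)
qed

lemma flat_exp_derivative: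
  "(flat_exp k has_real_derivative flat_exp (k + 2) x - real k * flat_exp (k + 1) x) (at x)"
proof -
  consider "x < 0" | "x > 0" | "x = 0" by linarith
  then show ?thesis
  proof cases
    case 1
    have "((\<lambda>_. 0 :: real) has_real_derivative 0) (at x)" by simp
    then have "(flat_exp k has_real_derivative 0) (at x)"
      by (rule has_field_derivative_transform_within_open [of _ _ _ "{..<0}"]) (use 1 in \<open>auto simp: flat_exp_def\<close>)
    then show ?thesis using 1 by (simp add: flat_exp_def)
  next
    case 2
    have p: "real k * (1 / x) ^ (k - 1) * (1 / x) = real k * (1 / x) ^ k"
      by (cases k) auto
    have "((\<lambda>x. (1 / x) ^ k * exp (- (1 / x))) has_real_derivative
        (real k * (1 / x) ^ (k - 1) * (- (1 / x\<^sup>2))) * exp (- (1 / x))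
        + (1 / x) ^ k * (exp (- (1 / x)) * (1 / x\<^sup>2))) (at x)"
      using 2 by (auto intro!: derivative_eq_intros simp: power2_eq_square)
    also have "(real k * (1 / x) ^ (k - 1) * (- (1 / x\<^sup>2))) * exp (- (1 / x))
        + (1 / x) ^ k * (exp (- (1 / x)) * (1 / x\<^sup>2)) =
        (1 / x) ^ (k + 2) * exp (- (1 / x)) - (real k * (1 / x) ^ (k - 1) * (1 / x)) * (1 / x) * exp (- (1 / x))"
      by (simp add: power2_eq_square algebra_simps power_add)
    also have "\<dots> = flat_exp (k + 2) x - real k * flat_exp (k + 1) x"
      using 2 unfolding p by (simp add: flat_exp_def)
    finally have "((\<lambda>x. (1 / x) ^ k * exp (- (1 / x))) has_real_derivative 
        flat_exp (k + 2) x - real k * flat_exp (k + 1) x) (at x)" .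
    then show ?thesis
      by (rule has_field_derivative_transform_within_open [of _ _ _ "{0<..}"]) (use 2 in \<open>auto simp: flat_exp_def\<close>)
  next
    case 3
    have "((\<lambda>y. flat_exp k y / y) \<longlongrightarrow> 0) (at_right 0)"
      by (rule filterlim_cong [THEN iffD1, OF refl refl _ flat_exp_tendsto_0 [of "Suc k"]])
        (auto simp: flat_exp_def eventually_at_filter)
    moreover have "((\<lambda>y. flat_exp k y / y) \<longlongrightarrow> 0) (at_left 0)"
      by (rule tendsto_eventually) (auto simp: flat_exp_def eventually_at_filter)
    ultimately have "((\<lambda>y. flat_exp k y / y) \<longlongrightarrow> 0) (at 0)"
      by (simp add: filterlim_split_at)
    then have "(flat_exp k has_real_derivative 0) (at 0)"
      by (simp add: has_field_derivative_iff flat_exp_def)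
    then show ?thesis using 3 by (simp add: flat_exp_def)
  qed
qed

lemma Ck_flat_exp: "Ck n (flat_exp k)"
proof (induction n arbitrary: k)
  case 0
  show ?case
    unfolding Ck.simps(1)
    by (rule DERIV_continuous_on [OF has_field_derivative_at_within [OF flat_exp_derivative]])
next
  case (Suc n)
  have "Ck n (\<lambda>x. flat_exp (k + 2) x + (- real k) * flat_exp (k + 1) x)"
    by (intro Ck_add Ck_mult Ck_const Suc.IH)
  then show ?case by (intro Ck_Suc_realI [OF flat_exp_derivative]) simp
qed

definition bump :: "real \<Rightarrow> real \<Rightarrow> real" where
  "bump e x = flat_exp 0 (e + x) * flat_exp 0 (e - x)"

lemma bump_pos: "\<bar>x\<bar> < e \<Longrightarrow> bump e x > 0"
  by (auto simp: bump_def flat_exp_def)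

lemma bump_zero: "e \<le> \<bar>x\<bar> \<Longrightarrow> bump e x = 0"
  by (auto simp: bump_def flat_exp_def)

lemma Ck_bump: "Ck n (\<lambda>x. bump e (x - s))"
proof -
  have "Ck n (\<lambda>x. flat_exp 0 (x + (e - s)))"
    by (rule Ck_compose_affine [OF bounded_linear_ident Ck_flat_exp])
  moreover have "Ck n (\<lambda>x. flat_exp 0 (- x + (e + s)))"
    by (rule Ck_compose_affine [OF bounded_linear_minus [OF bounded_linear_ident] Ck_flat_exp])
  ultimately have "Ck n (\<lambda>x. flat_exp 0 (x + (e - s)) * flat_exp 0 (- x + (e + s)))" by (rule Ck_mult)
  moreover have "(\<lambda>x. flat_exp 0 (x + (e - s)) * flat_exp 0 (- x + (e + s))) = (\<lambda>x. bump e (x - s))"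
    by (simp add: bump_def algebra_simps)
  ultimately show ?thesis by simp
qed

lemma continuous_bump: "continuous_on S (\<lambda>x. bump e (x - s))"
  using Ck_bump [of 0 e s] by (auto intro: continuous_on_subset)

lemma bump_nonneg: "0 \<le> bump e x"
  using bump_pos [of x e] bump_zero [of e x] by (cases "\<bar>x\<bar> < e") auto

lemma bump_integral:
  assumes "e > 0"
  shows "\<exists>I>0. \<forall>s a b. a \<le> s - e \<longrightarrow> s + e \<le> b \<longrightarrow> ((\<lambda>x. bump e (x - s)) has_integral I) {a..b}"
proof -
  define I where "I = integral {-e..e} (bump e)"
  have c: "continuous_on S (bump e)" for S using continuous_bump [of S e 0] by simp
  then have I: "(bump e has_integral I) {-e..e}"
    unfolding I_def by (intro integrable_integral integrable_continuous_interval)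
  have "((\<lambda>x. bump e (x - s)) has_integral I) {a..b}" if "a \<le> s - e" "s + e \<le> b" for s a b
  proof -
    have "((\<lambda>x. bump e (x - s)) has_integral I) {s - e..s + e}"
      using has_integral_shift_real_ivl [OF I, of "- s"] by (simp add: add.commute)
    then show ?thesis
      by (rule has_integral_on_superset) (use that in \<open>auto intro!: bump_zero\<close>)
  qed
  moreover have "I \<ge> 0" unfolding I_def by (intro integral_nonneg integrable_continuous_interval c bump_nonneg)
  moreover have "I \<noteq> 0"
  proof
    assume "I = 0"
    then have "(bump e has_integral 0) (cbox (-e) e)" using I by simp
    then have "bump e 0 = 0"
      by (rule has_integral_0_cbox_imp_0 [OF c bump_nonneg]) (use assms in auto)
    then show False using bump_pos [of 0 e] assms by simp
  qed
  ultimately show ?thesis by (intro exI [of _ I]) auto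
qed

text \<open>Both bumps have the same integral, so the primitive of their difference vanishes to the right of both.\<close>

lemma bump_difference_primitive:
  assumes "0 < e" "e < s" "s < t"
  obtains \<eta> where "\<And>x. (\<eta> has_real_derivative bump e (x - s) - bump e (x - t)) (at x)"
    "\<And>x. x \<notin> {s - e..t + e} \<Longrightarrow> \<eta> x = 0"
proof -
  define \<rho> where "\<rho> x = bump e (x - s) - bump e (x - t)" for x
  define \<eta> where "\<eta> x = integral {0..x} \<rho>" for x
  have c: "continuous_on S \<rho>" for S
    unfolding \<rho>_def by (intro continuous_intros continuous_bump)
  have \<rho>0: "\<rho> x = 0" if "x < s - e" for x
    using that assms by (auto simp: \<rho>_def bump_zero)
  have \<eta>0: "\<eta> x = 0" if "x < s - e" for x
  proof -
    have "\<eta> x = integral {0..x} (\<lambda>_. 0)"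
      unfolding \<eta>_def by (rule integral_cong) (use that \<rho>0 in auto)
    then show ?thesis by simp
  qed
  have "(\<eta> has_real_derivative \<rho> x) (at x)" for x
  proof (cases "x < s - e")
    case True
    have "((\<lambda>_. 0 :: real) has_real_derivative 0) (at x)" by simp
    then have "(\<eta> has_real_derivative 0) (at x)"
      by (rule has_field_derivative_transform_within_open [of _ _ _ "{..<s - e}"]) (use True \<eta>0 in auto)
    then show ?thesis using \<rho>0 [OF True] by simp
  next
    case False
    then have x: "x \<in> {0<..<x + 1}" using assms by auto
    have "(\<eta> has_real_derivative \<rho> x) (at x within {0..x + 1})"
      unfolding \<eta>_def using x by (intro integral_has_real_derivative c) auto
    then show ?thesis using x by (simp add: at_within_Icc_at)
  qed
  moreover have "\<eta> x = 0" if "x \<notin> {s - e..t + e}" for x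
  proof (cases "x < s - e")
    case False
    then have x: "t + e \<le> x" using that by auto
    obtain I where "I > 0"
      and I: "\<And>s a b. a \<le> s - e \<Longrightarrow> s + e \<le> b \<Longrightarrow> ((\<lambda>x. bump e (x - s)) has_integral I) {a..b}"
      using bump_integral [OF assms(1)] by blast
    have "(\<rho> has_integral I - I) {0..x}"
      unfolding \<rho>_def by (intro has_integral_diff I) (use x assms in auto)
    then show ?thesis unfolding \<eta>_def by (simp add: integral_unique)
  qed (rule \<eta>0)
  ultimately show thesis using that unfolding \<rho>_def by blast
qed

text \<open>This is the lemma of du Bois-Reymond for continuous functions. Let \<open>w\<close> be \<open>u\<close> minus a primitive of \<open>G\<close>; then
  \<open>w\<close> is orthogonal to the derivatives of test functions. A difference of two translated bumps is
  such a derivative, so the averages of \<open>w\<close> near any two points agree and \<open>w\<close> is constant.\<close>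

lemma weak_derivative_imp_derivative:
  fixes u G :: "real \<Rightarrow> real"
  assumes u: "continuous_on {0..} u" and G: "continuous_on {0..} G"
    and weak: "\<And>\<eta> a b. (\<And>k. Ck k \<eta>) \<Longrightarrow> 0 < a \<Longrightarrow> (\<And>t. t \<notin> {a..b} \<Longrightarrow> \<eta> t = 0) \<Longrightarrow>
      (LINT t:{0..}|lborel. deriv \<eta> t * u t + \<eta> t * G t) = 0"
    and "t > 0"
  shows "(u has_real_derivative G t) (at t)"
proof -
  define W where "W x = integral {0..x} G" for x
  have W: "(W has_real_derivative G x) (at x)" if "x > 0" for x
  proof -
    have "(W has_real_derivative G x) (at x within {0..x + 1})"
      unfolding W_def using that G by (intro integral_has_real_derivative) (auto elim: continuous_on_subset)
    then show ?thesis using that by (simp add: at_within_Icc_at)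
  qed
  define w where "w x = u x - W x" for x
  have uc: "continuous_on {0<..} u" using u by (rule continuous_on_subset) auto
  have Wc: "continuous_on {0<..} W"
    by (intro continuous_at_imp_continuous_on ballI DERIV_isCont [OF W]) auto
  have wc: "continuous_on {0<..} w" unfolding w_def by (intro continuous_intros uc Wc)
  \<comment> \<open>The test function is the primitive of \<open>\<rho>\<close>; the primitive \<open>W\<close> is moved to it by integration by parts.\<close>
  have ortho: "integral {a..b} (\<lambda>x. (bump e (x - s) - bump e (x - t)) * w x) = 0"
    if e: "0 < e" "0 < a" "a < s - e" "s < t" "t + e < b" for e s t a b
  proof -
    define \<rho> where "\<rho> x = bump e (x - s) - bump e (x - t)" for x
    have \<rho>k: "Ck k \<rho>" for k
    proof -
      have "Ck k (\<lambda>x. bump e (x - s) + (- 1) * bump e (x - t))"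
        by (intro Ck_add Ck_mult Ck_const Ck_bump)
      then show ?thesis by (simp add: \<rho>_def [abs_def])
    qed
    have \<rho>c: "continuous_on S \<rho>" for S
      using \<rho>k [of 0] by (auto elim: continuous_on_subset)
    obtain \<eta> where \<eta>: "\<And>x. (\<eta> has_real_derivative \<rho> x) (at x)"
      and \<eta>0: "\<And>x. x \<notin> {s - e..t + e} \<Longrightarrow> \<eta> x = 0"
      using bump_difference_primitive [of e s t] e unfolding \<rho>_def by auto
    have \<rho>0: "\<rho> x = 0" if "x \<notin> {s - e..t + e}" for x
      using that e by (auto simp: \<rho>_def bump_zero)
    have Ck\<eta>: "Ck k \<eta>" for k
      using Ck_mono_Suc [OF Ck_Suc_realI [OF \<eta> \<rho>k]] .
    have \<eta>c: "continuous_on S \<eta>" for S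
      using Ck\<eta> [of 0] by (auto elim: continuous_on_subset)
    have ab: "{a..b} \<subseteq> {0<..}" "{a..b} \<subseteq> {0..}" using e by auto
    let ?f = "\<lambda>x. \<rho> x * u x + \<eta> x * G x"
    have fc: "continuous_on {a..b} ?f"
      by (intro continuous_intros \<rho>c \<eta>c continuous_on_subset [OF u] continuous_on_subset [OF G] ab)
    have "0 = (LINT x:{0..}|lborel. deriv \<eta> x * u x + \<eta> x * G x)"
      using weak [OF Ck\<eta>, of "s - e" "t + e"] \<eta>0 e by simp
    also have "\<dots> = (LINT x:{a..b}|lborel. ?f x)"
      unfolding set_lebesgue_integral_def
    proof (rule Bochner_Integration.integral_cong [OF refl])
      fix x
      have "?f x = 0" if "x \<notin> {a..b}"
      proof -
        have "x \<notin> {s - e..t + e}" using that e by auto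
        then show ?thesis using \<rho>0 \<eta>0 by simp
      qed
      then show "indicator {0..} x *\<^sub>R (deriv \<eta> x * u x + \<eta> x * G x) = indicator {a..b} x *\<^sub>R ?f x"
        using ab DERIV_imp_deriv [OF \<eta>] by (auto simp: indicator_def)
    qed
    also have "\<dots> = integral {a..b} ?f"
      by (intro set_borel_integral_eq_integral borel_integrable_atLeastAtMost' fc)
    finally have 0: "integral {a..b} ?f = 0" by simp
    have "((\<lambda>x. \<rho> x * W x + \<eta> x * G x) has_integral (\<eta> b * W b - \<eta> a * W a)) {a..b}"
    proof (rule fundamental_theorem_of_calculus)
      fix x assume "x \<in> {a..b}"
      then have "x > 0" using e by auto
      have "((\<lambda>x. \<eta> x * W x) has_real_derivative \<rho> x * W x + \<eta> x * G x) (at x)"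
        using DERIV_mult [OF \<eta> W [OF \<open>x > 0\<close>]] by (simp add: algebra_simps)
      then show "((\<lambda>x. \<eta> x * W x) has_vector_derivative \<rho> x * W x + \<eta> x * G x) (at x within {a..b})"
        by (simp add: has_real_derivative_iff_has_vector_derivative has_vector_derivative_at_within)
    qed (use e in simp)
    then have 1: "((\<lambda>x. \<rho> x * W x + \<eta> x * G x) has_integral 0) {a..b}"
      using \<eta>0 [of a] \<eta>0 [of b] e by simp
    have "(?f has_integral 0) {a..b}"
      using integrable_integral [OF integrable_continuous_interval [OF fc]] 0 by simp
    from has_integral_diff [OF this 1] have "((\<lambda>x. \<rho> x * w x) has_integral 0) {a..b}"
      by (simp add: w_def algebra_simps)
    then show ?thesis unfolding \<rho>_def by (rule integral_unique)
  qed
  have const: "w s = w t" if st: "0 < s" "s < t" for s t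
  proof (rule ccontr)
    assume "w s \<noteq> w t"
    \<comment> \<open>The two averages are equal but lie within \<open>d\<close> of \<open>w s\<close> and \<open>w t\<close>, which are \<open>3 d\<close> apart.\<close>
    define d where "d = \<bar>w s - w t\<bar> / 3"
    have d: "d > 0" using \<open>w s \<noteq> w t\<close> by (simp add: d_def)
    have nb: "\<exists>\<epsilon>>0. \<forall>y. \<bar>y - x\<bar> < \<epsilon> \<longrightarrow> \<bar>w y - w x\<bar> < d" if "x > 0" for x
    proof -
      have "isCont w x" using wc that by (simp add: continuous_on_eq_continuous_at)
      then show ?thesis using d unfolding continuous_at_eps_delta by (simp add: dist_real_def)
    qed
    have "t > 0" using st by linarith
    obtain \<epsilon>1 where \<epsilon>1: "\<epsilon>1 > 0" "\<And>y. \<bar>y - s\<bar> < \<epsilon>1 \<Longrightarrow> \<bar>w y - w s\<bar> < d"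
      using nb [OF st(1)] by blast
    obtain \<epsilon>2 where \<epsilon>2: "\<epsilon>2 > 0" "\<And>y. \<bar>y - t\<bar> < \<epsilon>2 \<Longrightarrow> \<bar>w y - w t\<bar> < d"
      using nb [OF \<open>t > 0\<close>] by blast
    note \<epsilon> = \<epsilon>1(1) \<epsilon>2(1) \<epsilon>1(2) \<epsilon>2(2)
    define e where "e = min (s / 2) (min \<epsilon>1 \<epsilon>2)"
    have e: "0 < e" "e < s" "e \<le> \<epsilon>1" "e \<le> \<epsilon>2" using \<epsilon> st by (auto simp: e_def)
    define a where "a = (s - e) / 2"
    define b where "b = t + e + 1"
    have ab: "0 < a" "a < s - e" "t + e < b" using e st by (auto simp: a_def b_def)
    have sub: "{a..b} \<subseteq> {0<..}" using ab by auto
    obtain I where I: "I > 0"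
      "\<And>s a b. a \<le> s - e \<Longrightarrow> s + e \<le> b \<Longrightarrow> ((\<lambda>x. bump e (x - s)) has_integral I) {a..b}"
      using bump_integral [OF e(1)] by blast
    have wcab: "continuous_on {a..b} w" using wc sub by (rule continuous_on_subset)
    have close: "\<bar>integral {a..b} (\<lambda>x. bump e (x - c) * w x) - I * w c\<bar> \<le> I * d"
      if c: "a \<le> c - e" "c + e \<le> b" and n: "\<And>y. \<bar>y - c\<bar> < e \<Longrightarrow> \<bar>w y - w c\<bar> < d" for c
    proof -
      note Ic = I(2) [OF c]
      have i1: "(\<lambda>x. bump e (x - c) * w x) integrable_on {a..b}"
        by (intro integrable_continuous_interval continuous_intros continuous_bump wcab)
      have i2: "((\<lambda>x. bump e (x - c) * w c) has_integral I * w c) {a..b}"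
        using has_integral_mult_left [OF Ic] .
      have "((\<lambda>x. bump e (x - c) * w x - bump e (x - c) * w c) has_integral
          integral {a..b} (\<lambda>x. bump e (x - c) * w x) - I * w c) {a..b}"
        by (rule has_integral_diff [OF integrable_integral [OF i1] i2])
      then have e1: "((\<lambda>x. bump e (x - c) * (w x - w c)) has_integral
          integral {a..b} (\<lambda>x. bump e (x - c) * w x) - I * w c) {a..b}"
        by (simp add: right_diff_distrib)
      have e2: "((\<lambda>x. bump e (x - c) * d) has_integral I * d) {a..b}"
        using has_integral_mult_left [OF Ic] .
      have "norm (integral {a..b} (\<lambda>x. bump e (x - c) * (w x - w c))) \<le> integral {a..b} (\<lambda>x. bump e (x - c) * d)"
      proof (rule integral_norm_bound_integral)
        fix x
        show "norm (bump e (x - c) * (w x - w c)) \<le> bump e (x - c) * d"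
        proof (cases "\<bar>x - c\<bar> < e")
          case True
          then show ?thesis using n [of x] bump_nonneg [of e "x - c"]
            by (simp add: abs_mult mult_left_mono)
        qed (simp add: bump_zero)
      qed (use e1 e2 in blast)+
      then show ?thesis unfolding integral_unique [OF e1] integral_unique [OF e2] by simp
    qed
    have i: "(\<lambda>x. bump e (x - c) * w x) integrable_on {a..b}" for c
      by (intro integrable_continuous_interval continuous_intros continuous_bump wcab)
    have "integral {a..b} (\<lambda>x. bump e (x - s) * w x) = integral {a..b} (\<lambda>x. bump e (x - t) * w x)"
      using ortho [OF e(1) ab(1,2) st(2) ab(3)] integral_diff [OF i [of s] i [of t]]
      by (simp add: left_diff_distrib)
    moreover have "\<bar>integral {a..b} (\<lambda>x. bump e (x - s) * w x) - I * w s\<bar> \<le> I * d"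
      using ab st e \<epsilon>(3) by (intro close) auto
    moreover have "\<bar>integral {a..b} (\<lambda>x. bump e (x - t) * w x) - I * w t\<bar> \<le> I * d"
      using ab st e \<epsilon>(4) by (intro close) auto
    ultimately have "\<bar>I * w s - I * w t\<bar> \<le> 2 * (I * d)" by linarith
    then have "I * \<bar>w s - w t\<bar> \<le> I * (2 * d)"
      using I(1) by (simp add: right_diff_distrib [symmetric] abs_mult)
    then show False using I(1) d by (simp add: d_def)
  qed
  have eq: "W x + w t = u x" if "x > 0" for x
  proof -
    have "w x = w t"
    proof (cases x t rule: linorder_cases)
      case less then show ?thesis using const that by blast
    next
      case greater then show ?thesis using const [OF \<open>t > 0\<close> greater] by simp
    qed simp
    then show ?thesis by (simp add: w_def)
  qed
  have "((\<lambda>x. W x + w t) has_real_derivative G t) (at t)"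
    using DERIV_add [OF W [OF \<open>t > 0\<close>] DERIV_const, of "w t"] by simp
  then show ?thesis
    by (rule has_field_derivative_transform_within_open [of _ _ _ "{0<..}"]) (use \<open>t > 0\<close> eq in auto)
qed

section \<open>The Fokker-Planck equation tested with a function of space\<close>

text \<open>The product of the projection with the identity is open, so continuity descends from lifts.\<close>

lemma continuous_on_torus_lift:
  fixes f :: "'n::finite torus \<Rightarrow> 'b::topological_space \<Rightarrow> 'c::topological_space"
  assumes "continuous_on UNIV (\<lambda>(z, p). f (to_torus z) p)"
  shows "continuous_on UNIV (\<lambda>(X, p). f X p)"
  unfolding continuous_on_open_vimage [OF open_UNIV]
proof safe
  fix V :: "'c set" assume V: "open V"
  define U where "U = (\<lambda>(z, p). f (to_torus z) p) -` V"
  have U: "open U" using open_vimage [OF V assms] by (simp add: U_def)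
  show "open ((\<lambda>(X, p). f X p) -` V \<inter> UNIV)"
  proof (rule topological_space_class.openI)
    fix Xp assume Xp: "Xp \<in> (\<lambda>(X, p). f X p) -` V \<inter> UNIV"
    obtain X p where [simp]: "Xp = (X, p)" by (cases Xp)
    have "(rep_torus X, p) \<in> U" using Xp by (simp add: U_def)
    then obtain A B where AB: "open A" "open B" "(rep_torus X, p) \<in> A \<times> B" "A \<times> B \<subseteq> U"
      using open_prod_elim [OF U] by blast
    have "to_torus ` A \<times> B \<subseteq> (\<lambda>(X, p). f X p) -` V"
    proof safe
      fix z q assume "z \<in> A" "q \<in> B"
      then have "(z, q) \<in> U" using AB by blast
      then show "(to_torus z, q) \<in> (\<lambda>(X, p). f X p) -` V" by (simp add: U_def)
    qed
    moreover have "(X, p) \<in> to_torus ` A \<times> B"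
      using AB(3) to_torus_rep [of X] by (metis SigmaD1 SigmaD2 SigmaI image_eqI)
    ultimately show "\<exists>T. open T \<and> Xp \<in> T \<and> T \<subseteq> (\<lambda>(X, p). f X p) -` V \<inter> UNIV"
      using open_Times [OF open_to_torus_image [OF AB(1)] AB(2)]
      by (intro exI [of _ "to_torus ` A \<times> B"]) auto
  qed
qed

lemma continuous_on_torus_lift1:
  assumes "continuous_on UNIV (\<lambda>z. f (to_torus z))"
  shows "continuous_on UNIV f"
proof -
  have "open (f -` V)" if "open V" for V
  proof -
    have "f -` V = to_torus ` ((\<lambda>z. f (to_torus z)) -` V)"
    proof (intro subset_antisym subsetI)
      fix X assume "X \<in> f -` V"
      then show "X \<in> to_torus ` ((\<lambda>z. f (to_torus z)) -` V)"
        by (intro image_eqI [of _ _ "rep_torus X"]) simp_all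
    qed auto
    then show ?thesis using open_to_torus_image [OF open_vimage [OF that assms]] by simp
  qed
  then show ?thesis by (simp add: continuous_on_open_vimage)
qed

text \<open>Translation by \<open>z' - z\<close> maps the lift to itself. Hence the gradient on the torus, defined at a
  chosen representative, can be computed at any lift of the point.\<close>

lemma frechet_derivative_lift:
  assumes g: "tdifferentiable g" and z: "to_torus z = to_torus z'"
  shows "frechet_derivative (\<lambda>y. g (to_torus y)) (at z) = frechet_derivative (\<lambda>y. g (to_torus y)) (at z')"
proof -
  let ?G = "\<lambda>y. g (to_torus y)"
  have "to_torus (y + (z' - z)) = to_torus y" for y
    using z unfolding to_torus_eq_iff lattice_equiv_def
    by (simp add: algebra_simps) (metis Ints_minus minus_diff_eq)
  then have eq: "(\<lambda>y. ?G (y + (z' - z))) = ?G" by simp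
  have "(?G has_derivative frechet_derivative ?G (at z')) (at (z + (z' - z)))"
  proof -
    have "?G differentiable (at z')" using g by (simp add: tdifferentiable_def)
    then show ?thesis unfolding frechet_derivative_works by simp
  qed
  then have "((\<lambda>y. ?G (y + (z' - z))) has_derivative (\<lambda>h. frechet_derivative ?G (at z') h)) (at z)"
    by (rule has_derivative_compose [rotated]) (auto intro!: derivative_eq_intros)
  then show ?thesis unfolding eq by (rule frechet_derivative_eqI)
qed

lemma tgrad_to_torus:
  assumes "tdifferentiable g"
  shows "tgrad g (to_torus z) $ i = frechet_derivative (\<lambda>y. g (to_torus y)) (at z) (axis i 1)"
  using frechet_derivative_lift [OF assms, of "rep_torus (to_torus z)" z]
  by (simp add: tgrad_def grad_def)

lemma Ck_space_imp_Ck: "Ck_space k g \<Longrightarrow> Ck k (\<lambda>z. g m (to_torus z))"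
proof (induction k arbitrary: g)
  case 0
  then have "continuous_on UNIV (g m)" using continuous_on_slice by auto
  then show ?case using continuous_on_compose2 [OF _ continuous_to_torus [of UNIV]] by auto
next
  case (Suc k)
  have d: "tdifferentiable (g m)" for m using Suc.prems by simp
  have "Ck k (\<lambda>z. frechet_derivative (\<lambda>y. g m (to_torus y)) (at z) b)" if "b \<in> Basis" for b
  proof -
    obtain i where b: "b = axis i 1" using \<open>b \<in> Basis\<close> by (auto simp: Basis_vec_def)
    have "Ck k (\<lambda>z. tgrad (g m) (to_torus z) $ i)"
      using Suc.IH [of "\<lambda>m x. tgrad (g m) x $ i"] Suc.prems by simp
    then show ?thesis by (simp add: tgrad_to_torus [OF d] b)
  qed
  then show ?case using d by (simp add: tdifferentiable_def)
qed

lemma tgrad_cmult: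
  assumes "tdifferentiable g"
  shows "tgrad (\<lambda>x. c * g x) x = c *\<^sub>R tgrad g x"
proof -
  have "((\<lambda>y. g (to_torus y)) has_derivative frechet_derivative (\<lambda>y. g (to_torus y)) (at z)) (at z)" for z
    using assms frechet_derivative_works unfolding tdifferentiable_def by blast
  then have "frechet_derivative (\<lambda>y. c * g (to_torus y)) (at z)
      = (\<lambda>h. c * frechet_derivative (\<lambda>y. g (to_torus y)) (at z) h)" for z
    by (intro frechet_derivative_eqI has_derivative_mult_right)
  then show ?thesis by (simp add: tgrad_def grad_def vec_eq_iff)
qed

context
  fixes \<psi> :: "'n::finite torus \<Rightarrow> real"
  assumes sm: "\<And>k. Ck k (\<lambda>z. \<psi> (to_torus z))"
begin

lemma smooth_tdifferentiable: "tdifferentiable \<psi>"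
  using sm [of "Suc 0"] unfolding tdifferentiable_def by (simp only: Ck.simps) blast

lemma smooth_tgrad: "Ck k (\<lambda>z. tgrad \<psi> (to_torus z) $ i)"
  using sm [of "Suc k"] by (simp add: tgrad_to_torus [OF smooth_tdifferentiable] axis_in_Basis_iff)

end

lemma continuous_tgrad:
  assumes "\<And>k. Ck k (\<lambda>z. \<psi> (to_torus z))"
  shows "continuous_on UNIV (tgrad \<psi>)"
proof -
  have "continuous_on UNIV (\<lambda>x. tgrad \<psi> x $ i)" for i
    using smooth_tgrad [OF assms, of 0 i] by (intro continuous_on_torus_lift1) simp
  then have "continuous_on UNIV (\<lambda>x. \<chi> i. tgrad \<psi> x $ i)" by (intro continuous_on_vec_lambda)
  then show ?thesis by simp
qed

lemma continuous_tlap: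
  assumes "\<And>k. Ck k (\<lambda>z. \<psi> (to_torus z))"
  shows "continuous_on UNIV (tlap \<psi>)"
proof -
  have "continuous_on UNIV (\<lambda>x. tgrad (\<lambda>y. tgrad \<psi> y $ i) x)" for i
    by (intro continuous_tgrad smooth_tgrad assms)
  then show ?thesis unfolding tlap_def tdiv_def by (intro continuous_intros) auto
qed

lemma tlap_cmult:
  assumes "\<And>k. Ck k (\<lambda>z. \<psi> (to_torus z))"
  shows "tlap (\<lambda>x. c * \<psi> x) x = c * tlap \<psi> x"
proof -
  have 1: "tgrad (\<lambda>x. c * \<psi> x) = (\<lambda>x. c *\<^sub>R tgrad \<psi> x)"
    by (intro ext tgrad_cmult smooth_tdifferentiable assms)
  have 2: "tgrad (\<lambda>x. c * tgrad \<psi> x $ i) x = c *\<^sub>R tgrad (\<lambda>x. tgrad \<psi> x $ i) x" for i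
    by (intro tgrad_cmult smooth_tdifferentiable smooth_tgrad assms)
  show ?thesis unfolding tlap_def tdiv_def 1 by (simp add: 2 sum_distrib_left)
qed

lemma continuous_evaluation:
  "continuous_on UNIV (\<lambda>(\<alpha>, y). apply_bcontfun (\<alpha> :: 'a::metric_space \<Rightarrow>\<^sub>C 'b::metric_space) y)"
  unfolding continuous_on_def
proof
  fix q :: "('a \<Rightarrow>\<^sub>C 'b) \<times> 'a"
  obtain \<alpha> y where q: "q = (\<alpha>, y)" by (cases q)
  have "((\<lambda>p. dist (apply_bcontfun (fst p) (snd p)) (apply_bcontfun \<alpha> y)) \<longlongrightarrow> 0) (at (\<alpha>, y))"
  proof (rule tendsto_sandwich [OF always_eventually always_eventually tendsto_const,
        where h = "\<lambda>p. dist (fst p) \<alpha> + dist (apply_bcontfun \<alpha> (snd p)) (apply_bcontfun \<alpha> y)"])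
    show "\<forall>p :: ('a \<Rightarrow>\<^sub>C 'b) \<times> 'a. 0 \<le> dist (apply_bcontfun (fst p) (snd p)) (apply_bcontfun \<alpha> y)" by simp
    show "\<forall>p. dist (apply_bcontfun (fst p) (snd p)) (apply_bcontfun \<alpha> y)
      \<le> dist (fst p) \<alpha> + dist (apply_bcontfun \<alpha> (snd p)) (apply_bcontfun \<alpha> y)"
      by (meson add_right_mono dist_bounded dist_triangle order_trans)
  next
    have c: "isCont (apply_bcontfun \<alpha>) y"
      by (rule continuous_on_eq_continuous_at [OF open_UNIV, THEN iffD1, rule_format])
        (rule continuous_on_apply_bcontfun UNIV_I)+
    have "((\<lambda>p. apply_bcontfun \<alpha> (snd p)) \<longlongrightarrow> apply_bcontfun \<alpha> y) (at (\<alpha>, y))"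
      by (rule isCont_tendsto_compose [OF c]) (auto intro!: tendsto_eq_intros)
    then have "((\<lambda>p. dist (fst p) \<alpha> + dist (apply_bcontfun \<alpha> (snd p)) (apply_bcontfun \<alpha> y)) \<longlongrightarrow>
        dist \<alpha> \<alpha> + dist (apply_bcontfun \<alpha> y) (apply_bcontfun \<alpha> y)) (at (\<alpha>, y))"
      by (intro tendsto_add tendsto_dist tendsto_const) (auto intro!: tendsto_eq_intros)
    then show "((\<lambda>p. dist (fst p) \<alpha> + dist (apply_bcontfun \<alpha> (snd p)) (apply_bcontfun \<alpha> y)) \<longlongrightarrow> 0) (at (\<alpha>, y))"
      by simp
  qed
  then show "((\<lambda>(\<alpha>, y). apply_bcontfun \<alpha> y) \<longlongrightarrow> (case q of (\<alpha>, y) \<Rightarrow> apply_bcontfun \<alpha> y)) (at q within UNIV)"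
    unfolding q by (subst tendsto_dist_iff) (simp add: case_prod_beta')
qed

lemma test_function_product:
  assumes sm: "\<And>k. Ck k (\<lambda>z. \<psi> (to_torus z))" and \<eta>: "\<And>k. Ck k \<eta>"
    and a: "0 < a" and supp: "\<And>t. t \<notin> {a..b} \<Longrightarrow> \<eta> t = 0"
  shows "test_function (\<lambda>t x. \<eta> t * \<psi> (x :: 'n::finite torus))"
proof -
  have "Ck k (\<lambda>p :: real \<times> (real ^ 'n). \<eta> (fst p + 0) * \<psi> (to_torus (snd p + 0)))" for k
    by (intro Ck_mult Ck_compose_affine [OF bounded_linear_fst \<eta>]
        Ck_compose_affine [OF bounded_linear_snd sm])
  then have "smooth (\<lambda>(t, z :: real ^ 'n). \<eta> t * \<psi> (to_torus z))"
    by (simp add: smooth_def case_prod_beta')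
  then show ?thesis using a supp unfolding test_function_def by (metis mult_zero_left)
qed

text \<open>With \<open>l = \<Delta>\<psi>\<close> and \<open>g = D\<psi>\<close> this is the time derivative of \<open>\<integral>\<psi> dm\<close> along the Fokker-Planck equation. Later
  \<open>\<psi>\<close> is a flat derivative, whose gradient and Laplacian depend on a further measure.\<close>

definition drift_pairing ::
    "('n::finite torus \<Rightarrow> real) \<Rightarrow> ('n torus \<Rightarrow> real ^ 'n) \<Rightarrow> 'n ptorus \<Rightarrow> ('n torus \<Rightarrow>\<^sub>C (real ^ 'n)) \<Rightarrow> real" where
  "drift_pairing l g m \<alpha> = (LINT x|meas m. l x - g x \<bullet> apply_bcontfun \<alpha> x)"

lemma continuous_drift_pairing:
  fixes l :: "'a::topological_space \<Rightarrow> 'n::finite torus \<Rightarrow> real" and g :: "'a \<Rightarrow> 'n torus \<Rightarrow> real ^ 'n"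
  assumes l: "continuous_on UNIV (\<lambda>(a, x). l a x)" and g: "continuous_on UNIV (\<lambda>(a, x). g a x)"
  shows "continuous_on UNIV (\<lambda>(a, m, \<alpha>). drift_pairing (l a) (g a) m \<alpha>)"
proof -
  have sel: "continuous_on UNIV (\<lambda>p :: ('a \<times> 'n ptorus \<times> ('n torus \<Rightarrow>\<^sub>C (real ^ 'n))) \<times> 'n torus. (fst (fst p), snd p))"
    "continuous_on UNIV (\<lambda>p :: ('a \<times> 'n ptorus \<times> ('n torus \<Rightarrow>\<^sub>C (real ^ 'n))) \<times> 'n torus. (snd (snd (fst p)), snd p))"
    by (intro continuous_intros)+
  have "continuous_on UNIV (\<lambda>(p :: 'a \<times> 'n ptorus \<times> ('n torus \<Rightarrow>\<^sub>C (real ^ 'n)), x).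
      l (fst p) x - g (fst p) x \<bullet> apply_bcontfun (snd (snd p)) x)"
    unfolding case_prod_beta'
    using continuous_on_compose2 [OF l sel(1)] continuous_on_compose2 [OF g sel(1)]
      continuous_on_compose2 [OF continuous_evaluation sel(2)]
    by (intro continuous_on_diff continuous_on_inner) simp_all
  then have "continuous_on UNIV (\<lambda>p. LINT x|meas (fst (snd p)). l (fst p) x - g (fst p) x \<bullet> apply_bcontfun (snd (snd p)) x)"
    by (rule continuous_integral_param) (intro continuous_intros)
  then show ?thesis by (simp add: drift_pairing_def case_prod_beta')
qed

text \<open>Products \<open>\<eta>(t) \<psi>(x)\<close> are test functions, so the pairing is the weak time derivative of \<open>\<integral>\<psi> dm(t)\<close>. It is
  continuous because \<open>m\<close> and \<open>a\<close> are, so it is a classical derivative.\<close>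

lemma fokker_planck_derivative:
  fixes \<psi> :: "'n::finite torus \<Rightarrow> real"
  assumes sm: "\<And>k. Ck k (\<lambda>z. \<psi> (to_torus z))"
    and FP: "fokker_planck m (\<lambda>t. apply_bcontfun (a t))"
    and m: "continuous_on {0..} m" and a: "continuous_on {0..} a" and "t > 0"
  shows "((\<lambda>t. LINT x|meas (m t). \<psi> x) has_real_derivative drift_pairing (tlap \<psi>) (tgrad \<psi>) (m t) (a t)) (at t)"
proof -
  define u where "u t = (LINT x|meas (m t). \<psi> x)" for t
  define G where "G t = drift_pairing (tlap \<psi>) (tgrad \<psi>) (m t) (a t)" for t
  have c\<psi>: "continuous_on UNIV \<psi>"
    using sm [of 0] by (intro continuous_on_torus_lift1) simp
  note cg = continuous_tgrad [OF sm] and cl = continuous_tlap [OF sm]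
  have u: "continuous_on {0..} u"
    using continuous_on_compose2 [OF continuous_integral_meas [OF c\<psi>] m] by (simp add: u_def)
  have "continuous_on UNIV (\<lambda>(_ :: real, x). tlap \<psi> x)" "continuous_on UNIV (\<lambda>(_ :: real, x). tgrad \<psi> x)"
    unfolding case_prod_beta' by (rule continuous_on_compose2 [OF cl] continuous_on_compose2 [OF cg]; auto intro!: continuous_intros)+
  from continuous_drift_pairing [OF this]
  have Q: "continuous_on UNIV (\<lambda>(_ :: real, m, \<alpha>). drift_pairing (tlap \<psi>) (tgrad \<psi>) m \<alpha>)" .
  have "continuous_on {0..} (\<lambda>t. (0 :: real, m t, a t))" using m a by (intro continuous_intros)
  from continuous_on_compose2 [OF Q this] have G: "continuous_on {0..} G" by (simp add: G_def)
  have "(u has_real_derivative G t) (at t)"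
  proof (rule weak_derivative_imp_derivative [OF u G _ \<open>t > 0\<close>])
    fix \<eta> :: "real \<Rightarrow> real" and c b :: real
    assume \<eta>: "\<And>k. Ck k \<eta>" "0 < c" "\<And>t. t \<notin> {c..b} \<Longrightarrow> \<eta> t = 0"
    have d\<eta>: "(\<eta> has_real_derivative deriv \<eta> t) (at t)" for t
    proof -
      have "\<eta> differentiable (at t)" using \<eta>(1) [of "Suc 0"] by simp
      then show ?thesis by (simp add: DERIV_deriv_iff_real_differentiable)
    qed
    have "(LINT x|meas (m t). deriv (\<lambda>s. \<eta> s * \<psi> x) t + tlap (\<lambda>x. \<eta> t * \<psi> x) x
        - tgrad (\<lambda>x. \<eta> t * \<psi> x) x \<bullet> apply_bcontfun (a t) x) = deriv \<eta> t * u t + \<eta> t * G t" for t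
    proof -
      have "deriv (\<lambda>s. \<eta> s * \<psi> x) t = deriv \<eta> t * \<psi> x" for x
        by (rule DERIV_imp_deriv) (rule DERIV_cmult_right [OF d\<eta>])
      then have "(LINT x|meas (m t). deriv (\<lambda>s. \<eta> s * \<psi> x) t + tlap (\<lambda>x. \<eta> t * \<psi> x) x
          - tgrad (\<lambda>x. \<eta> t * \<psi> x) x \<bullet> apply_bcontfun (a t) x)
        = (LINT x|meas (m t). deriv \<eta> t * \<psi> x + \<eta> t * (tlap \<psi> x - tgrad \<psi> x \<bullet> apply_bcontfun (a t) x))"
        by (simp add: tlap_cmult [OF sm] tgrad_cmult [OF smooth_tdifferentiable [OF sm]] algebra_simps)
      also have "\<dots> = deriv \<eta> t * u t + \<eta> t * G t"
      proof -
        have "integrable (meas (m t)) \<psi>" by (intro integrable_meas c\<psi>)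
        moreover have "integrable (meas (m t)) (\<lambda>x. tlap \<psi> x - tgrad \<psi> x \<bullet> apply_bcontfun (a t) x)"
          by (intro integrable_meas continuous_intros cl cg continuous_on_apply_bcontfun)
        ultimately show ?thesis unfolding u_def G_def drift_pairing_def by simp
      qed
      finally show ?thesis .
    qed
    then show "(LINT t:{0..}|lborel. deriv \<eta> t * u t + \<eta> t * G t) = 0"
      using FP [unfolded fokker_planck_def, rule_format, OF test_function_product [OF sm \<eta>]] by simp
  qed
  then show ?thesis unfolding u_def G_def .
qed

section \<open>The chain rule on the space of measures\<close>

lemma emeasure_meas_UNIV [simp]: "emeasure (meas m) UNIV = 1"
  using prob_space.emeasure_space_1 [OF prob_space_meas, of m] by simp

text \<open>A convex combination is a Bernoulli mixture, to which the integration rules for \<open>\<bind>\<close> apply.\<close>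

lemma meas_convex_comb:
  assumes "0 \<le> t" "t \<le> 1"
  shows "meas (convex_comb t m1 m2) = measure_pmf (bernoulli_pmf t) \<bind> (\<lambda>b. meas (if b then m2 else m1))"
proof -
  define N where "N = measure_pmf (bernoulli_pmf t) \<bind> (\<lambda>b. meas (if b then m2 else m1))"
  have k: "(\<lambda>b. meas (if b then m2 else m1)) \<in> measure_pmf (bernoulli_pmf t) \<rightarrow>\<^sub>M subprob_algebra borel"
    by (auto simp: space_subprob_algebra prob_space_imp_subprob_space prob_space_meas)
  have sN: "sets N = sets borel" unfolding N_def by (rule sets_bind) auto
  have spN: "space N = UNIV" using sets_eq_imp_space_eq [OF sN] by simp
  have e: "emeasure N A = ennreal (1 - t) * emeasure (meas m1) A + ennreal t * emeasure (meas m2) A"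
    if "A \<in> sets borel" for A
    unfolding N_def using assms that
    by (subst emeasure_bind [OF _ k]) (simp_all add: mult.commute add.commute)
  have "prob_space N"
    using assms by (intro prob_spaceI) (simp add: spN e ennreal_plus [symmetric] del: ennreal_plus)
  have "measure_of UNIV (sets borel) (\<lambda>A. ennreal (1 - t) * emeasure (meas m1) A + ennreal t * emeasure (meas m2) A)
      = measure_of (space N) (sets N) (emeasure N)"
    unfolding sN spN using e by (intro measure_of_eq) (auto simp: sets.sigma_sets_eq [of borel, simplified])
  also have "\<dots> = N" by (rule measure_of_of_measure)
  finally show ?thesis
    unfolding convex_comb_def N_def [symmetric] using \<open>prob_space N\<close> sN by (simp add: Abs_ptorus_inverse)
qed

lemma integral_convex_comb:
  fixes f :: "'n::finite torus \<Rightarrow> real"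
  assumes t: "0 \<le> t" "t \<le> 1" and f: "continuous_on UNIV f"
  shows "(LINT x|meas (convex_comb t m1 m2). f x) = (1 - t) * (LINT x|meas m1. f x) + t * (LINT x|meas m2. f x)"
proof -
  have k: "(\<lambda>b. meas (if b then m2 else m1)) \<in> measure_pmf (bernoulli_pmf t) \<rightarrow>\<^sub>M subprob_algebra borel"
    by (auto simp: space_subprob_algebra prob_space_imp_subprob_space prob_space_meas)
  obtain B where B: "\<And>x. norm (f x) \<le> B" using torus_bounded [OF f] by blast
  have "(LINT x|meas (convex_comb t m1 m2). f x)
      = (LINT b|measure_pmf (bernoulli_pmf t). LINT x|meas (if b then m2 else m1). f x)"
    unfolding meas_convex_comb [OF t]
  proof (rule integral_bind [OF _ _ k])
    show "f \<in> borel_measurable borel" using f by (rule borel_measurable_continuous_onI)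
    show "\<bar>f x\<bar> \<le> B" for x using B [of x] by simp
    show "finite_measure (measure_pmf (bernoulli_pmf t))" by unfold_locales
    show "AE b in bernoulli_pmf t. emeasure (meas (if b then m2 else m1)) (space (meas (if b then m2 else m1))) \<le> ennreal 1"
      by simp
  qed
  then show ?thesis using t by simp
qed

text \<open>The weights are arbitrary here; this freedom is what makes limits uniform in the weight.\<close>

lemma convex_comb_tendsto:
  assumes M: "M \<longlonglongrightarrow> L" and \<tau>: "\<And>n. \<tau> n \<in> {0..1}"
  shows "(\<lambda>n. convex_comb (\<tau> n) L (M n)) \<longlonglongrightarrow> L"
proof (rule tendsto_ptorus_weakI)
  fix f :: "'a torus \<Rightarrow> real" assume f: "continuous_on UNIV f"
  have "(\<lambda>n. LINT x|meas (M n). f x) \<longlonglongrightarrow> (LINT x|meas L. f x)"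
    using continuous_on_tendsto_compose [OF continuous_integral_meas [OF f] M] by simp
  then have "(\<lambda>n. (LINT x|meas (M n). f x) - (LINT x|meas L. f x)) \<longlonglongrightarrow> 0"
    by (simp add: LIM_zero_iff)
  then have lim: "(\<lambda>n. \<bar>(LINT x|meas (M n). f x) - (LINT x|meas L. f x)\<bar>) \<longlonglongrightarrow> 0"
    by (rule tendsto_rabs_zero)
  have "norm (\<tau> n * ((LINT x|meas (M n). f x) - (LINT x|meas L. f x)))
      \<le> \<bar>(LINT x|meas (M n). f x) - (LINT x|meas L. f x)\<bar>" for n
    using \<tau> [of n] by (simp add: abs_mult mult_left_le_one_le)
  then have "(\<lambda>n. \<tau> n * ((LINT x|meas (M n). f x) - (LINT x|meas L. f x))) \<longlonglongrightarrow> 0"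
    by (intro Lim_null_comparison [OF always_eventually lim]) simp
  then have "(\<lambda>n. (LINT x|meas L. f x) + \<tau> n * ((LINT x|meas (M n). f x) - (LINT x|meas L. f x)))
      \<longlonglongrightarrow> (LINT x|meas L. f x) + 0" by (intro tendsto_intros)
  moreover have "(LINT x|meas (convex_comb (\<tau> n) L (M n)). f x)
      = (LINT x|meas L. f x) + \<tau> n * ((LINT x|meas (M n). f x) - (LINT x|meas L. f x))" for n
    using integral_convex_comb [OF _ _ f, of "\<tau> n" L "M n"] \<tau> [of n] by (simp add: algebra_simps)
  ultimately show "(\<lambda>n. LINT x|meas (convex_comb (\<tau> n) L (M n)). f x) \<longlonglongrightarrow> (LINT x|meas L. f x)" by simp
qed

lemma continuous_convex_comb: "continuous_on {0..1} (\<lambda>t. convex_comb t m1 m2)"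
  unfolding continuous_on_sequentially
proof safe
  fix \<tau> :: "nat \<Rightarrow> real" and t assume \<tau>: "\<forall>n. \<tau> n \<in> {0..1}" "\<tau> \<longlonglongrightarrow> t" and t: "t \<in> {0..1}"
  show "((\<lambda>t. convex_comb t m1 m2) \<circ> \<tau>) \<longlonglongrightarrow> convex_comb t m1 m2"
  proof (rule tendsto_ptorus_weakI)
    fix f :: "'a torus \<Rightarrow> real" assume f: "continuous_on UNIV f"
    have "(\<lambda>n. (1 - \<tau> n) * (LINT x|meas m1. f x) + \<tau> n * (LINT x|meas m2. f x))
       \<longlonglongrightarrow> (1 - t) * (LINT x|meas m1. f x) + t * (LINT x|meas m2. f x)"
      by (intro tendsto_intros \<tau>)
    then show "(\<lambda>n. LINT x|meas (((\<lambda>t. convex_comb t m1 m2) \<circ> \<tau>) n). f x) \<longlonglongrightarrow> (LINT x|meas (convex_comb t m1 m2). f x)"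
      using \<tau>(1) t by (simp add: integral_convex_comb [OF _ _ f])
  qed
qed

text \<open>Convergence along every choice of parameters is uniform convergence: choose a violating parameter
  whenever there is one.\<close>

lemma eventually_all_choice:
  assumes "\<And>\<tau>. (\<And>n. \<tau> n \<in> S) \<Longrightarrow> eventually (\<lambda>n. P n (\<tau> n)) sequentially" and "S \<noteq> {}"
  shows "eventually (\<lambda>n. \<forall>x\<in>S. P n x) sequentially"
proof -
  have "\<exists>x\<in>S. (\<exists>y\<in>S. \<not> P n y) \<longrightarrow> \<not> P n x" for n using \<open>S \<noteq> {}\<close> by blast
  then obtain \<tau> where \<tau>: "\<And>n. \<tau> n \<in> S" "\<And>n. (\<exists>y\<in>S. \<not> P n y) \<Longrightarrow> \<not> P n (\<tau> n)" by metis
  from assms(1) [OF \<tau>(1)] show ?thesis by eventually_elim (use \<tau>(2) in blast)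
qed

text \<open>The integrand in the formula that defines the flat derivative.\<close>

definition flat_increment ::
    "('n::finite ptorus \<Rightarrow> 'n torus \<Rightarrow> real) \<Rightarrow> 'n ptorus \<Rightarrow> 'n ptorus \<Rightarrow> real \<Rightarrow> real" where
  "flat_increment g m1 m2 t =
    (LINT x|meas m2. g (convex_comb t m1 m2) x) - (LINT x|meas m1. g (convex_comb t m1 m2) x)"

text \<open>The increment is continuous in \<open>t\<close>, hence integrable, and its mean is as close to \<open>c\<close> as
  its values are.\<close>

lemma flat_deriv_difference_bound:
  assumes g: "is_flat_deriv \<Phi> g"
    and le: "\<And>t. t \<in> {0..1} \<Longrightarrow> \<bar>flat_increment g m1 m2 t - c\<bar> \<le> \<epsilon>"
  shows "\<bar>\<Phi> m2 - \<Phi> m1 - c\<bar> \<le> \<epsilon>"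
proof -
  let ?k = "flat_increment g m1 m2"
  have gc: "continuous_on UNIV (\<lambda>(m, x). g m x)" using g by (simp add: is_flat_deriv_def)
  have "continuous_on UNIV (\<lambda>n. LINT x|meas m. g n x)" for m
    by (rule continuous_integral_param [OF gc continuous_on_const])
  from continuous_on_compose2 [OF this continuous_convex_comb]
  have kc: "continuous_on {0..1} ?k"
    unfolding flat_increment_def [abs_def] by (intro continuous_on_diff) auto
  have "\<Phi> m2 - \<Phi> m1 = (LINT t:{0..1}|lborel. ?k t)"
    using g unfolding is_flat_deriv_def flat_increment_def by blast
  also have "\<dots> = integral {0..1} ?k"
    by (intro set_borel_integral_eq_integral borel_integrable_atLeastAtMost' kc)
  finally have eq: "\<Phi> m2 - \<Phi> m1 = integral {0..1} ?k" .
  have "((\<lambda>t. ?k t - c) has_integral integral {0..1} ?k - c) {0..1}"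
    using has_integral_diff [OF integrable_integral [OF integrable_continuous_interval [OF kc]] has_integral_const_real [of c 0 1]]
    by simp
  moreover have "0 \<le> \<epsilon>" using le [of 0] by (rule order_trans [OF abs_ge_zero]) simp
  ultimately have "norm (integral {0..1} ?k - c) \<le> \<epsilon> * measure lborel (cbox 0 (1 :: real))"
    by (intro has_integral_bound [of \<epsilon> "\<lambda>t. ?k t - c"]) (use le in auto)
  then show ?thesis unfolding eq by simp
qed

text \<open>If \<open>M n\<close> tends to \<open>L\<close>, so do all convex combinations of \<open>L\<close> and \<open>M n\<close>, uniformly in the weight; thus the
  increments tend to 0 uniformly.\<close>

lemma flat_deriv_continuous:
  assumes g: "is_flat_deriv \<Phi> g"
  shows "continuous_on UNIV \<Phi>"
proof (rule continuous_on_ptorus_sequentiallyI)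
  fix M :: "nat \<Rightarrow> 'a ptorus" and L assume M: "M \<longlonglongrightarrow> L"
  have gc: "continuous_on UNIV (\<lambda>(m, x). g m x)" using g by (simp add: is_flat_deriv_def)
  have "continuous_on UNIV (\<lambda>q :: ('a ptorus \<times> 'a ptorus) \<times> 'a torus. (fst (fst q), snd q))"
    by (intro continuous_intros)
  from continuous_on_compose2 [OF gc this]
  have "continuous_on UNIV (\<lambda>(p :: 'a ptorus \<times> 'a ptorus, x). g (fst p) x)"
    by (simp add: case_prod_beta')
  then have J0: "continuous_on UNIV (\<lambda>p :: 'a ptorus \<times> 'a ptorus. LINT x|meas (snd p). g (fst p) x)"
    by (rule continuous_integral_param) (intro continuous_intros)
  define J where "J n m = (LINT x|meas m. g n x)" for n m
  have J: "continuous_on UNIV (\<lambda>(n, m). J n m)" using J0 by (simp add: J_def case_prod_beta')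
  show "(\<lambda>n. \<Phi> (M n)) \<longlonglongrightarrow> \<Phi> L"
  proof (rule LIMSEQ_I)
    fix r :: real assume r: "r > 0"
    have "eventually (\<lambda>n. \<forall>t\<in>{0..1}. \<bar>flat_increment g L (M n) t - 0\<bar> \<le> r / 2) sequentially"
    proof (rule eventually_all_choice)
      fix \<tau> :: "nat \<Rightarrow> real" assume \<tau>: "\<And>n. \<tau> n \<in> {0..1}"
      note cc = convex_comb_tendsto [OF M \<tau>]
      have "(\<lambda>n. J (convex_comb (\<tau> n) L (M n)) (M n)) \<longlonglongrightarrow> J L L"
        using continuous_on_tendsto_compose [OF J tendsto_Pair [OF cc M]] by simp
      moreover have "(\<lambda>n. J (convex_comb (\<tau> n) L (M n)) L) \<longlonglongrightarrow> J L L"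
        using continuous_on_tendsto_compose [OF J tendsto_Pair [OF cc tendsto_const [of L]]] by simp
      ultimately have "(\<lambda>n. flat_increment g L (M n) (\<tau> n)) \<longlonglongrightarrow> J L L - J L L"
        unfolding flat_increment_def J_def by (rule tendsto_diff)
      then have "eventually (\<lambda>n. dist (flat_increment g L (M n) (\<tau> n)) (J L L - J L L) < r / 2) sequentially"
        by (rule tendstoD) (use r in simp)
      then show "eventually (\<lambda>n. \<bar>flat_increment g L (M n) (\<tau> n) - 0\<bar> \<le> r / 2) sequentially"
        by eventually_elim (simp add: dist_real_def)
    qed simp
    then have "eventually (\<lambda>n. norm (\<Phi> (M n) - \<Phi> L) < r) sequentially"
    proof eventually_elim
      case (elim n)
      have "\<bar>\<Phi> (M n) - \<Phi> L - 0\<bar> \<le> r / 2"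
        by (rule flat_deriv_difference_bound [OF g]) (use elim in blast)
      then show ?case using r by simp
    qed
    then show "\<exists>no. \<forall>n\<ge>no. norm (\<Phi> (M n) - \<Phi> L) < r"
      unfolding eventually_sequentially .
  qed
qed

lemma flat_deriv_bounded:
  assumes g: "is_flat_deriv \<Phi> g"
  obtains B where "B \<ge> 0" "\<And>m. \<bar>\<Phi> m\<bar> \<le> B"
proof -
  have c: "continuous_on UNIV (\<lambda>(m, x :: 'a torus). \<Phi> m)"
    using continuous_on_compose2 [OF flat_deriv_continuous [OF g] continuous_on_fst [OF continuous_on_id]]
    by (simp add: case_prod_beta')
  show thesis
  proof (rule ptorus_bounded [OF c])
    fix B assume B: "B \<ge> 0" "\<And>m (x :: 'a torus). \<bar>\<Phi> m\<bar> \<le> B"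
    show thesis by (rule that [of B]) (use B in auto)
  qed
qed

text \<open>The derivative of \<open>\<Phi>\<close> is taken at \<open>n\<close> but integrated against \<open>fst z\<close>: difference quotients of \<open>\<Phi>\<close> along
  a trajectory involve flat derivatives at convex combinations of two of its points.\<close>

definition generator ::
    "('n::finite ptorus \<Rightarrow> real) \<Rightarrow> 'n ptorus \<Rightarrow> 'n ptorus \<times> ('n torus \<Rightarrow>\<^sub>C (real ^ 'n)) \<Rightarrow> real" where
  "generator \<Phi> n z = drift_pairing (tdiv (Dm \<Phi> n)) (Dm \<Phi> n) (fst z) (snd z)"

context
  fixes \<Phi> :: "'n::finite ptorus \<Rightarrow> real"
  assumes \<Phi>: "C11 \<Phi>"
begin

lemma C11_is_flat_deriv: "is_flat_deriv \<Phi> (flat_deriv \<Phi>)"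
proof -
  obtain g where "is_flat_deriv \<Phi> g" using \<Phi> unfolding C11_def C1_def by blast
  then show ?thesis unfolding flat_deriv_def by (rule someI [of "is_flat_deriv \<Phi>" g])
qed

lemma C11_Ck_space: "Ck_space k (flat_deriv \<Phi>)"
proof (cases k)
  case 0
  then show ?thesis using C11_is_flat_deriv by (simp add: is_flat_deriv_def)
next
  case (Suc j)
  then show ?thesis using \<Phi> unfolding C11_def Dm_def by simp
qed

lemma C11_smooth_lift: "Ck k (\<lambda>z. flat_deriv \<Phi> m (to_torus z))"
  by (rule Ck_space_imp_Ck [OF C11_Ck_space])

lemma tgrad_flat_deriv: "tgrad (flat_deriv \<Phi> m) = Dm \<Phi> m"
  by (simp add: Dm_def fun_eq_iff)

lemma tlap_flat_deriv: "tlap (flat_deriv \<Phi> m) = tdiv (Dm \<Phi> m)"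
  unfolding tlap_def tgrad_flat_deriv ..

lemma C11_Dm_Ck_space: "Ck_space k (\<lambda>m x. Dm \<Phi> m x $ i)"
  using \<Phi> by (simp add: C11_def)

lemma continuous_Dm: "continuous_on UNIV (\<lambda>(m, x). Dm \<Phi> m x)"
proof -
  have "continuous_on UNIV (\<lambda>p. Dm \<Phi> (fst p) (snd p) $ i)" for i
    using C11_Dm_Ck_space [of 0 i] by (simp add: case_prod_beta')
  then have "continuous_on UNIV (\<lambda>p. \<chi> i. Dm \<Phi> (fst p) (snd p) $ i)" by (rule continuous_on_vec_lambda)
  then show ?thesis by (simp add: case_prod_beta')
qed

lemma continuous_div_Dm: "continuous_on UNIV (\<lambda>(m, x). tdiv (Dm \<Phi> m) x)"
proof -
  have "continuous_on UNIV (\<lambda>p. tgrad (\<lambda>y. Dm \<Phi> (fst p) y $ i) (snd p) $ i)" for i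
    using C11_Dm_Ck_space [of "Suc 0" i] by (simp add: case_prod_beta')
  then show ?thesis unfolding tdiv_def case_prod_beta' by (intro continuous_on_sum)
qed

text \<open>Compactness of the space of measures and of the torus makes both continuous functions bounded.\<close>

lemma C11_drift_bound: "\<exists>K. \<forall>m y v. norm v \<le> A \<longrightarrow> \<bar>tdiv (Dm \<Phi> m) y - Dm \<Phi> m y \<bullet> v\<bar> \<le> K"
proof -
  have c: "continuous_on UNIV (\<lambda>(m, y). norm (Dm \<Phi> m y))"
    using continuous_on_norm [OF continuous_Dm] by (simp add: case_prod_beta')
  obtain B where B: "B \<ge> 0" "\<And>m y. \<bar>norm (Dm \<Phi> m y)\<bar> \<le> B"
    by (rule ptorus_bounded [OF c]) (rule that)
  obtain B' where B': "B' \<ge> 0" "\<And>m y. \<bar>tdiv (Dm \<Phi> m) y\<bar> \<le> B'"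
    by (rule ptorus_bounded [OF continuous_div_Dm]) (rule that)
  have "\<bar>tdiv (Dm \<Phi> m) y - Dm \<Phi> m y \<bullet> v\<bar> \<le> B' + B * A" if "norm v \<le> A" for m y v
  proof -
    have "\<bar>Dm \<Phi> m y \<bullet> v\<bar> \<le> norm (Dm \<Phi> m y) * norm v" by (rule Cauchy_Schwarz_ineq2)
    also have "\<dots> \<le> B * A" using that B(2) [of m y] B(1) by (intro mult_mono) auto
    finally show ?thesis using B'(2) [of m y] by linarith
  qed
  then show ?thesis by blast
qed

lemma continuous_generator: "continuous_on UNIV (\<lambda>(n, z). generator \<Phi> n z)"
  using continuous_drift_pairing [OF continuous_div_Dm continuous_Dm]
  by (simp add: generator_def case_prod_beta')

end

lemma mvt_between:
  fixes f :: "real \<Rightarrow> real"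
  assumes "0 < s" "0 < t" and f: "\<And>x. 0 < x \<Longrightarrow> (f has_real_derivative f' x) (at x)"
  shows "\<exists>\<xi>>0. \<bar>\<xi> - t\<bar> \<le> \<bar>s - t\<bar> \<and> f s - f t = (s - t) * f' \<xi>"
proof (cases s t rule: linorder_cases)
  case less
  have "\<exists>z>s. z < t \<and> f t - f s = (t - s) * f' z"
    by (rule MVT2 [OF less]) (rule f, use \<open>0 < s\<close> in linarith)
  then obtain \<xi> where \<xi>: "s < \<xi>" "\<xi> < t" "f t - f s = (t - s) * f' \<xi>" by blast
  then have "f s - f t = (s - t) * f' \<xi>" by (simp add: left_diff_distrib)
  then show ?thesis using \<xi> \<open>0 < s\<close> by (intro exI [of _ \<xi>]) simp
next
  case greater
  have "\<exists>z>t. z < s \<and> f s - f t = (s - t) * f' z"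
    by (rule MVT2 [OF greater]) (rule f, use \<open>0 < t\<close> in linarith)
  then obtain \<xi> where "t < \<xi>" "\<xi> < s" "f s - f t = (s - t) * f' \<xi>" by blast
  then show ?thesis using \<open>0 < t\<close> by (intro exI [of _ \<xi>]) simp
qed (use assms in \<open>intro exI [of _ t], simp\<close>)

text \<open>For a weight \<open>\<tau>\<close> let \<open>\<psi>\<close> be the flat derivative of \<open>\<Phi>\<close> at the convex combination of \<open>m t\<close> and \<open>m s\<close>. By the mean
  value theorem for \<open>\<integral>\<psi> dm\<close> the increment is \<open>s - t\<close> times the generator evaluated at this
  combination and at some \<open>m \<xi>\<close>, \<open>a \<xi>\<close> with \<open>\<xi>\<close> between \<open>s\<close> and \<open>t\<close>. As \<open>s\<close> tends to \<open>t\<close> these measures all tend to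
  \<open>m t\<close>, uniformly in \<open>\<tau>\<close>, and the generator is jointly continuous.\<close>

lemma chain_rule:
  assumes \<Phi>: "C11 \<Phi>"
    and FP: "fokker_planck m (\<lambda>t. apply_bcontfun (a t))"
    and m: "continuous_on {0..} m" and a: "continuous_on {0..} a" and "t > 0"
  shows "((\<lambda>t. \<Phi> (m t)) has_real_derivative generator \<Phi> (m t) (m t, a t)) (at t)"
proof -
  define D where "D = generator \<Phi> (m t) (m t, a t)"
  have "at t within {0<..} = at t" by (rule at_within_open) (use \<open>t > 0\<close> in auto)
  moreover have "((\<lambda>s. (\<Phi> (m s) - \<Phi> (m t)) / (s - t)) \<longlongrightarrow> D) (at t within {0<..})"
    unfolding tendsto_at_iff_sequentially
  proof safe
    fix s :: "nat \<Rightarrow> real" assume s: "\<forall>n. s n \<in> {0<..} - {t}" and st: "s \<longlonglongrightarrow> t"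
    have mt: "(\<lambda>n. m (\<xi> n)) \<longlonglongrightarrow> m t" and at: "(\<lambda>n. a (\<xi> n)) \<longlonglongrightarrow> a t"
      if "\<And>n. \<xi> n > 0" "\<xi> \<longlonglongrightarrow> t" for \<xi> :: "nat \<Rightarrow> real"
      using continuous_on_tendsto_compose [OF m that(2)] continuous_on_tendsto_compose [OF a that(2)]
        that(1) \<open>t > 0\<close> by (auto simp: less_imp_le)
    have ms: "(\<lambda>n. m (s n)) \<longlonglongrightarrow> m t" using s st by (intro mt) auto
    show "((\<lambda>s. (\<Phi> (m s) - \<Phi> (m t)) / (s - t)) \<circ> s) \<longlonglongrightarrow> D"
    proof (rule tendstoI)
      fix r :: real assume r: "r > 0"
      have "eventually (\<lambda>n. \<forall>\<tau>\<in>{0..1}. \<bar>flat_increment (flat_deriv \<Phi>) (m t) (m (s n)) \<tau> - (s n - t) * D\<bar> \<le> \<bar>s n - t\<bar> * (r / 2)) sequentially"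
      proof (rule eventually_all_choice)
        fix \<tau> :: "nat \<Rightarrow> real" assume \<tau>: "\<And>n. \<tau> n \<in> {0..1}"
        define c where "c n = convex_comb (\<tau> n) (m t) (m (s n))" for n
        have cc: "c \<longlonglongrightarrow> m t" unfolding c_def by (rule convex_comb_tendsto [OF ms \<tau>])
        have "\<exists>\<xi>>0. \<bar>\<xi> - t\<bar> \<le> \<bar>s n - t\<bar> \<and>
          (LINT x|meas (m (s n)). flat_deriv \<Phi> (c n) x) - (LINT x|meas (m t). flat_deriv \<Phi> (c n) x)
            = (s n - t) * generator \<Phi> (c n) (m \<xi>, a \<xi>)" for n
        proof (rule mvt_between)
          show "0 < s n" using s by simp
          show "((\<lambda>s. LINT x|meas (m s). flat_deriv \<Phi> (c n) x) has_real_derivative generator \<Phi> (c n) (m \<xi>, a \<xi>)) (at \<xi>)"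
            if "0 < \<xi>" for \<xi>
            using fokker_planck_derivative [OF C11_smooth_lift [OF \<Phi>] FP m a that, of "c n"]
            unfolding tlap_flat_deriv [OF \<Phi>] tgrad_flat_deriv [OF \<Phi>] by (simp add: generator_def)
        qed (rule \<open>t > 0\<close>)
        then obtain \<xi> where \<xi>: "\<And>n. \<xi> n > 0" "\<And>n. \<bar>\<xi> n - t\<bar> \<le> \<bar>s n - t\<bar>"
          and eq: "\<And>n. (LINT x|meas (m (s n)). flat_deriv \<Phi> (c n) x) - (LINT x|meas (m t). flat_deriv \<Phi> (c n) x)
            = (s n - t) * generator \<Phi> (c n) (m (\<xi> n), a (\<xi> n))" by metis
        have st0: "(\<lambda>n. \<bar>s n - t\<bar>) \<longlonglongrightarrow> 0"
          using st by (intro tendsto_rabs_zero) (simp add: LIM_zero_iff)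
        have "(\<lambda>n. \<xi> n - t) \<longlonglongrightarrow> 0"
          by (rule Lim_null_comparison [OF always_eventually st0]) (simp add: \<xi>(2))
        then have \<xi>t: "\<xi> \<longlonglongrightarrow> t" by (simp add: LIM_zero_iff)
        have "(\<lambda>n. generator \<Phi> (c n) (m (\<xi> n), a (\<xi> n))) \<longlonglongrightarrow> D"
          unfolding D_def
          using continuous_on_tendsto_compose [OF continuous_generator [OF \<Phi>]
              tendsto_Pair [OF cc tendsto_Pair [OF mt [OF \<xi>(1) \<xi>t] at [OF \<xi>(1) \<xi>t]]]] by simp
        then have "eventually (\<lambda>n. dist (generator \<Phi> (c n) (m (\<xi> n), a (\<xi> n))) D < r / 2) sequentially"
          using r by (intro tendstoD) auto
        then show "eventually (\<lambda>n. \<bar>flat_increment (flat_deriv \<Phi>) (m t) (m (s n)) (\<tau> n) - (s n - t) * D\<bar> \<le> \<bar>s n - t\<bar> * (r / 2)) sequentially"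
        proof eventually_elim
          case (elim n)
          have "\<bar>(s n - t) * generator \<Phi> (c n) (m (\<xi> n), a (\<xi> n)) - (s n - t) * D\<bar>
              = \<bar>s n - t\<bar> * \<bar>generator \<Phi> (c n) (m (\<xi> n), a (\<xi> n)) - D\<bar>"
            by (simp add: right_diff_distrib [symmetric] abs_mult)
          also have "\<dots> \<le> \<bar>s n - t\<bar> * (r / 2)"
            using elim by (intro mult_left_mono) (auto simp: dist_real_def)
          finally show ?case unfolding flat_increment_def c_def [symmetric] eq .
        qed
      qed simp
      then show "eventually (\<lambda>n. dist (((\<lambda>s. (\<Phi> (m s) - \<Phi> (m t)) / (s - t)) \<circ> s) n) D < r) sequentially"
      proof eventually_elim
        case (elim n)
        have nz: "s n - t \<noteq> 0" using s by auto
        have "\<bar>\<Phi> (m (s n)) - \<Phi> (m t) - (s n - t) * D\<bar> \<le> \<bar>s n - t\<bar> * (r / 2)"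
          by (rule flat_deriv_difference_bound [OF C11_is_flat_deriv [OF \<Phi>]]) (use elim in blast)
        moreover have "\<Phi> (m (s n)) - \<Phi> (m t) - (s n - t) * D = (s n - t) * ((\<Phi> (m (s n)) - \<Phi> (m t)) / (s n - t) - D)"
          using nz by (simp add: field_simps)
        ultimately have "\<bar>s n - t\<bar> * \<bar>(\<Phi> (m (s n)) - \<Phi> (m t)) / (s n - t) - D\<bar> \<le> \<bar>s n - t\<bar> * (r / 2)"
          by (simp add: abs_mult)
        then have "\<bar>(\<Phi> (m (s n)) - \<Phi> (m t)) / (s n - t) - D\<bar> \<le> r / 2" using nz by simp
        then show ?case using r by (simp add: dist_real_def)
      qed
    qed
  qed
  ultimately show ?thesis by (simp add: has_field_derivative_iff D_def)
qed

section \<open>Discounted time averages\<close>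

lemma discount_density_integrable:
  fixes \<delta> :: real
  assumes "\<delta> > 0"
  shows "set_integrable lborel {0..} (\<lambda>s. \<delta> * exp (- \<delta> * s))"
proof -
  interpret E: prob_space "density lborel (exponential_density \<delta>)"
    using assms by (rule prob_space_exponential_density)
  have eq: "(\<lambda>s. indicator {0..} s *\<^sub>R (\<delta> * exp (- \<delta> * s))) = exponential_density \<delta>"
    by (auto simp: exponential_density_def indicator_def mult.commute)
  have nn: "(\<integral>\<^sup>+s. ennreal (exponential_density \<delta> s) \<partial>lborel) = ennreal 1"
    using E.emeasure_space_1 by (simp add: emeasure_density)
  have pos: "AE s in lborel. 0 \<le> exponential_density \<delta> s"
    using assms by (simp add: exponential_density_nonneg)
  show "set_integrable lborel {0..} (\<lambda>s. \<delta> * exp (- \<delta> * s))"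
    unfolding set_integrable_def eq by (rule integrableI_nn_integral_finite [OF _ pos nn]) simp
qed

lemma discount_integrable:
  fixes f :: "real \<Rightarrow> real"
  assumes "\<delta> > 0" and f: "continuous_on {0..} f" and B: "\<And>s. s \<ge> 0 \<Longrightarrow> \<bar>f s\<bar> \<le> B"
  shows "set_integrable lborel {0..} (\<lambda>s. \<delta> * exp (- \<delta> * s) * f s)"
proof -
  have "set_integrable lborel {0..} (\<lambda>s. B * (\<delta> * exp (- \<delta> * s)))"
    using discount_density_integrable [OF \<open>\<delta> > 0\<close>] by (rule set_integrable_mult_right)
  then show ?thesis
    unfolding set_integrable_def
  proof (rule Bochner_Integration.integrable_bound)
    have fc: "continuous_on {0..} (\<lambda>s. \<delta> * exp (- \<delta> * s) * f s)" by (intro continuous_intros f)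
    show "(\<lambda>s. indicator {0..} s *\<^sub>R (\<delta> * exp (- \<delta> * s) * f s)) \<in> borel_measurable lborel"
      using borel_measurable_continuous_on_indicator [of "{0 :: real..}", OF _ fc] by simp
    have "norm (\<delta> * exp (- \<delta> * s) * f s) \<le> B * (\<delta> * exp (- \<delta> * s))" if "s \<ge> 0" for s
    proof -
      have "\<bar>f s\<bar> * (\<delta> * exp (- \<delta> * s)) \<le> B * (\<delta> * exp (- \<delta> * s))"
        using B [OF that] \<open>\<delta> > 0\<close> by (intro mult_right_mono) auto
      then show ?thesis using \<open>\<delta> > 0\<close> by (simp add: abs_mult mult_ac)
    qed
    then show "AE s in lborel. norm (indicator {0..} s *\<^sub>R (\<delta> * exp (- \<delta> * s) * f s))
        \<le> norm (indicator {0..} s *\<^sub>R (B * (\<delta> * exp (- \<delta> * s))))"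
      by (intro AE_I2) (auto simp: indicator_def intro: order_trans [OF _ abs_ge_self])
  qed
qed

text \<open>Integration by parts on \<open>[0, T]\<close> leaves the boundary terms, at most \<open>\<delta> (exp (- \<delta> T) B + B)\<close>, and a term where
  the weight is differentiated, at most \<open>\<delta> B (1 - exp (- \<delta> T))\<close>. They add up to \<open>2 \<delta> B\<close> for every \<open>T\<close>.\<close>

lemma discounted_derivative_bound:
  fixes f G :: "real \<Rightarrow> real"
  assumes "\<delta> > 0" and f: "continuous_on {0..} f" and B: "\<And>s. s \<ge> 0 \<Longrightarrow> \<bar>f s\<bar> \<le> B"
    and G: "continuous_on {0..} G" "\<And>s. s \<ge> 0 \<Longrightarrow> \<bar>G s\<bar> \<le> B'"
    and d: "\<And>s. s > 0 \<Longrightarrow> (f has_real_derivative G s) (at s)"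
  shows "\<bar>LINT s:{0..}|lborel. \<delta> * exp (- \<delta> * s) * G s\<bar> \<le> 2 * \<delta> * B"
proof -
  have B0: "B \<ge> 0" using B [of 0] by linarith
  have le: "\<bar>LINT s:{0..real n}|lborel. \<delta> * exp (- \<delta> * s) * G s\<bar> \<le> 2 * \<delta> * B" for n
  proof -
    define T where "T = real n"
    have T: "T \<ge> 0" by (simp add: T_def)
    have sub: "{0..T} \<subseteq> {0..}" by auto
    note fT = continuous_on_subset [OF f sub] and GT = continuous_on_subset [OF G(1) sub]
    have "((\<lambda>s. \<delta> * exp (- \<delta> * s) * (G s - \<delta> * f s)) has_integral (\<delta> * exp (- \<delta> * T) * f T - \<delta> * exp (- \<delta> * 0) * f 0)) {0..T}"
    proof (rule fundamental_theorem_of_calculus_interior [OF T])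
      show "continuous_on {0..T} (\<lambda>s. \<delta> * exp (- \<delta> * s) * f s)" by (intro continuous_intros fT)
      fix s assume "s \<in> {0<..<T}"
      then have "(f has_real_derivative G s) (at s)" using d by simp
      then have "((\<lambda>s. \<delta> * exp (- \<delta> * s) * f s) has_real_derivative \<delta> * exp (- \<delta> * s) * (G s - \<delta> * f s)) (at s)"
        by (auto intro!: derivative_eq_intros simp: algebra_simps)
      then show "((\<lambda>s. \<delta> * exp (- \<delta> * s) * f s) has_vector_derivative \<delta> * exp (- \<delta> * s) * (G s - \<delta> * f s)) (at s)"
        by (simp add: has_real_derivative_iff_has_vector_derivative)
    qed
    then have 1: "((\<lambda>s. \<delta> * exp (- \<delta> * s) * (G s - \<delta> * f s)) has_integral \<delta> * (exp (- \<delta> * T) * f T - f 0)) {0..T}"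
      by (simp add: algebra_simps)
    have if': "(\<lambda>s. \<delta> * exp (- \<delta> * s) * (\<delta> * f s)) integrable_on {0..T}"
      by (intro integrable_continuous_interval continuous_intros fT)
    have 2: "integral {0..T} (\<lambda>s. \<delta> * exp (- \<delta> * s) * G s)
      = \<delta> * (exp (- \<delta> * T) * f T - f 0) + integral {0..T} (\<lambda>s. \<delta> * exp (- \<delta> * s) * (\<delta> * f s))"
      using has_integral_add [OF 1 integrable_integral [OF if']]
      by (intro integral_unique) (simp add: algebra_simps)
    have e: "((\<lambda>s. \<delta> * exp (- \<delta> * s) * (\<delta> * B)) has_integral \<delta> * B * (1 - exp (- \<delta> * T))) {0..T}"
    proof -
      have "((\<lambda>s. \<delta> * exp (- \<delta> * s) * (\<delta> * B)) has_integral (- (exp (- \<delta> * T) * (\<delta> * B)) - - (exp (- \<delta> * 0) * (\<delta> * B)))) {0..T}"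
      proof (rule fundamental_theorem_of_calculus [OF T])
        fix s
        show "((\<lambda>s. - (exp (- \<delta> * s) * (\<delta> * B))) has_vector_derivative \<delta> * exp (- \<delta> * s) * (\<delta> * B)) (at s within {0..T})"
          unfolding has_real_derivative_iff_has_vector_derivative [symmetric]
          by (auto intro!: derivative_eq_intros)
      qed
      then show ?thesis by (simp add: algebra_simps)
    qed
    have "norm (integral {0..T} (\<lambda>s. \<delta> * exp (- \<delta> * s) * (\<delta> * f s))) \<le> integral {0..T} (\<lambda>s. \<delta> * exp (- \<delta> * s) * (\<delta> * B))"
    proof (rule integral_norm_bound_integral [OF if'])
      show "(\<lambda>s. \<delta> * exp (- \<delta> * s) * (\<delta> * B)) integrable_on {0..T}" using e by blast
      show "norm (\<delta> * exp (- \<delta> * s) * (\<delta> * f s)) \<le> \<delta> * exp (- \<delta> * s) * (\<delta> * B)" if "s \<in> {0..T}" for s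
        using B [of s] that \<open>\<delta> > 0\<close> by (simp add: abs_mult)
    qed
    then have 3: "\<bar>integral {0..T} (\<lambda>s. \<delta> * exp (- \<delta> * s) * (\<delta> * f s))\<bar> \<le> \<delta> * B * (1 - exp (- \<delta> * T))"
      unfolding integral_unique [OF e] real_norm_def .
    have "\<bar>exp (- \<delta> * T) * f T - f 0\<bar> \<le> exp (- \<delta> * T) * B + B"
    proof -
      have "\<bar>exp (- \<delta> * T) * f T\<bar> \<le> exp (- \<delta> * T) * B" using B [OF T] by (simp add: abs_mult)
      then show ?thesis using B [of 0] by linarith
    qed
    then have "\<bar>\<delta> * (exp (- \<delta> * T) * f T - f 0)\<bar> \<le> \<delta> * (exp (- \<delta> * T) * B + B)"
      using \<open>\<delta> > 0\<close> by (simp add: abs_mult)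
    then have "\<bar>integral {0..T} (\<lambda>s. \<delta> * exp (- \<delta> * s) * G s)\<bar> \<le> \<delta> * (exp (- \<delta> * T) * B + B) + \<delta> * B * (1 - exp (- \<delta> * T))"
      unfolding 2 using 3 by linarith
    also have "\<dots> = 2 * \<delta> * B" by (simp add: algebra_simps)
    finally have "\<bar>integral {0..T} (\<lambda>s. \<delta> * exp (- \<delta> * s) * G s)\<bar> \<le> 2 * \<delta> * B" .
    moreover have "(LINT s:{0..T}|lborel. \<delta> * exp (- \<delta> * s) * G s) = integral {0..T} (\<lambda>s. \<delta> * exp (- \<delta> * s) * G s)"
      by (intro set_borel_integral_eq_integral borel_integrable_atLeastAtMost' continuous_intros GT)
    ultimately show ?thesis by (simp only: T_def)
  qed
  have "(\<lambda>n. LINT s:{0..real n}|lborel. \<delta> * exp (- \<delta> * s) * G s) \<longlonglongrightarrow> (LINT s:{0..}|lborel. \<delta> * exp (- \<delta> * s) * G s)"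
    unfolding set_lebesgue_integral_def
  proof (rule integral_dominated_convergence)
    have int: "integrable lborel (\<lambda>s. indicator {0..} s *\<^sub>R (\<delta> * exp (- \<delta> * s) * G s))"
      using discount_integrable [OF \<open>\<delta> > 0\<close> G] by (simp add: set_integrable_def)
    then show "integrable lborel (\<lambda>s. norm (indicator {0..} s *\<^sub>R (\<delta> * exp (- \<delta> * s) * G s)))"
      by (rule integrable_norm)
    show "(\<lambda>s. indicator {0..} s *\<^sub>R (\<delta> * exp (- \<delta> * s) * G s)) \<in> borel_measurable lborel"
      using int by (rule borel_measurable_integrable)
    show "(\<lambda>s. indicator {0..real n} s *\<^sub>R (\<delta> * exp (- \<delta> * s) * G s)) \<in> borel_measurable lborel" for n
    proof -
      have c: "continuous_on {0..real n} (\<lambda>s. \<delta> * exp (- \<delta> * s) * G s)"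
        by (intro continuous_intros continuous_on_subset [OF G(1)]) auto
      then show ?thesis using borel_measurable_continuous_on_indicator [OF _ c] by simp
    qed
    show "AE s in lborel. norm (indicator {0..real n} s *\<^sub>R (\<delta> * exp (- \<delta> * s) * G s))
        \<le> norm (indicator {0..} s *\<^sub>R (\<delta> * exp (- \<delta> * s) * G s))" for n
      by (intro AE_I2) (simp add: indicator_def)
    show "AE s in lborel. (\<lambda>n. indicator {0..real n} s *\<^sub>R (\<delta> * exp (- \<delta> * s) * G s))
        \<longlonglongrightarrow> indicator {0..} s *\<^sub>R (\<delta> * exp (- \<delta> * s) * G s)"
    proof (intro AE_I2 tendsto_eventually)
      fix s :: real
      obtain N :: nat where "s \<le> real N" using real_arch_simple by blast
      then have "indicator {0..real n} s = (indicator {0..} s :: real)" if "n \<ge> N" for n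
        using that by (auto simp: indicator_def)
      then show "eventually (\<lambda>n. indicator {0..real n} s *\<^sub>R (\<delta> * exp (- \<delta> * s) * G s)
          = indicator {0..} s *\<^sub>R (\<delta> * exp (- \<delta> * s) * G s)) sequentially"
        unfolding eventually_sequentially by (intro exI [of _ N]) simp
    qed
  qed
  from tendsto_rabs [OF this] show ?thesis
    by (rule tendsto_upperbound) (use le in auto)
qed

text \<open>The path is continuous into the product space, hence measurable for its Borel sets, so the occupation
  measure is its image of the exponential distribution.\<close>

lemma integral_occupation:
  fixes f :: "'n::finite ptorus \<times> ('n torus \<Rightarrow>\<^sub>C (real ^ 'n)) \<Rightarrow> real"
  assumes "\<delta> > 0" and m: "continuous_on {0..} m" and a: "continuous_on {0..} a"
    and E: "\<And>t. t \<ge> 0 \<Longrightarrow> a t \<in> feedbacks C" and f: "continuous_on UNIV f"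
  shows "(LINT z|occupation C \<delta> m a. f z) = (LINT s:{0..}|lborel. \<delta> * exp (- \<delta> * s) * f (m s, a s))"
proof -
  let ?D = "density (restrict_space lborel {0..}) (\<lambda>s. ennreal (\<delta> * exp (- \<delta> * s)))"
  have sets: "sets (restrict_space lborel {0 :: real..}) = sets (restrict_space borel {0..})"
    by (simp add: sets_restrict_space)
  have c: "continuous_on {0..} (\<lambda>s. (m s, a s))" using m a by (rule continuous_on_Pair)
  have "(\<lambda>s. (m s, a s)) \<in> restrict_space borel {0..} \<rightarrow>\<^sub>M PE_borel C"
    unfolding PE_borel_def
    by (rule measurable_restrict_space2 [OF _ borel_measurable_continuous_on_restrict [OF c]])
      (auto simp: space_restrict_space E)
  then have ma: "(\<lambda>s. (m s, a s)) \<in> ?D \<rightarrow>\<^sub>M PE_borel C"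
    using sets by (simp cong: measurable_cong_sets)
  have fm: "f \<in> borel_measurable (PE_borel C)"
    unfolding PE_borel_def
    by (rule borel_measurable_continuous_on_restrict [OF continuous_on_subset [OF f]]) simp
  have "continuous_on {0..} (\<lambda>s. f (m s, a s))" using continuous_on_compose2 [OF f c] by simp
  then have fma: "(\<lambda>s. f (m s, a s)) \<in> borel_measurable (restrict_space lborel {0..})"
    unfolding measurable_cong_sets [OF sets refl] by (rule borel_measurable_continuous_on_restrict)
  have em: "(\<lambda>s. \<delta> * exp (- \<delta> * s)) \<in> borel_measurable (restrict_space lborel {0..})"
    unfolding measurable_cong_sets [OF sets refl]
    by (rule borel_measurable_continuous_on_restrict) (intro continuous_intros)
  have "(LINT z|occupation C \<delta> m a. f z) = (LINT s|?D. f (m s, a s))"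
    unfolding occupation_def by (rule integral_distr [OF ma fm])
  also have "\<dots> = (LINT s|restrict_space lborel {0..}. (\<delta> * exp (- \<delta> * s)) *\<^sub>R f (m s, a s))"
    using \<open>\<delta> > 0\<close> by (intro integral_density fma em) auto
  also have "\<dots> = (LINT s:{0..}|lborel. \<delta> * exp (- \<delta> * s) * f (m s, a s))"
    unfolding set_lebesgue_integral_def by (subst integral_restrict_space) (simp_all)
  finally show ?thesis .
qed

lemma continuous_feedback_path:
  fixes a :: "real \<Rightarrow> ('n::finite torus \<Rightarrow>\<^sub>C 'b::metric_space)"
  assumes "continuous_on ({0..} \<times> UNIV) (\<lambda>(t, x). apply_bcontfun (a t) x)"
  shows "continuous_on {0..} a"
proof -
  \<comment> \<open>Freezing the path at negative times makes the integrand continuous on the whole line.\<close>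
  have "continuous_on UNIV (\<lambda>p :: real \<times> 'n torus. (max 0 (fst p), snd p))" by (intro continuous_intros)
  from continuous_on_compose2 [OF assms this]
  have g: "continuous_on UNIV (\<lambda>(t, x). apply_bcontfun (a (max 0 t)) x)" by (simp add: case_prod_beta' image_subset_iff)
  show ?thesis
    unfolding continuous_on_def
  proof safe
    fix t :: real assume t: "t \<ge> 0"
    show "(a \<longlongrightarrow> a t) (at t within {0..})"
    proof (rule tendstoI)
      fix e :: real assume e: "e > 0"
      obtain A where A: "open A" "t \<in> A" and
        close: "\<And>t' y. t' \<in> A \<Longrightarrow> dist (apply_bcontfun (a (max 0 t')) y) (apply_bcontfun (a (max 0 t)) y) < e / 2"
        using tube_uniform [OF g compact_torus, of "e / 2" t] e by auto
      have "eventually (\<lambda>t'. t' \<in> A \<and> t' \<in> {0..}) (at t within {0..})"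
        using A eventually_at_topological by blast
      then show "eventually (\<lambda>t'. dist (a t') (a t) < e) (at t within {0..})"
      proof eventually_elim
        case (elim t')
        have "dist (a t') (a t) \<le> e / 2"
          using close [of t'] elim t by (intro dist_bound less_imp_le) (simp add: max_def split: if_splits)
        then show ?case using e by simp
      qed
    qed
  qed
qed

section \<open>The Legendre transform\<close>

lemma Ck_Suc_grad:
  fixes f :: "real ^ 'n::finite \<Rightarrow> real"
  assumes "Ck (Suc k) f"
  shows "(f has_derivative (\<lambda>h. grad f p \<bullet> h)) (at p)" and "Ck k (\<lambda>p. grad f p $ i)"
proof -
  let ?D = "frechet_derivative f (at p)"
  have d: "(f has_derivative ?D) (at p)" by (rule Ck_SucD(1) [OF assms])
  then have "linear ?D" by (rule has_derivative_linear)
  have "?D h = grad f p \<bullet> h" for h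
  proof -
    have "?D h = ?D (\<Sum>i\<in>UNIV. h $ i *\<^sub>R axis i 1)"
      using basis_expansion [of h] by (simp add: scalar_mult_eq_scaleR)
    also have "\<dots> = (\<Sum>i\<in>UNIV. h $ i * ?D (axis i 1))"
      using \<open>linear ?D\<close> by (simp add: linear_sum linear_cmul o_def)
    also have "\<dots> = grad f p \<bullet> h" by (simp add: grad_def inner_vec_def mult.commute)
    finally show ?thesis .
  qed
  then have "?D = (\<lambda>h. grad f p \<bullet> h)" by blast
  then show "(f has_derivative (\<lambda>h. grad f p \<bullet> h)) (at p)" using d by simp
  show "Ck k (\<lambda>p. grad f p $ i)"
    unfolding grad_def using Ck_SucD(2) [OF assms] by (simp add: axis_in_Basis_iff)
qed

lemma ray_derivatives:
  fixes f :: "real ^ 'n::finite \<Rightarrow> real"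
  assumes "Ck (Suc (Suc 0)) f"
  shows "((\<lambda>s. f (s *\<^sub>R e)) has_real_derivative grad f (s *\<^sub>R e) \<bullet> e) (at s)"
    and "((\<lambda>s. grad f (s *\<^sub>R e) \<bullet> e) has_real_derivative e \<bullet> (hess f (s *\<^sub>R e) *v e)) (at s)"
proof -
  have ray: "((\<lambda>s. h (s *\<^sub>R e)) has_real_derivative grad h (s *\<^sub>R e) \<bullet> e) (at s)"
    if "Ck (Suc 0) h" for h :: "real ^ 'n \<Rightarrow> real" and s
    unfolding has_field_derivative_def
    by (rule has_derivative_eq_rhs,
        rule has_derivative_compose [OF _ Ck_Suc_grad(1) [OF that], of "\<lambda>s. s *\<^sub>R e"])
      (auto intro!: derivative_eq_intros)
  show "((\<lambda>s. f (s *\<^sub>R e)) has_real_derivative grad f (s *\<^sub>R e) \<bullet> e) (at s)"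
    by (rule ray [OF Ck_mono_Suc [OF assms]])
  have "((\<lambda>s. \<Sum>i\<in>UNIV. grad f (s *\<^sub>R e) $ i * e $ i) has_real_derivative
      (\<Sum>i\<in>UNIV. (grad (\<lambda>p. grad f p $ i) (s *\<^sub>R e) \<bullet> e) * e $ i)) (at s)"
    by (intro DERIV_sum DERIV_cmult_right ray Ck_Suc_grad(2) [OF assms])
  moreover have "(\<lambda>s. \<Sum>i\<in>UNIV. grad f (s *\<^sub>R e) $ i * e $ i) = (\<lambda>s. grad f (s *\<^sub>R e) \<bullet> e)"
    by (simp add: inner_vec_def)
  moreover have "(\<Sum>i\<in>UNIV. (grad (\<lambda>p. grad f p $ i) (s *\<^sub>R e) \<bullet> e) * e $ i) = e \<bullet> (hess f (s *\<^sub>R e) *v e)"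
    by (simp add: hess_def matrix_vector_mult_def inner_vec_def mult.commute)
  ultimately show "((\<lambda>s. grad f (s *\<^sub>R e) \<bullet> e) has_real_derivative e \<bullet> (hess f (s *\<^sub>R e) *v e)) (at s)"
    by simp
qed

text \<open>Along the ray through \<open>p\<close> the function minus \<open>c / 2\<close> times the squared distance to 0 is convex. Convexity at
  the parameters 0, 1 and \<open>norm p\<close> bounds its value at \<open>p\<close> by values on the unit ball.\<close>

lemma strongly_convex_growth:
  fixes f :: "real ^ 'n::finite \<Rightarrow> real"
  assumes f: "Ck (Suc (Suc 0)) f" and c: "\<And>p \<xi>. c * (\<xi> \<bullet> \<xi>) \<le> \<xi> \<bullet> (hess f p *v \<xi>)"
    and B: "\<And>p. norm p \<le> 1 \<Longrightarrow> \<bar>f p\<bar> \<le> B" and p: "norm p \<ge> 1"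
  shows "c / 2 * (norm p)\<^sup>2 - (2 * B + c / 2) * norm p \<le> f p"
proof -
  define s where "s = norm p"
  define e where "e = (1 / s) *\<^sub>R p"
  have s: "s \<ge> 1" using p by (simp add: s_def)
  have e: "norm e = 1" using s unfolding e_def by (simp add: s_def [symmetric])
  then have ee: "e \<bullet> e = 1" by (simp add: norm_eq_1)
  have pe: "p = s *\<^sub>R e" using s by (simp add: e_def)
  define k where "k r = f (r *\<^sub>R e) - c / 2 * r\<^sup>2" for r
  have "convex_on UNIV k"
  proof (rule f''_ge0_imp_convex)
    show "(k has_real_derivative grad f (r *\<^sub>R e) \<bullet> e - c * r) (at r)" for r
      unfolding k_def by (rule derivative_eq_intros ray_derivatives(1) [OF f] | simp)+
    show "((\<lambda>r. grad f (r *\<^sub>R e) \<bullet> e - c * r) has_real_derivative e \<bullet> (hess f (r *\<^sub>R e) *v e) - c) (at r)" for r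
      by (rule derivative_eq_intros ray_derivatives(2) [OF f] | simp)+
    show "0 \<le> e \<bullet> (hess f (r *\<^sub>R e) *v e) - c" for r using c [of e "r *\<^sub>R e"] ee by simp
  qed simp
  from convex_onD [OF this, of "1 / s" 0 s] s
  have "k 1 \<le> (1 - 1 / s) * k 0 + (1 / s) * k s" by simp
  then have "s * k 1 \<le> s * ((1 - 1 / s) * k 0 + (1 / s) * k s)" using s by (intro mult_left_mono) auto
  also have "\<dots> = (s - 1) * k 0 + k s" using s by (simp add: field_simps)
  finally have "s * k 1 - (s - 1) * k 0 \<le> k s" by simp
  then have 1: "c / 2 * s\<^sup>2 + s * (f e - c / 2) - (s - 1) * f 0 \<le> f p"
    by (simp add: k_def pe algebra_simps)
  have "s * (- B) \<le> s * f e" using B [of e] e s by (intro mult_left_mono) auto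
  moreover have "(s - 1) * f 0 \<le> (s - 1) * B" using B [of 0] s by (intro mult_left_mono) auto
  moreover have "(s - 1) * B \<le> s * B" using B [of 0] s by (intro mult_right_mono) auto
  ultimately show ?thesis using 1 unfolding s_def [symmetric] by (simp add: algebra_simps)
qed

context
  fixes H :: "'n::finite torus \<Rightarrow> real ^ 'n \<Rightarrow> real"
  assumes H: "Hamiltonian_assms H"
begin

lemma Hamiltonian_Ck: "Ck (Suc (Suc 0)) (\<lambda>(z :: real ^ 'n, p). H (to_torus z) p)"
  using H unfolding Hamiltonian_assms_def numeral_2_eq_2 by (elim conjE)

lemma continuous_Hamiltonian: "continuous_on UNIV (\<lambda>(x, p). H x p)"
  by (rule continuous_on_torus_lift [OF Ck_imp_continuous [OF Hamiltonian_Ck]])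

lemma Ck_Hamiltonian_slice: "Ck (Suc (Suc 0)) (H x)"
proof -
  have "bounded_linear (\<lambda>p :: real ^ 'n. (0 :: real ^ 'n, p))"
    by (intro bounded_linear_Pair bounded_linear_zero bounded_linear_ident)
  from Ck_compose_affine [OF this Hamiltonian_Ck, of "(rep_torus x, 0)"]
  show ?thesis by simp
qed

text \<open>The quadratic growth is uniform in \<open>x\<close> and beats the linear term. So the supremum defining \<open>H\<^sup>*(x, a)\<close> is
  finite, and for \<open>a\<close> in a bounded set it only involves \<open>p\<close> in a fixed ball.\<close>

lemma Hamiltonian_dominates:
  "\<exists>R\<ge>0. \<forall>x a p. norm a \<le> A \<longrightarrow> R \<le> norm p \<longrightarrow> a \<bullet> p - H x p \<le> - H x 0"
proof -
  obtain Cb where Cb: "Cb > 0" "\<And>x p \<xi>. inverse Cb * (\<xi> \<bullet> \<xi>) \<le> \<xi> \<bullet> (hess (H x) p *v \<xi>)"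
    using H unfolding Hamiltonian_assms_def by blast
  define c where "c = inverse Cb"
  have c: "c > 0" "\<And>x p \<xi>. c * (\<xi> \<bullet> \<xi>) \<le> \<xi> \<bullet> (hess (H x) p *v \<xi>)" using Cb by (auto simp: c_def)
  have "compact ((\<lambda>(x, p). H x p) ` (UNIV \<times> cball 0 1))"
    by (intro compact_continuous_image compact_Times compact_torus compact_cball
        continuous_on_subset [OF continuous_Hamiltonian]) simp
  then have "bounded ((\<lambda>(x, p). H x p) ` (UNIV \<times> cball 0 1))" by (rule compact_imp_bounded)
  then obtain B where "\<forall>y\<in>(\<lambda>(x, p). H x p) ` (UNIV \<times> cball 0 1). norm y \<le> B" unfolding bounded_iff by blast
  then have B: "\<bar>H x p\<bar> \<le> B" if "norm p \<le> 1" for x p using that by force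
  have B0: "B \<ge> 0" using B [of 0] abs_ge_zero order_trans by (metis norm_zero zero_le_one)
  \<comment> \<open>For \<open>norm p \<ge> R\<close> the quadratic coefficient satisfies \<open>c / 2 * norm p \<ge> A + 3 * B + c / 2\<close>.\<close>
  define R where "R = max 1 ((A + 3 * B + c / 2) * (2 / c))"
  have "a \<bullet> p - H x p \<le> - H x 0" if "norm a \<le> A" "R \<le> norm p" for x a p
  proof -
    define s where "s = norm p"
    have s: "s \<ge> 1" "(A + 3 * B + c / 2) * (2 / c) \<le> s" using that by (auto simp: s_def R_def)
    have "c / 2 * ((A + 3 * B + c / 2) * (2 / c)) \<le> c / 2 * s"
      using s(2) c(1) by (intro mult_left_mono) auto
    moreover have "c / 2 * ((A + 3 * B + c / 2) * (2 / c)) = A + 3 * B + c / 2"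
      using c(1) by (simp add: field_simps)
    ultimately have "A + 2 * B + c / 2 - c / 2 * s \<le> - B" by linarith
    then have "s * (A + 2 * B + c / 2 - c / 2 * s) \<le> s * (- B)" using s by (intro mult_left_mono) auto
    also have "\<dots> \<le> - B" using s B0 mult_right_mono [of 1 s B] by simp
    finally have 1: "A * s + (2 * B + c / 2) * s - c / 2 * s\<^sup>2 \<le> - B"
      by (simp add: algebra_simps power2_eq_square)
    have "a \<bullet> p \<le> norm a * norm p" by (rule norm_cauchy_schwarz)
    also have "\<dots> \<le> A * s" using that s by (simp add: s_def mult_right_mono)
    finally have "a \<bullet> p - H x p \<le> A * s - (c / 2 * s\<^sup>2 - (2 * B + c / 2) * s)"
      using strongly_convex_growth [OF Ck_Hamiltonian_slice c(2) B, of p x] s by (simp add: s_def)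
    also have "\<dots> \<le> - B" using 1 by linarith
    also have "\<dots> \<le> - H x 0" using B [of 0 x] by simp
    finally show ?thesis .
  qed
  moreover have "R \<ge> 0" by (simp add: R_def)
  ultimately show ?thesis by blast
qed

lemma Legendre_bdd: "bdd_above (range (\<lambda>p. a \<bullet> p - H x p))"
proof -
  obtain R where R: "\<And>x p. R \<le> norm p \<Longrightarrow> a \<bullet> p - H x p \<le> - H x 0"
    using Hamiltonian_dominates [of "norm a"] by blast
  have "continuous_on UNIV (H x)" by (rule continuous_on_slice [OF continuous_Hamiltonian])
  then have "continuous_on (cball 0 R) (H x)" by (rule continuous_on_subset) simp
  then have "compact ((\<lambda>p. a \<bullet> p - H x p) ` cball 0 R)"
    by (intro compact_continuous_image compact_cball continuous_on_diff continuous_on_inner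
        continuous_on_const continuous_on_id)
  then have "bounded ((\<lambda>p. a \<bullet> p - H x p) ` cball 0 R)" by (rule compact_imp_bounded)
  then obtain K where K: "\<forall>y\<in>(\<lambda>p. a \<bullet> p - H x p) ` cball 0 R. norm y \<le> K"
    unfolding bounded_iff by blast
  have "a \<bullet> p - H x p \<le> max K (- H x 0)" for p
  proof (cases "R \<le> norm p")
    case False
    then have "norm (a \<bullet> p - H x p) \<le> K" using K by auto
    then show ?thesis by simp
  qed (use R [of p x] in simp)
  then show ?thesis by (intro bdd_aboveI2)
qed

lemma Fenchel: "a \<bullet> p - H x p \<le> Hstar H x a"
  unfolding Hstar_def by (rule cSUP_upper [OF UNIV_I Legendre_bdd])

text \<open>On the compact set that matters \<open>a \<bullet> p - H x p\<close> is uniformly continuous, and suprema of uniformly close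
  functions are close. For \<open>p\<close> outside the ball the comparison is made with the value at \<open>p = 0\<close>.\<close>

lemma continuous_Hstar: "continuous_on UNIV (\<lambda>(x, a). Hstar H x a)"
  unfolding continuous_on_iff
proof (intro ballI allI impI)
  fix z0 :: "'n torus \<times> (real ^ 'n)" and \<epsilon> :: real assume "\<epsilon> > 0"
  obtain x0 a0 where z0: "z0 = (x0, a0)" by (cases z0)
  define A where "A = norm a0 + 1"
  obtain R where "R \<ge> 0" and R: "\<And>x a p. norm a \<le> A \<Longrightarrow> R \<le> norm p \<Longrightarrow> a \<bullet> p - H x p \<le> - H x 0"
    using Hamiltonian_dominates [of A] by blast
  define S where "S = ((UNIV :: 'n torus set) \<times> cball (0 :: real ^ 'n) A) \<times> cball (0 :: real ^ 'n) R"
  define \<Psi> where "\<Psi> q = snd (fst q) \<bullet> snd q - H (fst (fst q)) (snd q)" for q :: "('n torus \<times> (real ^ 'n)) \<times> (real ^ 'n)"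
  have "continuous_on S (\<lambda>q. (fst (fst q), snd q))" by (intro continuous_intros)
  from continuous_on_compose2 [OF continuous_Hamiltonian this]
  have "continuous_on S \<Psi>" unfolding \<Psi>_def by (intro continuous_intros) simp
  moreover have "compact S" unfolding S_def by (intro compact_Times compact_torus compact_cball)
  ultimately have "uniformly_continuous_on S \<Psi>" by (rule compact_uniformly_continuous)
  then obtain d where d: "d > 0"
    and unif: "\<And>q q'. q \<in> S \<Longrightarrow> q' \<in> S \<Longrightarrow> dist q' q < d \<Longrightarrow> dist (\<Psi> q') (\<Psi> q) < \<epsilon> / 2"
    using \<open>\<epsilon> > 0\<close> unfolding uniformly_continuous_on_def by (meson half_gt_zero)
  have le: "Hstar H x a \<le> Hstar H x' a' + \<epsilon> / 2"
    if "norm a \<le> A" "norm a' \<le> A" and close: "dist (x, a) (x', a') < d" for x a x' a'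
    unfolding Hstar_def [of H x a]
  proof (rule cSUP_least)
    fix p
    show "a \<bullet> p - H x p \<le> Hstar H x' a' + \<epsilon> / 2"
    proof (cases "norm p \<le> R")
      case True
      have "dist (\<Psi> ((x, a), p)) (\<Psi> ((x', a'), p)) < \<epsilon> / 2"
        using that True by (intro unif) (auto simp: S_def dist_Pair_Pair)
      then have "a \<bullet> p - H x p \<le> a' \<bullet> p - H x' p + \<epsilon> / 2"
        unfolding \<Psi>_def dist_real_def fst_conv snd_conv by linarith
      then show ?thesis using Fenchel [of a' p x'] by linarith
    next
      case False
      have "a \<bullet> p - H x p \<le> - H x 0" using R that False by simp
      moreover have "dist (\<Psi> ((x, a), 0)) (\<Psi> ((x', a'), 0)) < \<epsilon> / 2"
        using that \<open>R \<ge> 0\<close> by (intro unif) (auto simp: S_def dist_Pair_Pair)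
      ultimately show ?thesis using Fenchel [of a' 0 x']
        unfolding \<Psi>_def dist_real_def fst_conv snd_conv inner_zero_right by linarith
    qed
  qed simp
  show "\<exists>d>0. \<forall>z\<in>UNIV. dist z z0 < d \<longrightarrow> dist (case z of (x, a) \<Rightarrow> Hstar H x a) (case z0 of (x, a) \<Rightarrow> Hstar H x a) < \<epsilon>"
  proof (intro exI [of _ "min d 1"] conjI ballI impI)
    fix z :: "'n torus \<times> (real ^ 'n)" assume z: "dist z z0 < min d 1"
    obtain x a where xa: "z = (x, a)" by (cases z)
    have "dist a a0 \<le> dist z z0" unfolding xa z0 using dist_snd_le [of "(x, a)" "(x0, a0)"] by simp
    then have "norm a \<le> A" using z norm_triangle_ineq2 [of a a0] by (simp add: A_def dist_norm)
    moreover have "norm a0 \<le> A" by (simp add: A_def)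
    ultimately have "Hstar H x a \<le> Hstar H x0 a0 + \<epsilon> / 2" "Hstar H x0 a0 \<le> Hstar H x a + \<epsilon> / 2"
      using z by (auto simp: xa z0 dist_commute intro!: le)
    then show "dist (case z of (x, a) \<Rightarrow> Hstar H x a) (case z0 of (x, a) \<Rightarrow> Hstar H x a) < \<epsilon>"
      using \<open>\<epsilon> > 0\<close> by (simp add: xa z0 dist_real_def abs_le_iff)
  qed (use d in auto)
qed

end

section \<open>Kernels and the measure \<open>m(dy) \<mu>(dm)\<close>\<close>

lemma measurable_kernel_integral:
  fixes f :: "'a \<Rightarrow> 'b \<Rightarrow> 'c::{banach, second_countable_topology}"
  assumes f: "(\<lambda>(x, y). f x y) \<in> borel_measurable (M \<Otimes>\<^sub>M N)" and L: "L \<in> M \<rightarrow>\<^sub>M subprob_algebra N"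
  shows "(\<lambda>x. LINT y|L x. f x y) \<in> borel_measurable M"
proof -
  have "(\<lambda>x. distr (L x) (M \<Otimes>\<^sub>M N) (\<lambda>y. (x, y))) \<in> M \<rightarrow>\<^sub>M subprob_algebra (M \<Otimes>\<^sub>M N)"
    by (rule measurable_distr2 [OF _ L]) simp
  then have "(\<lambda>x. LINT z|distr (L x) (M \<Otimes>\<^sub>M N) (\<lambda>y. (x, y)). (\<lambda>(x, y). f x y) z) \<in> borel_measurable M"
    using integral_measurable_subprob_algebra [OF f] by (rule measurable_compose)
  moreover have "(LINT z|distr (L x) (M \<Otimes>\<^sub>M N) (\<lambda>y. (x, y)). (\<lambda>(x, y). f x y) z) = (LINT y|L x. f x y)"
    if "x \<in> space M" for x
    using that sets_kernel [OF L that] f by (subst integral_distr) (simp_all cong: measurable_cong_sets)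
  ultimately show ?thesis by (rule measurable_cong [THEN iffD1, rotated])
qed

lemma (in prob_space) norm_integral_le_const:
  fixes f :: "'a \<Rightarrow> 'b::{banach, second_countable_topology}"
  assumes "f \<in> borel_measurable M" "\<And>x. x \<in> space M \<Longrightarrow> norm (f x) \<le> B"
  shows "integrable M f" "norm (LINT x|M. f x) \<le> B"
proof -
  show i: "integrable M f" using assms by (intro integrable_const_bound [of _ B]) auto
  have "norm (LINT x|M. f x) \<le> (LINT x|M. norm (f x))" by simp
  also have "\<dots> \<le> (LINT x|M. B)" using assms i by (intro integral_mono integrable_norm) auto
  finally show "norm (LINT x|M. f x) \<le> B" by (simp add: prob_space)
qed

lemma sums_set_integral:
  fixes f :: "'a \<Rightarrow> 'b::{banach, second_countable_topology}"
  assumes f: "integrable M f" and A: "range A \<subseteq> sets M" "disjoint_family (A :: nat \<Rightarrow> _)"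
  shows "(\<lambda>i. LINT x:A i|M. f x) sums (LINT x:(\<Union>i. A i)|M. f x)"
proof -
  have As: "A i \<in> sets M" for i using A by blast
  have int: "set_integrable M S f" if "S \<in> sets M" for S
    using f that unfolding set_integrable_def by (rule integrable_mult_indicator [rotated])
  have "(\<lambda>n. LINT x:(\<Union>i<n. A i)|M. f x) \<longlonglongrightarrow> (LINT x:(\<Union>n. \<Union>i<n. A i)|M. f x)"
  proof (rule set_integral_cont_up)
    show "incseq (\<lambda>n. \<Union>i<n. A i)"
      unfolding incseq_def by (intro allI impI UN_mono) auto
  qed (use As in \<open>auto intro!: int\<close>)
  moreover have "(\<Union>n. \<Union>i<n. A i) = (\<Union>i. A i)" by blast
  moreover have "(LINT x:(\<Union>i<n. A i)|M. f x) = (\<Sum>i<n. LINT x:A i|M. f x)" for n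
    by (rule set_integral_finite_Union) (use As A(2) in \<open>auto simp: disjoint_family_on_def intro!: int\<close>)
  ultimately show ?thesis by (simp add: sums_def)
qed

lemma ext_integral_ereal:
  assumes f: "integrable M f"
  shows "ext_integral M (\<lambda>x. ereal (f x)) = ereal (LINT x|M. f x)"
proof -
  have fin: "(\<integral>\<^sup>+x. ennreal (g x) \<partial>M) < top" if "integrable M g" for g :: "_ \<Rightarrow> real"
  proof -
    have "(\<integral>\<^sup>+x. ennreal (g x) \<partial>M) \<le> (\<integral>\<^sup>+x. ennreal (norm (g x)) \<partial>M)"
      by (intro nn_integral_mono ennreal_leI) simp
    also have "\<dots> < top" using that by (simp add: integrable_iff_bounded)
    finally show ?thesis .
  qed
  have e: "enn2ereal r = ereal (enn2real r)" if "r < top" for r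
    using that by (cases r) auto
  show ?thesis
    unfolding ext_integral_def using fin [OF f] fin [OF Bochner_Integration.integrable_minus [OF f]]
    by (simp add: e real_lebesgue_integral_def [OF f])
qed

lemma ext_integral_cong_AE:
  assumes "AE x in M. f x = g x"
  shows "ext_integral M f = ext_integral M g"
proof -
  have "(\<integral>\<^sup>+x. e2ennreal (f x) \<partial>M) = (\<integral>\<^sup>+x. e2ennreal (g x) \<partial>M)"
    by (rule nn_integral_cong_AE) (use assms in auto)
  moreover have "(\<integral>\<^sup>+x. e2ennreal (- f x) \<partial>M) = (\<integral>\<^sup>+x. e2ennreal (- g x) \<partial>M)"
    by (rule nn_integral_cong_AE) (use assms in auto)
  ultimately show ?thesis by (simp add: ext_integral_def)
qed

lemma integral_vec_nth:
  fixes f :: "'a \<Rightarrow> real ^ 'n::finite"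
  assumes "integrable M f"
  shows "(LINT x|M. f x) $ i = (LINT x|M. f x $ i)"
  using integral_bounded_linear [OF bounded_linear_vec_nth assms, of i] by simp

lemma measurable_meas_subprob: "meas \<in> borel \<rightarrow>\<^sub>M subprob_algebra (borel :: 'n::finite torus measure)"
  by (rule measurable_prob_algebraD [OF measurable_meas])

text \<open>The bound on the sum suffices because the essential supremum of a nonnegative function is nonnegative.\<close>

lemma feedbacks_norm_le:
  fixes \<alpha> :: "'n::finite torus \<Rightarrow>\<^sub>C (real ^ 'n)"
  assumes "\<alpha> \<in> feedbacks C"
  shows "norm \<alpha> \<le> C"
proof -
  obtain G :: "'n torus \<Rightarrow> real ^ 'n ^ 'n" where le: "ereal (norm \<alpha>) + esssup lborel (\<lambda>z. ereal (norm (G (to_torus z)))) \<le> ereal C"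
    using assms unfolding feedbacks_def by blast
  have "(0 :: ereal) = esssup lborel (\<lambda>z :: real ^ 'n. 0)"
    by (rule esssup_const [symmetric]) simp
  also have "\<dots> \<le> esssup lborel (\<lambda>z. ereal (norm (G (to_torus z))))"
    by (rule esssup_mono) auto
  finally have "ereal (norm \<alpha>) + 0 \<le> ereal C"
    using le by (meson add_left_mono order_trans)
  then show ?thesis by simp
qed

lemma measurable_Pair_torus: "(\<lambda>y. (m, y)) \<in> meas m \<rightarrow>\<^sub>M borel"
  by (rule measurable_torus) (intro continuous_on_Pair continuous_on_const continuous_on_id)

lemma measurable_section:
  fixes f :: "'n::finite ptorus \<times> 'n torus \<Rightarrow> 'c::topological_space"
  assumes "f \<in> borel_measurable borel"
  shows "(\<lambda>y. f (m, y)) \<in> borel_measurable (meas m)"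
  using measurable_compose [OF measurable_Pair_torus assms] .

context
  fixes \<mu> :: "'n::finite ptorus measure"
  assumes prob: "prob_space \<mu>" and sets_mu: "sets \<mu> = sets borel"
begin

lemma measurable_dm_kernel:
  "(\<lambda>m. distr (meas m) borel (\<lambda>y. (m, y))) \<in> \<mu> \<rightarrow>\<^sub>M subprob_algebra (borel :: ('n ptorus \<times> 'n torus) measure)"
proof -
  have "(\<lambda>(m, y). (m, y)) \<in> (borel \<Otimes>\<^sub>M borel :: ('n ptorus \<times> 'n torus) measure) \<rightarrow>\<^sub>M borel"
    by (simp add: measurable_cong_sets [OF refl sets_borel_Times])
  then have "(\<lambda>m. distr (meas m) borel (\<lambda>y. (m, y))) \<in> borel \<rightarrow>\<^sub>M subprob_algebra (borel :: ('n ptorus \<times> 'n torus) measure)"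
    by (rule measurable_distr2 [OF _ measurable_meas_subprob])
  then show ?thesis unfolding measurable_cong_sets [OF sets_mu refl] .
qed

lemma space_mu: "space \<mu> = UNIV"
  using sets_eq_imp_space_eq [OF sets_mu] by simp

lemma sets_dm_otimes: "sets (dm_otimes \<mu>) = sets borel"
  unfolding dm_otimes_def by (rule sets_bind) (auto simp: space_mu)

lemma prob_space_dm_otimes: "prob_space (dm_otimes \<mu>)"
  unfolding dm_otimes_def
proof (rule prob_space.prob_space_bind [OF prob _ measurable_dm_kernel])
  show "AE m in \<mu>. prob_space (distr (meas m) borel (\<lambda>y. (m, y)))"
    by (simp add: prob_space.prob_space_distr [OF prob_space_meas measurable_Pair_torus])
qed

lemma measurable_on_dm: "f \<in> borel_measurable borel \<Longrightarrow> f \<in> borel_measurable (dm_otimes \<mu>)"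
  by (simp add: measurable_cong_sets [OF sets_dm_otimes refl])

lemma measurable_fibre_integral:
  fixes f :: "'n ptorus \<times> 'n torus \<Rightarrow> 'c::{banach, second_countable_topology}"
  assumes "f \<in> borel_measurable borel"
  shows "(\<lambda>m. LINT y|meas m. f (m, y)) \<in> borel_measurable \<mu>"
  unfolding measurable_cong_sets [OF sets_mu refl]
proof (rule measurable_kernel_integral [OF _ measurable_meas_subprob])
  show "(\<lambda>(m, y). f (m, y)) \<in> borel_measurable (borel \<Otimes>\<^sub>M borel)"
    using assms by (simp add: measurable_cong_sets [OF sets_borel_Times refl])
qed

lemma integral_dm_otimes:
  fixes f :: "'n ptorus \<times> 'n torus \<Rightarrow> real"
  assumes f: "f \<in> borel_measurable borel" and B: "\<And>z. \<bar>f z\<bar> \<le> B"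
  shows "(LINT z|dm_otimes \<mu>. f z) = (LINT m|\<mu>. LINT y|meas m. f (m, y))"
proof -
  have "(LINT z|dm_otimes \<mu>. f z) = (LINT m|\<mu>. LINT z|distr (meas m) borel (\<lambda>y. (m, y)). f z)"
    unfolding dm_otimes_def
  proof (rule integral_bind [OF f _ measurable_dm_kernel])
    show "\<bar>f z\<bar> \<le> B" for z by (rule B)
    show "finite_measure \<mu>" using prob by (rule prob_space.finite_measure)
    have "emeasure (distr (meas m) borel (\<lambda>y. (m, y))) (space (distr (meas m) borel (\<lambda>y. (m, y)))) = 1" for m :: "'n ptorus"
      by (rule prob_space.emeasure_space_1 [OF prob_space.prob_space_distr [OF prob_space_meas measurable_Pair_torus]])
    then show "AE m in \<mu>. emeasure (distr (meas m) borel (\<lambda>y. (m, y))) (space (distr (meas m) borel (\<lambda>y. (m, y)))) \<le> ennreal 1"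
      by (intro AE_I2) simp
  qed
  then show ?thesis by (simp add: integral_distr [OF measurable_Pair_torus f])
qed

lemma integral_dm_otimes_vec:
  fixes f :: "'n ptorus \<times> 'n torus \<Rightarrow> real ^ 'k::finite"
  assumes f: "f \<in> borel_measurable borel" and B: "\<And>z. norm (f z) \<le> B"
  shows "integrable (dm_otimes \<mu>) f"
    and "(LINT z|dm_otimes \<mu>. f z) = (LINT m|\<mu>. LINT y|meas m. f (m, y))"
proof -
  show i: "integrable (dm_otimes \<mu>) f"
    by (rule prob_space.norm_integral_le_const(1) [OF prob_space_dm_otimes measurable_on_dm [OF f]]) (rule B)
  have im: "integrable (meas m) (\<lambda>y. f (m, y))" "norm (LINT y|meas m. f (m, y)) \<le> B" for m
    by (rule prob_space.norm_integral_le_const [OF prob_space_meas measurable_section [OF f]], rule B)+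
  have imu: "integrable \<mu> (\<lambda>m. LINT y|meas m. f (m, y))"
    by (rule prob_space.norm_integral_le_const(1) [OF prob measurable_fibre_integral [OF f]]) (rule im(2))
  show "(LINT z|dm_otimes \<mu>. f z) = (LINT m|\<mu>. LINT y|meas m. f (m, y))"
  proof (rule vec_eq_iff [THEN iffD2, rule_format])
    fix i
    have fi: "(\<lambda>z. f z $ i) \<in> borel_measurable borel"
      using f by (rule measurable_compose) (intro borel_measurable_continuous_onI continuous_intros)
    have "(LINT z|dm_otimes \<mu>. f z) $ i = (LINT z|dm_otimes \<mu>. f z $ i)" by (rule integral_vec_nth [OF i])
    also have "\<dots> = (LINT m|\<mu>. LINT y|meas m. f (m, y) $ i)"
      by (rule integral_dm_otimes [OF fi]) (rule order_trans [OF component_le_norm_cart B])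
    also have "\<dots> = (LINT m|\<mu>. (LINT y|meas m. f (m, y)) $ i)"
      by (simp add: integral_vec_nth [OF im(1)])
    also have "\<dots> = (LINT m|\<mu>. LINT y|meas m. f (m, y)) $ i"
      by (rule integral_vec_nth [OF imu, symmetric])
    finally show "(LINT z|dm_otimes \<mu>. f z) $ i = (LINT m|\<mu>. LINT y|meas m. f (m, y)) $ i" .
  qed
qed

lemma AE_dm_otimes:
  assumes "{z. P z} \<in> sets borel" and "AE z in dm_otimes \<mu>. P z"
  shows "AE m in \<mu>. AE y in meas m. P (m, y)"
proof -
  have P: "Measurable.pred (borel :: ('n ptorus \<times> 'n torus) measure) P"
    using assms(1) by (simp add: pred_def)
  have "AE m in \<mu>. AE z in distr (meas m) borel (\<lambda>y. (m, y)). P z"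
    using assms(2) unfolding dm_otimes_def AE_bind [OF measurable_dm_kernel P] .
  moreover have "(AE z in distr (meas m) borel (\<lambda>y. (m, y)). P z) \<longleftrightarrow> (AE y in meas m. P (m, y))" for m
    by (rule AE_distr_iff [OF measurable_Pair_torus]) (use assms(1) in simp)
  ultimately show ?thesis by simp
qed

end

section \<open>The running cost and the generator as integrands\<close>

definition running_cost ::
    "('n::finite torus \<Rightarrow> real ^ 'n \<Rightarrow> real) \<Rightarrow> ('n ptorus \<Rightarrow> real) \<Rightarrow>
     'n ptorus \<times> ('n torus \<Rightarrow>\<^sub>C (real ^ 'n)) \<Rightarrow> real" where
  "running_cost H F z = (LINT y|meas (fst z). Hstar H y (apply_bcontfun (snd z) y)) + F (fst z)"

lemma continuous_Hstar_feedback: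
  assumes H: "Hamiltonian_assms H"
  shows "continuous_on UNIV (\<lambda>(z :: 'n::finite ptorus \<times> ('n torus \<Rightarrow>\<^sub>C (real ^ 'n)), y). Hstar H y (apply_bcontfun (snd z) y))"
proof -
  have "continuous_on UNIV (\<lambda>p :: ('n ptorus \<times> ('n torus \<Rightarrow>\<^sub>C (real ^ 'n))) \<times> 'n torus. (snd (fst p), snd p))"
    by (intro continuous_intros)
  from continuous_on_compose2 [OF continuous_evaluation this]
  have "continuous_on UNIV (\<lambda>p :: ('n ptorus \<times> ('n torus \<Rightarrow>\<^sub>C (real ^ 'n))) \<times> 'n torus. apply_bcontfun (snd (fst p)) (snd p))"
    by simp
  from continuous_on_Pair [OF continuous_on_snd [OF continuous_on_id] this]
  have "continuous_on UNIV (\<lambda>p :: ('n ptorus \<times> ('n torus \<Rightarrow>\<^sub>C (real ^ 'n))) \<times> 'n torus. (snd p, apply_bcontfun (snd (fst p)) (snd p)))" .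
  from continuous_on_compose2 [OF continuous_Hstar [OF H] this]
  show ?thesis by (simp add: case_prod_beta')
qed

lemma continuous_running_cost:
  assumes H: "Hamiltonian_assms H" and F: "continuous_on UNIV F"
  shows "continuous_on UNIV (running_cost H F)"
proof -
  have "continuous_on UNIV (\<lambda>z. LINT y|meas (fst z). Hstar H y (apply_bcontfun (snd z) y))"
    by (rule continuous_integral_param [OF continuous_Hstar_feedback [OF H]]) (intro continuous_intros)
  moreover have "continuous_on UNIV (\<lambda>z. F (fst z))"
    using continuous_on_compose2 [OF F continuous_on_fst [OF continuous_on_id]] by simp
  ultimately show ?thesis unfolding running_cost_def [abs_def] by (rule continuous_on_add)
qed

lemma Hstar_bounded:
  assumes H: "Hamiltonian_assms H"
  shows "\<exists>K. \<forall>y a. norm a \<le> C \<longrightarrow> \<bar>Hstar H (y :: 'n::finite torus) a\<bar> \<le> K"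
proof -
  have "compact ((\<lambda>(y, a). Hstar H y a) ` (UNIV \<times> cball 0 C))"
    by (intro compact_continuous_image compact_Times compact_torus compact_cball
        continuous_on_subset [OF continuous_Hstar [OF H]]) simp
  then have "bounded ((\<lambda>(y, a). Hstar H y a) ` (UNIV \<times> cball 0 C))" by (rule compact_imp_bounded)
  then obtain K where "\<forall>v\<in>(\<lambda>(y, a). Hstar H y a) ` (UNIV \<times> cball 0 C). norm v \<le> K"
    unfolding bounded_iff by blast
  then have "\<bar>Hstar H y a\<bar> \<le> K" if "norm a \<le> C" for y a using that by force
  then show ?thesis by blast
qed

lemma running_cost_bounded:
  assumes H: "Hamiltonian_assms H" and FB: "\<And>m. \<bar>F m\<bar> \<le> B"
  shows "\<exists>K. \<forall>m \<alpha>. norm \<alpha> \<le> C \<longrightarrow> \<bar>running_cost H F (m, \<alpha>)\<bar> \<le> K"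
proof -
  obtain K where K: "\<And>y a. norm a \<le> C \<Longrightarrow> \<bar>Hstar H y a\<bar> \<le> K" using Hstar_bounded [OF H] by blast
  have "\<bar>running_cost H F (m, \<alpha>)\<bar> \<le> K + B" if "norm \<alpha> \<le> C" for m \<alpha>
  proof -
    have "\<bar>LINT y|meas m. Hstar H y (apply_bcontfun \<alpha> y)\<bar> \<le> K"
    proof (rule abs_integral_meas_le)
      show "continuous_on UNIV (\<lambda>y. Hstar H y (apply_bcontfun \<alpha> y))"
        using continuous_on_slice [OF continuous_Hstar_feedback [OF H], of "(m, \<alpha>)"] by simp
      show "\<bar>Hstar H y (apply_bcontfun \<alpha> y)\<bar> \<le> K" for y
        by (rule K) (rule order_trans [OF norm_bounded that])
    qed
    then show ?thesis using FB [of m] by (simp add: running_cost_def)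
  qed
  then show ?thesis by blast
qed

lemma generator_bounded:
  assumes \<Phi>: "C11 \<Phi>"
  shows "\<exists>K. \<forall>m \<alpha>. norm \<alpha> \<le> C \<longrightarrow> \<bar>generator \<Phi> m (m, \<alpha>)\<bar> \<le> K"
proof -
  obtain K where K: "\<And>m y v. norm v \<le> C \<Longrightarrow> \<bar>tdiv (Dm \<Phi> m) y - Dm \<Phi> m y \<bullet> v\<bar> \<le> K"
    using C11_drift_bound [OF \<Phi>] by blast
  have "\<bar>generator \<Phi> m (m, \<alpha>)\<bar> \<le> K" if "norm \<alpha> \<le> C" for m \<alpha>
    unfolding generator_def drift_pairing_def fst_conv snd_conv
  proof (rule abs_integral_meas_le)
    show "continuous_on UNIV (\<lambda>y. tdiv (Dm \<Phi> m) y - Dm \<Phi> m y \<bullet> apply_bcontfun \<alpha> y)"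
      by (intro continuous_on_diff continuous_on_inner continuous_on_apply_bcontfun
          continuous_on_slice [OF continuous_div_Dm [OF \<Phi>]] continuous_on_slice [OF continuous_Dm [OF \<Phi>]])
    show "\<bar>tdiv (Dm \<Phi> m) y - Dm \<Phi> m y \<bullet> apply_bcontfun \<alpha> y\<bar> \<le> K" for y
      by (rule K [OF order_trans [OF norm_bounded that]])
  qed
  then show ?thesis by blast
qed

section \<open>The limit flux and closedness\<close>

text \<open>The mean of the feedbacks in the fibre over \<open>m\<close>. It is the density of the limit flux with respect to
  \<open>m(dy) \<mu>(dm)\<close>.\<close>

definition mean_drift :: "('n::finite ptorus \<Rightarrow> ('n torus \<Rightarrow>\<^sub>C (real ^ 'n)) measure) \<Rightarrow> 'n ptorus \<times> 'n torus \<Rightarrow> real ^ 'n" where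
  "mean_drift \<kappa> z = (LINT \<alpha>|\<kappa> (fst z). apply_bcontfun \<alpha> (snd z))"

context
  fixes C :: real
    and \<nu> :: "('n::finite ptorus \<times> ('n torus \<Rightarrow>\<^sub>C (real ^ 'n))) measure"
    and \<mu> :: "'n ptorus measure"
    and \<kappa> :: "'n ptorus \<Rightarrow> ('n torus \<Rightarrow>\<^sub>C (real ^ 'n)) measure"
  assumes \<nu>: "\<nu> \<in> space (prob_algebra (PE_borel C))"
    and \<mu>: "\<mu> = distr \<nu> borel fst"
    and \<kappa>: "disintegration C \<nu> \<mu> \<kappa>"
begin

abbreviation E_borel :: "('n torus \<Rightarrow>\<^sub>C (real ^ 'n)) measure" where
  "E_borel \<equiv> restrict_space borel (feedbacks C)"

lemma prob_nu: "prob_space \<nu>" and sets_nu: "sets \<nu> = sets (PE_borel C)"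
  using \<nu> by (simp_all add: space_prob_algebra)

lemma space_PE: "space (PE_borel C) = UNIV \<times> feedbacks C"
  by (simp add: PE_borel_def space_restrict_space)

lemma space_nu: "space \<nu> = UNIV \<times> feedbacks C"
  using sets_eq_imp_space_eq [OF sets_nu] space_PE by simp

lemma measurable_PE_continuous:
  fixes f :: "'n ptorus \<times> ('n torus \<Rightarrow>\<^sub>C (real ^ 'n)) \<Rightarrow> 'b::topological_space"
  assumes "continuous_on UNIV f"
  shows "f \<in> PE_borel C \<rightarrow>\<^sub>M borel"
  unfolding PE_borel_def
  by (rule borel_measurable_continuous_on_restrict [OF continuous_on_subset [OF assms]]) simp

lemma measurable_nu_fst: "fst \<in> \<nu> \<rightarrow>\<^sub>M borel"
  unfolding measurable_cong_sets [OF sets_nu refl]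
  by (rule measurable_PE_continuous) (intro continuous_intros)

lemma prob_mu: "prob_space \<mu>"
  unfolding \<mu> by (rule prob_space.prob_space_distr [OF prob_nu measurable_nu_fst])

lemma sets_mu_borel: "sets \<mu> = sets borel"
  by (simp add: \<mu>)

lemma kappa_prob_kernel: "\<kappa> \<in> borel \<rightarrow>\<^sub>M prob_algebra E_borel"
  using \<kappa> unfolding disintegration_def by (rule conjunct1)

lemma measurable_kappa: "\<kappa> \<in> borel \<rightarrow>\<^sub>M subprob_algebra E_borel"
  by (rule measurable_prob_algebraD [OF kappa_prob_kernel])

lemma prob_kappa: "prob_space (\<kappa> m)" and sets_kappa: "sets (\<kappa> m) = sets E_borel"
proof -
  have "\<kappa> m \<in> space (prob_algebra E_borel)"
    by (rule measurable_space [OF kappa_prob_kernel]) simp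
  then show "prob_space (\<kappa> m)" "sets (\<kappa> m) = sets E_borel" by (simp_all add: space_prob_algebra)
qed

lemma space_kappa: "space (\<kappa> m) = feedbacks C"
  using sets_eq_imp_space_eq [OF sets_kappa] by (simp add: space_restrict_space)

lemma nonneg_C: "0 \<le> C"
proof -
  obtain \<alpha> :: "'n torus \<Rightarrow>\<^sub>C (real ^ 'n)" where "\<alpha> \<in> feedbacks C"
    using prob_space.not_empty [OF prob_kappa [of undefined]] unfolding space_kappa by blast
  then have "norm \<alpha> \<le> C" by (rule feedbacks_norm_le)
  then show ?thesis by (rule order_trans [OF norm_ge_zero])
qed

lemma feedback_apply_le: "(\<alpha> :: 'n torus \<Rightarrow>\<^sub>C (real ^ 'n)) \<in> feedbacks C \<Longrightarrow> norm (apply_bcontfun \<alpha> y) \<le> C"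
  by (rule order_trans [OF norm_bounded feedbacks_norm_le])

lemma measurable_evaluation: "(\<lambda>(\<alpha>, y). apply_bcontfun \<alpha> y) \<in> borel_measurable (E_borel \<Otimes>\<^sub>M (borel :: 'n torus measure))"
proof -
  have e: "(\<lambda>(\<alpha>, y). apply_bcontfun \<alpha> y) \<in> borel_measurable (borel \<Otimes>\<^sub>M borel :: (('n torus \<Rightarrow>\<^sub>C (real ^ 'n)) \<times> 'n torus) measure)"
    by (simp only: measurable_cong_sets [OF sets_borel_Times [symmetric] refl])
      (rule borel_measurable_continuous_onI [OF continuous_evaluation])
  have "(\<lambda>\<alpha>. \<alpha>) \<in> E_borel \<rightarrow>\<^sub>M borel"
    by (rule measurable_restrict_space1) simp
  then have "(\<lambda>z. (fst z, snd z)) \<in> E_borel \<Otimes>\<^sub>M (borel :: 'n torus measure) \<rightarrow>\<^sub>M borel \<Otimes>\<^sub>M borel"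
    by (intro measurable_Pair measurable_compose [OF measurable_fst] measurable_snd) simp_all
  from measurable_compose [OF this e] show ?thesis by (simp add: case_prod_beta')
qed

lemma measurable_kappa_integral:
  fixes f :: "'n ptorus \<Rightarrow> ('n torus \<Rightarrow>\<^sub>C (real ^ 'n)) \<Rightarrow> 'n torus \<Rightarrow> 'b::{banach, second_countable_topology}"
  assumes f: "(\<lambda>((m, \<alpha>), y). f m \<alpha> y) \<in> borel_measurable ((borel \<Otimes>\<^sub>M E_borel) \<Otimes>\<^sub>M borel)"
  shows "(\<lambda>z. LINT \<alpha>|\<kappa> (fst z). f (fst z) \<alpha> (snd z)) \<in> borel_measurable borel"
proof -
  have "(\<lambda>p. ((fst (fst p), snd p), snd (fst p))) \<in>
      ((borel :: 'n ptorus measure) \<Otimes>\<^sub>M (borel :: 'n torus measure)) \<Otimes>\<^sub>M E_borel \<rightarrow>\<^sub>M (borel \<Otimes>\<^sub>M E_borel) \<Otimes>\<^sub>M borel"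
    by (intro measurable_Pair measurable_snd measurable_compose [OF measurable_fst measurable_fst]
        measurable_compose [OF measurable_fst measurable_snd])
  from measurable_compose [OF this f]
  have "(\<lambda>(z, \<alpha>). f (fst z) \<alpha> (snd z)) \<in> borel_measurable ((borel \<Otimes>\<^sub>M borel) \<Otimes>\<^sub>M E_borel)"
    by (simp add: case_prod_beta')
  moreover have "(\<lambda>z. \<kappa> (fst z)) \<in> borel \<Otimes>\<^sub>M borel \<rightarrow>\<^sub>M subprob_algebra E_borel"
    by (rule measurable_compose [OF measurable_fst measurable_kappa])
  ultimately have "(\<lambda>z. LINT \<alpha>|\<kappa> (fst z). f (fst z) \<alpha> (snd z)) \<in> borel_measurable (borel \<Otimes>\<^sub>M borel)"
    by (rule measurable_kernel_integral)
  then show ?thesis by (simp only: measurable_cong_sets [OF sets_borel_Times refl])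
qed

lemma measurable_evaluation3:
  "(\<lambda>((m, \<alpha>), y). apply_bcontfun \<alpha> y) \<in> borel_measurable (((borel :: 'n ptorus measure) \<Otimes>\<^sub>M E_borel) \<Otimes>\<^sub>M borel)"
proof -
  have "(\<lambda>p. (snd (fst p), snd p)) \<in> ((borel :: 'n ptorus measure) \<Otimes>\<^sub>M E_borel) \<Otimes>\<^sub>M (borel :: 'n torus measure) \<rightarrow>\<^sub>M E_borel \<Otimes>\<^sub>M borel"
    by (intro measurable_Pair measurable_snd measurable_compose [OF measurable_fst measurable_snd])
  from measurable_compose [OF this measurable_evaluation] show ?thesis by (simp add: case_prod_beta')
qed

lemma measurable_mean_drift: "mean_drift \<kappa> \<in> borel_measurable borel"
  unfolding mean_drift_def [abs_def] by (rule measurable_kappa_integral [OF measurable_evaluation3])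

lemma measurable_apply: "(\<lambda>\<alpha>. apply_bcontfun \<alpha> y) \<in> borel_measurable (\<kappa> m)"
proof -
  have "(\<lambda>\<alpha>. apply_bcontfun \<alpha> y) \<in> borel_measurable E_borel"
    using measurable_compose [OF measurable_Pair2' measurable_evaluation, of y] by simp
  then show ?thesis by (simp only: measurable_cong_sets [OF sets_kappa refl])
qed

lemma integrable_apply: "integrable (\<kappa> m) (\<lambda>\<alpha>. apply_bcontfun \<alpha> y)"
  and mean_drift_le: "norm (mean_drift \<kappa> z) \<le> C"
proof -
  show "integrable (\<kappa> m) (\<lambda>\<alpha>. apply_bcontfun \<alpha> y)"
    by (rule prob_space.norm_integral_le_const(1) [OF prob_kappa measurable_apply, of _ _ C])
      (simp add: space_kappa feedback_apply_le)
  show "norm (mean_drift \<kappa> z) \<le> C"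
    unfolding mean_drift_def
    by (rule prob_space.norm_integral_le_const(2) [OF prob_kappa measurable_apply])
      (simp add: space_kappa feedback_apply_le)
qed

lemma fibre_Fubini:
  fixes f :: "('n torus \<Rightarrow>\<^sub>C (real ^ 'n)) \<Rightarrow> 'n torus \<Rightarrow> 'b::{banach, second_countable_topology}"
  assumes f: "(\<lambda>(\<alpha>, y). f \<alpha> y) \<in> borel_measurable (E_borel \<Otimes>\<^sub>M borel)"
    and B: "\<And>\<alpha> y. \<alpha> \<in> feedbacks C \<Longrightarrow> norm (f \<alpha> y) \<le> B"
  shows "(LINT \<alpha>|\<kappa> m. LINT y|meas m. f \<alpha> y) = (LINT y|meas m. LINT \<alpha>|\<kappa> m. f \<alpha> y)"
proof -
  interpret k: prob_space "\<kappa> m" by (rule prob_kappa)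
  interpret m: prob_space "meas m" by (rule prob_space_meas)
  interpret P: pair_prob_space "\<kappa> m" "meas m" ..
  have s: "sets (\<kappa> m \<Otimes>\<^sub>M meas m) = sets (E_borel \<Otimes>\<^sub>M borel)"
    by (rule sets_pair_measure_cong [OF sets_kappa sets_meas])
  have "(\<lambda>(\<alpha>, y). f \<alpha> y) \<in> borel_measurable (\<kappa> m \<Otimes>\<^sub>M meas m)"
    using f by (simp only: measurable_cong_sets [OF s refl])
  then have "integrable (\<kappa> m \<Otimes>\<^sub>M meas m) (\<lambda>(\<alpha>, y). f \<alpha> y)"
    by (rule P.norm_integral_le_const(1) [of _ B]) (auto simp: space_pair_measure space_kappa B)
  from P.Fubini_integral [OF this] show ?thesis by simp
qed

lemma limit_flux_eq:
  assumes A: "A \<in> sets borel"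
  shows "limit_flux \<mu> \<kappa> A = (LINT z:A|dm_otimes \<mu>. mean_drift \<kappa> z)"
proof -
  define f where "f z = indicat_real A z *\<^sub>R mean_drift \<kappa> z" for z
  have fm: "f \<in> borel_measurable borel"
    unfolding f_def [abs_def] using A measurable_mean_drift by (intro borel_measurable_scaleR borel_measurable_indicator)
  have fb: "norm (f z) \<le> C" for z
    using mean_drift_le [of z] nonneg_C by (simp add: f_def indicator_def)
  have "(LINT \<alpha>|\<kappa> m. LINT y|meas m. indicator A (m, y) *\<^sub>R apply_bcontfun \<alpha> y) = (LINT y|meas m. f (m, y))" for m
  proof -
    have "(\<lambda>z. indicat_real A (m, snd z)) \<in> borel_measurable (E_borel \<Otimes>\<^sub>M (borel :: 'n torus measure))"
    proof (rule measurable_compose [OF measurable_snd])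
      have "(\<lambda>y. (m, y)) \<in> borel \<rightarrow>\<^sub>M (borel :: ('n ptorus \<times> 'n torus) measure)"
        using measurable_Pair_torus [of m] by (simp only: measurable_cong_sets [OF sets_meas refl])
      from measurable_compose [OF this borel_measurable_indicator [OF A]]
      show "(\<lambda>y. indicat_real A (m, y)) \<in> borel_measurable borel" .
    qed
    then have "(\<lambda>(\<alpha>, y). indicat_real A (m, y) *\<^sub>R apply_bcontfun \<alpha> y) \<in> borel_measurable (E_borel \<Otimes>\<^sub>M borel)"
      using measurable_evaluation unfolding case_prod_beta' by (rule borel_measurable_scaleR)
    then have "(LINT \<alpha>|\<kappa> m. LINT y|meas m. indicat_real A (m, y) *\<^sub>R apply_bcontfun \<alpha> y)
        = (LINT y|meas m. LINT \<alpha>|\<kappa> m. indicat_real A (m, y) *\<^sub>R apply_bcontfun \<alpha> y)"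
      by (rule fibre_Fubini [where B = C]) (use feedback_apply_le nonneg_C in \<open>auto simp: indicator_def\<close>)
    then show ?thesis by (simp add: f_def mean_drift_def)
  qed
  then have "limit_flux \<mu> \<kappa> A = (LINT m|\<mu>. LINT y|meas m. f (m, y))"
    by (simp add: limit_flux_def)
  also have "\<dots> = (LINT z|dm_otimes \<mu>. f z)"
    by (rule integral_dm_otimes_vec(2) [OF prob_mu sets_mu_borel fm fb, symmetric])
  finally show ?thesis by (simp add: f_def set_lebesgue_integral_def)
qed

lemma integrable_mean_drift: "integrable (dm_otimes \<mu>) (mean_drift \<kappa>)"
  by (rule integral_dm_otimes_vec(1) [OF prob_mu sets_mu_borel measurable_mean_drift mean_drift_le])

lemma vector_measure_limit_flux: "vector_measure borel (limit_flux \<mu> \<kappa>)"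
  unfolding vector_measure_def
proof (intro conjI allI impI)
  show "limit_flux \<mu> \<kappa> {} = 0" by (simp add: limit_flux_eq set_lebesgue_integral_def)
  fix A :: "nat \<Rightarrow> ('n ptorus \<times> 'n torus) set"
  assume A: "range A \<subseteq> sets borel \<and> disjoint_family A"
  then have As: "A i \<in> sets borel" for i by blast
  have "(\<lambda>i. LINT z:A i|dm_otimes \<mu>. mean_drift \<kappa> z) sums (LINT z:(\<Union>i. A i)|dm_otimes \<mu>. mean_drift \<kappa> z)"
    by (rule sums_set_integral [OF integrable_mean_drift])
      (use A sets_dm_otimes [OF prob_mu sets_mu_borel] in auto)
  then show "(\<lambda>i. limit_flux \<mu> \<kappa> (A i)) sums limit_flux \<mu> \<kappa> (\<Union>i. A i)"
    using As by (simp add: limit_flux_eq sets.countable_UN)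
qed

lemma abs_continuous_limit_flux: "abs_continuous (dm_otimes \<mu>) (limit_flux \<mu> \<kappa>)"
  unfolding abs_continuous_def
proof
  fix A assume A: "A \<in> null_sets (dm_otimes \<mu>)"
  then have "A \<in> sets borel" using sets_dm_otimes [OF prob_mu sets_mu_borel] by auto
  moreover have "(LINT z:A|dm_otimes \<mu>. mean_drift \<kappa> z) = 0"
    unfolding set_lebesgue_integral_def
  proof (rule integral_eq_zero_AE)
    show "AE z in dm_otimes \<mu>. indicat_real A z *\<^sub>R mean_drift \<kappa> z = 0"
      using AE_not_in [OF A] by eventually_elim (simp add: indicator_def)
  qed
  ultimately show "limit_flux \<mu> \<kappa> A = 0" by (simp add: limit_flux_eq)
qed

text \<open>The chosen derivative and the mean drift have the same integrals over all Borel sets.\<close>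

lemma vec_RN_deriv_limit_flux:
  "vec_RN_deriv (dm_otimes \<mu>) (limit_flux \<mu> \<kappa>) \<in> borel_measurable borel"
  "AE z in dm_otimes \<mu>. vec_RN_deriv (dm_otimes \<mu>) (limit_flux \<mu> \<kappa>) z = mean_drift \<kappa> z"
proof -
  interpret D: prob_space "dm_otimes \<mu>" by (rule prob_space_dm_otimes [OF prob_mu sets_mu_borel])
  note sets = sets_dm_otimes [OF prob_mu sets_mu_borel]
  let ?P = "\<lambda>w. integrable (dm_otimes \<mu>) w \<and> (\<forall>A\<in>sets (dm_otimes \<mu>). limit_flux \<mu> \<kappa> A = (LINT x:A|dm_otimes \<mu>. w x))"
  have "?P (mean_drift \<kappa>)" using integrable_mean_drift sets limit_flux_eq by simp
  then have P: "?P (vec_RN_deriv (dm_otimes \<mu>) (limit_flux \<mu> \<kappa>))"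
    unfolding vec_RN_deriv_def by (rule someI [of ?P])
  then show "vec_RN_deriv (dm_otimes \<mu>) (limit_flux \<mu> \<kappa>) \<in> borel_measurable borel"
    using borel_measurable_integrable measurable_cong_sets [OF sets refl] by blast
  show "AE z in dm_otimes \<mu>. vec_RN_deriv (dm_otimes \<mu>) (limit_flux \<mu> \<kappa>) z = mean_drift \<kappa> z"
    using P limit_flux_eq sets by (intro D.density_unique_banach integrable_mean_drift) simp_all
qed

text \<open>The disintegration prescribes \<open>\<nu>\<close> on sets. On the product of the two Borel \<open>\<sigma>\<close>-algebras, which may be smaller
  than the Borel \<open>\<sigma>\<close>-algebra of the product space, this makes \<open>\<nu>\<close> the composition of \<open>\<mu>\<close> with a kernel, and
  integrals of measurable functions can be iterated.\<close>

lemma integral_nu: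
  fixes f :: "'n ptorus \<times> ('n torus \<Rightarrow>\<^sub>C (real ^ 'n)) \<Rightarrow> real"
  assumes f: "f \<in> borel_measurable (borel \<Otimes>\<^sub>M E_borel)"
    and B: "\<And>m \<alpha>. \<alpha> \<in> feedbacks C \<Longrightarrow> \<bar>f (m, \<alpha>)\<bar> \<le> B"
  shows "(LINT z|\<nu>. f z) = (LINT m|\<mu>. LINT \<alpha>|\<kappa> m. f (m, \<alpha>))"
proof -
  define N where "N = (borel :: 'n ptorus measure) \<Otimes>\<^sub>M E_borel"
  have spN: "space N = UNIV \<times> feedbacks C" by (simp add: N_def space_pair_measure space_restrict_space)
  have "snd \<in> PE_borel C \<rightarrow>\<^sub>M E_borel"
    by (rule measurable_restrict_space2) (auto simp: space_PE intro!: measurable_PE_continuous continuous_intros)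
  moreover have "(fst :: 'n ptorus \<times> ('n torus \<Rightarrow>\<^sub>C (real ^ 'n)) \<Rightarrow> _) \<in> PE_borel C \<rightarrow>\<^sub>M borel"
    by (rule measurable_PE_continuous) (intro continuous_intros)
  ultimately have "(\<lambda>z. (fst z, snd z)) \<in> PE_borel C \<rightarrow>\<^sub>M N"
    unfolding N_def by (intro measurable_Pair) auto
  then have idP: "(\<lambda>z. z) \<in> PE_borel C \<rightarrow>\<^sub>M N" by simp
  then have id: "(\<lambda>z. z) \<in> \<nu> \<rightarrow>\<^sub>M N" by (simp only: measurable_cong_sets [OF sets_nu refl])
  have PN: "(\<lambda>\<alpha>. (m, \<alpha>)) \<in> \<kappa> m \<rightarrow>\<^sub>M N" for m
    unfolding N_def measurable_cong_sets [OF sets_kappa refl] by (rule measurable_Pair1') simp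
  define D where "D m = distr (\<kappa> m) N (\<lambda>\<alpha>. (m, \<alpha>))" for m
  have K: "D \<in> \<mu> \<rightarrow>\<^sub>M subprob_algebra N"
    unfolding measurable_cong_sets [OF sets_mu_borel refl] D_def [abs_def]
    by (rule measurable_distr2 [OF _ measurable_kappa]) (simp add: N_def)
  have sp\<mu>: "space \<mu> = UNIV" using sets_eq_imp_space_eq [OF sets_mu_borel] by simp
  have "distr \<nu> N (\<lambda>z. z) = \<mu> \<bind> D"
  proof (rule measure_eqI)
    have sB: "sets (\<mu> \<bind> D) = sets N"
      by (rule sets_bind) (simp_all add: sp\<mu> D_def)
    then show "sets (distr \<nu> N (\<lambda>z. z)) = sets (\<mu> \<bind> D)" by simp
    fix A assume "A \<in> sets (distr \<nu> N (\<lambda>z. z))"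
    then have A: "A \<in> sets N" by simp
    then have sub: "A \<subseteq> UNIV \<times> feedbacks C" using sets.sets_into_space spN by metis
    have "A = (\<lambda>z. z) -` A \<inter> space (PE_borel C)" using sub by (auto simp: space_PE)
    then have AP: "A \<in> sets (PE_borel C)" using measurable_sets [OF idP A] by simp
    have "emeasure (distr \<nu> N (\<lambda>z. z)) A = emeasure \<nu> A"
      using sub by (simp add: emeasure_distr [OF id A] space_nu Int_absorb2)
    also have "\<dots> = (\<integral>\<^sup>+m. emeasure (\<kappa> m) {\<alpha>. (m, \<alpha>) \<in> A} \<partial>\<mu>)"
      using \<kappa> AP unfolding disintegration_def by blast
    also have "\<dots> = (\<integral>\<^sup>+m. emeasure (D m) A \<partial>\<mu>)"
    proof (rule nn_integral_cong)
      fix m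
      have "(\<lambda>\<alpha>. (m, \<alpha>)) -` A \<inter> space (\<kappa> m) = {\<alpha>. (m, \<alpha>) \<in> A}" using sub by (auto simp: space_kappa)
      then show "emeasure (\<kappa> m) {\<alpha>. (m, \<alpha>) \<in> A} = emeasure (D m) A"
        by (simp add: D_def emeasure_distr [OF PN A])
    qed
    also have "\<dots> = emeasure (\<mu> \<bind> D) A"
      by (rule emeasure_bind [OF _ K A, symmetric]) (simp add: sp\<mu>)
    finally show "emeasure (distr \<nu> N (\<lambda>z. z)) A = emeasure (\<mu> \<bind> D) A" .
  qed
  moreover have fN: "f \<in> borel_measurable N" using f by (simp add: N_def)
  moreover have "(LINT z|(\<mu> \<bind> D). f z) = (LINT m|\<mu>. LINT z|D m. f z)"
  proof (rule integral_bind [OF fN _ K])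
    show "\<bar>f z\<bar> \<le> B" if "z \<in> space N" for z using that B by (cases z) (auto simp: spN)
    show "finite_measure \<mu>" using prob_mu by (rule prob_space.finite_measure)
    have "emeasure (D m) (space (D m)) = 1" for m
      unfolding D_def by (rule prob_space.emeasure_space_1 [OF prob_space.prob_space_distr [OF prob_kappa PN]])
    then show "AE m in \<mu>. emeasure (D m) (space (D m)) \<le> ennreal 1"
      by (intro AE_I2) (simp only: ennreal_1 order_refl)
  qed
  ultimately show ?thesis
    using integral_distr [OF id fN] by (simp add: D_def integral_distr [OF PN fN])
qed

lemma integral_nu_fibre:
  fixes f :: "'n ptorus \<Rightarrow> ('n torus \<Rightarrow>\<^sub>C (real ^ 'n)) \<Rightarrow> 'n torus \<Rightarrow> real"
  assumes f: "(\<lambda>((m, \<alpha>), y). f m \<alpha> y) \<in> borel_measurable ((borel \<Otimes>\<^sub>M E_borel) \<Otimes>\<^sub>M borel)"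
    and B: "\<And>m \<alpha> y. \<alpha> \<in> feedbacks C \<Longrightarrow> \<bar>f m \<alpha> y\<bar> \<le> B"
  shows "(LINT z|\<nu>. LINT y|meas (fst z). f (fst z) (snd z) y) = (LINT m|\<mu>. LINT y|meas m. LINT \<alpha>|\<kappa> m. f m \<alpha> y)"
proof -
  have sec: "(\<lambda>(\<alpha>, y). f m \<alpha> y) \<in> borel_measurable (E_borel \<Otimes>\<^sub>M borel)" for m
  proof -
    have "(\<lambda>p. ((m, fst p), snd p)) \<in> E_borel \<Otimes>\<^sub>M (borel :: 'n torus measure) \<rightarrow>\<^sub>M ((borel \<Otimes>\<^sub>M E_borel) \<Otimes>\<^sub>M borel)"
      by (intro measurable_Pair measurable_const measurable_fst measurable_snd) simp
    from measurable_compose [OF this f] show ?thesis by (simp add: case_prod_beta')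
  qed
  have "(\<lambda>z. LINT y|meas (fst z). f (fst z) (snd z) y) \<in> borel_measurable (borel \<Otimes>\<^sub>M E_borel)"
    by (rule measurable_kernel_integral [OF _ measurable_compose [OF measurable_fst measurable_meas_subprob]])
      (use f in \<open>simp add: case_prod_beta'\<close>)
  moreover have "\<bar>LINT y|meas m. f m \<alpha> y\<bar> \<le> B" if \<alpha>: "\<alpha> \<in> feedbacks C" for m \<alpha>
  proof -
    have "(\<lambda>y. f m \<alpha> y) \<in> borel_measurable borel"
      using measurable_compose [OF measurable_Pair1' sec, of \<alpha> m] \<alpha> by (simp add: space_restrict_space)
    then have fm: "f m \<alpha> \<in> borel_measurable (meas m)" by (simp only: measurable_cong_sets [OF sets_meas refl])
    have "norm (LINT y|meas m. f m \<alpha> y) \<le> B"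
      by (rule prob_space.norm_integral_le_const(2) [OF prob_space_meas fm]) (simp add: B \<alpha>)
    then show ?thesis by simp
  qed
  ultimately have "(LINT z|\<nu>. LINT y|meas (fst z). f (fst z) (snd z) y) = (LINT m|\<mu>. LINT \<alpha>|\<kappa> m. LINT y|meas m. f m \<alpha> y)"
    by (subst integral_nu [where B = B]) simp_all
  also have "\<dots> = (LINT m|\<mu>. LINT y|meas m. LINT \<alpha>|\<kappa> m. f m \<alpha> y)"
    by (subst fibre_Fubini [OF sec, where B = B]) (simp_all add: B)
  finally show ?thesis .
qed

lemma measurable_torus_fun:
  fixes h :: "'n ptorus \<Rightarrow> 'n torus \<Rightarrow> 'b::topological_space"
  assumes "continuous_on UNIV (\<lambda>(m, y). h m y)"
  shows "(\<lambda>((m, \<alpha>), y). h m y) \<in> borel_measurable ((borel \<Otimes>\<^sub>M E_borel) \<Otimes>\<^sub>M borel)"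
proof -
  have h: "(\<lambda>(m, y). h m y) \<in> borel_measurable (borel \<Otimes>\<^sub>M borel)"
    by (simp only: measurable_cong_sets [OF sets_borel_Times [symmetric] refl])
      (rule borel_measurable_continuous_onI [OF assms])
  have "(\<lambda>p. (fst (fst p), snd p)) \<in> ((borel :: 'n ptorus measure) \<Otimes>\<^sub>M E_borel) \<Otimes>\<^sub>M (borel :: 'n torus measure) \<rightarrow>\<^sub>M borel \<Otimes>\<^sub>M borel"
    by (intro measurable_Pair measurable_snd measurable_compose [OF measurable_fst measurable_fst])
  from measurable_compose [OF this h] show ?thesis by (simp add: case_prod_beta')
qed

text \<open>The integrand of the generator is affine in the feedback, so averaging it over a fibre amounts to inserting
  the mean drift.\<close>

lemma closedness_defect:
  assumes \<Phi>: "C11 \<Phi>"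
  shows "- (LINT z|dm_otimes \<mu>. Dm \<Phi> (fst z) (snd z) \<bullet> vec_RN_deriv (dm_otimes \<mu>) (limit_flux \<mu> \<kappa>) z)
        + (LINT z|dm_otimes \<mu>. tdiv (Dm \<Phi> (fst z)) (snd z)) = (LINT z|\<nu>. generator \<Phi> (fst z) z)"
proof -
  note mm = measurable_on_dm [OF prob_mu sets_mu_borel]
  have cD: "continuous_on UNIV (\<lambda>z. Dm \<Phi> (fst z) (snd z))" and cd: "continuous_on UNIV (\<lambda>z. tdiv (Dm \<Phi> (fst z)) (snd z))"
    using continuous_Dm [OF \<Phi>] continuous_div_Dm [OF \<Phi>] by (simp_all add: case_prod_beta')
  note mD = borel_measurable_continuous_onI [OF cD] and md = borel_measurable_continuous_onI [OF cd]
  obtain K where K: "\<And>m y v. norm v \<le> C \<Longrightarrow> \<bar>tdiv (Dm \<Phi> m) y - Dm \<Phi> m y \<bullet> v\<bar> \<le> K"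
    using C11_drift_bound [OF \<Phi>] by blast
  have Kd: "\<bar>tdiv (Dm \<Phi> m) y\<bar> \<le> K" for m y
    using K [of 0 m y] nonneg_C by simp
  have ip: "\<bar>Dm \<Phi> m y \<bullet> v\<bar> \<le> 2 * K" if "norm v \<le> C" for m y v
    using K [OF that, of m y] Kd [of m y] by linarith
  have mDw: "(\<lambda>z. Dm \<Phi> (fst z) (snd z) \<bullet> mean_drift \<kappa> z) \<in> borel_measurable borel"
    by (intro borel_measurable_inner mD measurable_mean_drift)
  have "(LINT z|dm_otimes \<mu>. Dm \<Phi> (fst z) (snd z) \<bullet> vec_RN_deriv (dm_otimes \<mu>) (limit_flux \<mu> \<kappa>) z)
      = (LINT z|dm_otimes \<mu>. Dm \<Phi> (fst z) (snd z) \<bullet> mean_drift \<kappa> z)"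
    by (rule integral_cong_AE)
      (use vec_RN_deriv_limit_flux(2) in \<open>auto intro!: mm borel_measurable_inner mD measurable_mean_drift vec_RN_deriv_limit_flux(1) elim: eventually_mono\<close>)
  moreover have "integrable (dm_otimes \<mu>) (\<lambda>z. tdiv (Dm \<Phi> (fst z)) (snd z))"
    by (rule prob_space.norm_integral_le_const(1) [OF prob_space_dm_otimes [OF prob_mu sets_mu_borel] mm [OF md], of K])
      (simp add: Kd)
  moreover have "integrable (dm_otimes \<mu>) (\<lambda>z. Dm \<Phi> (fst z) (snd z) \<bullet> mean_drift \<kappa> z)"
    by (rule prob_space.norm_integral_le_const(1) [OF prob_space_dm_otimes [OF prob_mu sets_mu_borel] mm [OF mDw], of "2 * K"])
      (simp add: ip mean_drift_le)
  ultimately have "- (LINT z|dm_otimes \<mu>. Dm \<Phi> (fst z) (snd z) \<bullet> vec_RN_deriv (dm_otimes \<mu>) (limit_flux \<mu> \<kappa>) z)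
        + (LINT z|dm_otimes \<mu>. tdiv (Dm \<Phi> (fst z)) (snd z))
      = (LINT z|dm_otimes \<mu>. tdiv (Dm \<Phi> (fst z)) (snd z) - Dm \<Phi> (fst z) (snd z) \<bullet> mean_drift \<kappa> z)"
    by simp
  also have "\<dots> = (LINT m|\<mu>. LINT y|meas m. tdiv (Dm \<Phi> m) y - Dm \<Phi> m y \<bullet> mean_drift \<kappa> (m, y))"
  proof (subst integral_dm_otimes [OF prob_mu sets_mu_borel, where B = K])
    show "(\<lambda>z. tdiv (Dm \<Phi> (fst z)) (snd z) - Dm \<Phi> (fst z) (snd z) \<bullet> mean_drift \<kappa> z) \<in> borel_measurable borel"
      by (intro borel_measurable_diff md mDw)
    fix z :: "'n ptorus \<times> 'n torus"
    show "\<bar>tdiv (Dm \<Phi> (fst z)) (snd z) - Dm \<Phi> (fst z) (snd z) \<bullet> mean_drift \<kappa> z\<bar> \<le> K"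
      by (rule K [OF mean_drift_le])
  qed simp
  also have "\<dots> = (LINT m|\<mu>. LINT y|meas m. LINT \<alpha>|\<kappa> m. tdiv (Dm \<Phi> m) y - Dm \<Phi> m y \<bullet> apply_bcontfun \<alpha> y)"
  proof -
    have "(LINT \<alpha>|\<kappa> m. tdiv (Dm \<Phi> m) y - Dm \<Phi> m y \<bullet> apply_bcontfun \<alpha> y)
        = tdiv (Dm \<Phi> m) y - Dm \<Phi> m y \<bullet> mean_drift \<kappa> (m, y)" for m y
    proof -
      interpret k: prob_space "\<kappa> m" by (rule prob_kappa)
      show ?thesis by (simp add: integrable_apply mean_drift_def k.prob_space)
    qed
    then show ?thesis by simp
  qed
  also have "\<dots> = (LINT z|\<nu>. LINT y|meas (fst z). tdiv (Dm \<Phi> (fst z)) y - Dm \<Phi> (fst z) y \<bullet> apply_bcontfun (snd z) y)"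
  proof (rule integral_nu_fibre [symmetric, where B = K])
    show "(\<lambda>((m, \<alpha>), y). tdiv (Dm \<Phi> m) y - Dm \<Phi> m y \<bullet> apply_bcontfun \<alpha> y) \<in> borel_measurable ((borel \<Otimes>\<^sub>M E_borel) \<Otimes>\<^sub>M borel)"
      using borel_measurable_diff [OF measurable_torus_fun [OF continuous_div_Dm [OF \<Phi>]]
          borel_measurable_inner [OF measurable_torus_fun [OF continuous_Dm [OF \<Phi>]] measurable_evaluation3]]
      by (simp add: case_prod_beta')
    show "\<bar>tdiv (Dm \<Phi> m) y - Dm \<Phi> m y \<bullet> apply_bcontfun \<alpha> y\<bar> \<le> K" if "\<alpha> \<in> feedbacks C" for m \<alpha> y
      by (rule K [OF feedback_apply_le [OF that]])
  qed
  finally show ?thesis by (simp add: generator_def drift_pairing_def)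
qed

text \<open>\<open>H\<^sup>*\<close> is a supremum of affine functions, each of which commutes with the mean.\<close>

lemma Hstar_Jensen:
  assumes H: "Hamiltonian_assms H"
  shows "integrable (\<kappa> m) (\<lambda>\<alpha>. Hstar H y (apply_bcontfun \<alpha> y))"
    and "Hstar H y (mean_drift \<kappa> (m, y)) \<le> (LINT \<alpha>|\<kappa> m. Hstar H y (apply_bcontfun \<alpha> y))"
proof -
  interpret k: prob_space "\<kappa> m" by (rule prob_kappa)
  obtain K where K: "\<And>y a. norm a \<le> C \<Longrightarrow> \<bar>Hstar H y a\<bar> \<le> K" using Hstar_bounded [OF H] by blast
  have "Hstar H y \<in> borel_measurable borel"
    by (rule borel_measurable_continuous_onI [OF continuous_on_slice [OF continuous_Hstar [OF H]]])
  from measurable_compose [OF measurable_apply this]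
  show i: "integrable (\<kappa> m) (\<lambda>\<alpha>. Hstar H y (apply_bcontfun \<alpha> y))"
    by (rule k.norm_integral_le_const(1) [where B = K]) (simp add: space_kappa K feedback_apply_le)
  show "Hstar H y (mean_drift \<kappa> (m, y)) \<le> (LINT \<alpha>|\<kappa> m. Hstar H y (apply_bcontfun \<alpha> y))"
    unfolding Hstar_def [of H y "mean_drift \<kappa> (m, y)"]
  proof (rule cSUP_least)
    fix p
    have "mean_drift \<kappa> (m, y) \<bullet> p - H y p = (LINT \<alpha>|\<kappa> m. apply_bcontfun \<alpha> y \<bullet> p - H y p)"
      by (simp add: mean_drift_def integrable_apply k.prob_space)
    also have "\<dots> \<le> (LINT \<alpha>|\<kappa> m. Hstar H y (apply_bcontfun \<alpha> y))"
      by (intro integral_mono i Fenchel [OF H] Bochner_Integration.integrable_diff integrable_inner_left integrable_apply) simp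
    finally show "mean_drift \<kappa> (m, y) \<bullet> p - H y p \<le> (LINT \<alpha>|\<kappa> m. Hstar H y (apply_bcontfun \<alpha> y))" .
  qed simp
qed

text \<open>The action sees only the mean drift, whereas \<open>\<nu>\<close> integrates the cost of the individual feedbacks, so this
  is Jensen's inequality in each fibre.\<close>

lemma action_limit_flux_le:
  assumes H: "Hamiltonian_assms H" and F: "continuous_on UNIV F" and FB: "\<And>m. \<bar>F m\<bar> \<le> B"
  shows "action H F \<mu> (limit_flux \<mu> \<kappa>) \<le> ereal (LINT z|\<nu>. running_cost H F z)"
proof -
  interpret M: prob_space \<mu> by (rule prob_mu)
  obtain K where K: "\<And>y a. norm a \<le> C \<Longrightarrow> \<bar>Hstar H y a\<bar> \<le> K" using Hstar_bounded [OF H] by blast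
  define w where "w = vec_RN_deriv (dm_otimes \<mu>) (limit_flux \<mu> \<kappa>)"
  have wm: "w \<in> borel_measurable borel" and w: "AE z in dm_otimes \<mu>. w z = mean_drift \<kappa> z"
    using vec_RN_deriv_limit_flux by (simp_all add: w_def)
  have Hm: "(\<lambda>(y, a). Hstar H y a) \<in> borel_measurable (borel \<Otimes>\<^sub>M borel)"
    by (simp only: measurable_cong_sets [OF sets_borel_Times [symmetric] refl])
      (rule borel_measurable_continuous_onI [OF continuous_Hstar [OF H]])
  define f where "f m \<alpha> y = Hstar H y (apply_bcontfun \<alpha> y) + F m" for m \<alpha> y
  define h where "h z = Hstar H (snd z) (mean_drift \<kappa> z) + F (fst z)" for z
  define g where "g z = (LINT \<alpha>|\<kappa> (fst z). f (fst z) \<alpha> (snd z))" for z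
  have Fm: "(\<lambda>z :: 'n ptorus \<times> 'n torus. F (fst z)) \<in> borel_measurable borel"
    using continuous_on_compose2 [OF F continuous_on_fst [OF continuous_on_id]]
    by (intro borel_measurable_continuous_onI) simp
  have Hw: "(\<lambda>z. Hstar H (snd z) (mean_drift \<kappa> z)) \<in> borel_measurable borel"
  proof -
    have "snd \<in> (borel :: ('n ptorus \<times> 'n torus) measure) \<rightarrow>\<^sub>M borel"
      by (intro borel_measurable_continuous_onI continuous_intros)
    from measurable_compose [OF measurable_Pair [OF this measurable_mean_drift] Hm] show ?thesis by simp
  qed
  then have hm: "h \<in> borel_measurable borel" unfolding h_def [abs_def] using Fm by (rule borel_measurable_add)
  have hb: "\<bar>h z\<bar> \<le> K + B" for z
    using K [OF mean_drift_le [of z], of "snd z"] FB [of "fst z"] by (simp add: h_def)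
  have fm: "(\<lambda>((m, \<alpha>), y). f m \<alpha> y) \<in> borel_measurable ((borel \<Otimes>\<^sub>M E_borel) \<Otimes>\<^sub>M borel)"
  proof -
    have 1: "(\<lambda>((m, \<alpha>), y). F m) \<in> borel_measurable ((borel \<Otimes>\<^sub>M E_borel) \<Otimes>\<^sub>M (borel :: 'n torus measure))"
      by (rule measurable_torus_fun) (use continuous_on_compose2 [OF F continuous_on_fst [OF continuous_on_id]] in \<open>simp add: case_prod_beta'\<close>)
    have 2: "(\<lambda>p. Hstar H (snd p) (apply_bcontfun (snd (fst p)) (snd p))) \<in> borel_measurable (((borel :: 'n ptorus measure) \<Otimes>\<^sub>M E_borel) \<Otimes>\<^sub>M borel)"
      using measurable_compose [OF measurable_Pair [OF measurable_snd measurable_evaluation3] Hm]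
      by (simp add: case_prod_beta')
    from borel_measurable_add [OF 2 1] show ?thesis by (simp add: f_def case_prod_beta')
  qed
  have fb: "\<bar>f m \<alpha> y\<bar> \<le> K + B" if "\<alpha> \<in> feedbacks C" for m \<alpha> y
    using K [OF feedback_apply_le [OF that], of y y] FB [of m] by (simp add: f_def)
  have gm: "g \<in> borel_measurable borel" unfolding g_def [abs_def] by (rule measurable_kappa_integral [OF fm])
  have fi: "integrable (\<kappa> m) (\<lambda>\<alpha>. f m \<alpha> y)" for m y
    unfolding f_def using prob_space.finite_measure [OF prob_kappa [of m]]
    by (intro Bochner_Integration.integrable_add Hstar_Jensen(1) [OF H] finite_measure.integrable_const)
  have gb: "\<bar>g z\<bar> \<le> K + B" for z
  proof -
    have "norm (g z) \<le> K + B"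
      unfolding g_def
      by (rule prob_space.norm_integral_le_const(2) [OF prob_kappa borel_measurable_integrable [OF fi]])
        (simp add: space_kappa fb)
    then show ?thesis by simp
  qed
  have hg: "h z \<le> g z" for z
  proof -
    interpret k: prob_space "\<kappa> (fst z)" by (rule prob_kappa)
    have "g z = (LINT \<alpha>|\<kappa> (fst z). Hstar H (snd z) (apply_bcontfun \<alpha> (snd z))) + F (fst z)"
      by (simp add: g_def f_def Hstar_Jensen(1) [OF H] k.prob_space)
    then show ?thesis using Hstar_Jensen(2) [OF H, of "snd z" "fst z"] by (simp add: h_def)
  qed
  have him: "integrable (meas m) (\<lambda>y. h (m, y))" "norm (LINT y|meas m. h (m, y)) \<le> K + B"
    and gim: "integrable (meas m) (\<lambda>y. g (m, y))" "norm (LINT y|meas m. g (m, y)) \<le> K + B" for m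
    using prob_space.norm_integral_le_const [OF prob_space_meas measurable_section [OF hm], where B = "K + B"]
      prob_space.norm_integral_le_const [OF prob_space_meas measurable_section [OF gm], where B = "K + B"]
    by (simp_all only: real_norm_def hb gb)
  have hmu: "integrable \<mu> (\<lambda>m. LINT y|meas m. h (m, y))"
    by (rule M.norm_integral_le_const(1) [OF measurable_fibre_integral [OF prob_mu sets_mu_borel hm]]) (rule him(2))
  have gmu: "integrable \<mu> (\<lambda>m. LINT y|meas m. g (m, y))"
    by (rule M.norm_integral_le_const(1) [OF measurable_fibre_integral [OF prob_mu sets_mu_borel gm]]) (rule gim(2))
  have iH: "integrable (meas m) (\<lambda>y. Hstar H y (mean_drift \<kappa> (m, y)))" for m
    by (rule prob_space.norm_integral_le_const(1) [OF prob_space_meas, where B = K])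
      (use measurable_section [OF Hw, of m] K mean_drift_le in simp_all)
  have Jm: "(LINT y|meas m. h (m, y)) = (LINT y|meas m. Hstar H y (mean_drift \<kappa> (m, y))) + F m" for m
  proof -
    interpret m: prob_space "meas m" by (rule prob_space_meas)
    show ?thesis unfolding h_def fst_conv snd_conv
      by (subst Bochner_Integration.integral_add [OF iH]) simp_all
  qed
  have "{z. w z = mean_drift \<kappa> z} \<in> sets borel"
  proof -
    have "(\<lambda>z. w z - mean_drift \<kappa> z) \<in> borel_measurable borel"
      by (intro borel_measurable_diff wm measurable_mean_drift)
    from measurable_sets [OF this, of "{0}"] show ?thesis by (simp add: vimage_def)
  qed
  from AE_dm_otimes [OF prob_mu sets_mu_borel this w]
  have "AE m in \<mu>. ext_integral (meas m) (\<lambda>y. ereal (Hstar H y (w (m, y)))) + ereal (F m)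
      = ereal (LINT y|meas m. h (m, y))"
  proof eventually_elim
    case (elim m)
    have "ext_integral (meas m) (\<lambda>y. ereal (Hstar H y (w (m, y))))
        = ext_integral (meas m) (\<lambda>y. ereal (Hstar H y (mean_drift \<kappa> (m, y))))"
      by (rule ext_integral_cong_AE) (use elim in eventually_elim, simp)
    then show ?case by (simp add: ext_integral_ereal [OF iH] Jm)
  qed
  then have "action H F \<mu> (limit_flux \<mu> \<kappa>) = ext_integral \<mu> (\<lambda>m. ereal (LINT y|meas m. h (m, y)))"
    unfolding action_def w_def by (rule ext_integral_cong_AE)
  also have "\<dots> = ereal (LINT m|\<mu>. LINT y|meas m. h (m, y))" by (rule ext_integral_ereal [OF hmu])
  also have "\<dots> \<le> ereal (LINT m|\<mu>. LINT y|meas m. g (m, y))"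
    by (simp, intro integral_mono hmu gmu him gim hg)
  also have "(LINT m|\<mu>. LINT y|meas m. g (m, y)) = (LINT z|\<nu>. LINT y|meas (fst z). f (fst z) (snd z) y)"
    unfolding g_def fst_conv snd_conv by (rule integral_nu_fibre [OF fm fb, symmetric])
  also have "\<dots> = (LINT z|\<nu>. running_cost H F z)"
  proof (rule Bochner_Integration.integral_cong [OF refl])
    fix z :: "'n ptorus \<times> ('n torus \<Rightarrow>\<^sub>C (real ^ 'n))"
    interpret m: prob_space "meas (fst z)" by (rule prob_space_meas)
    have "integrable (meas (fst z)) (\<lambda>y. Hstar H y (apply_bcontfun (snd z) y))"
      by (rule integrable_meas) (rule continuous_on_slice [OF continuous_Hstar_feedback [OF H], of z])
    then show "(LINT y|meas (fst z). f (fst z) (snd z) y) = running_cost H F z"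
      unfolding f_def running_cost_def by (subst Bochner_Integration.integral_add) simp_all
  qed
  finally show ?thesis .
qed

end

theorem proposition3p1:
  fixes H :: "'n::finite torus \<Rightarrow> real ^ 'n \<Rightarrow> real"
    and F :: "'n ptorus \<Rightarrow> real"
    and lam C :: real
    and m0 :: "'n ptorus"
    and m :: "real \<Rightarrow> real \<Rightarrow> 'n ptorus"
    and \<alpha> :: "real \<Rightarrow> real \<Rightarrow> ('n torus \<Rightarrow>\<^sub>C (real ^ 'n))"
    and \<delta> :: "nat \<Rightarrow> real"
    and \<nu> :: "('n ptorus \<times> ('n torus \<Rightarrow>\<^sub>C (real ^ 'n))) measure"
    and \<mu> :: "'n ptorus measure"
    and \<kappa> :: "'n ptorus \<Rightarrow> ('n torus \<Rightarrow>\<^sub>C (real ^ 'n)) measure"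
  assumes H: "Hamiltonian_assms H"
    and F: "potential_assms F"
    and lam: "critical_value H F lam"
    and min_action: "min_action H F = ereal (- lam)"
    and optimal: "\<And>d. d > 0 \<Longrightarrow> minimizer H F d m0 (m d) (\<lambda>t. apply_bcontfun (\<alpha> d t))"
    and \<alpha>_cont: "\<And>d. d > 0 \<Longrightarrow> continuous_on ({0..} \<times> UNIV) (\<lambda>(t, x). apply_bcontfun (\<alpha> d t) x)"
    and \<alpha>_E: "\<And>d t. d > 0 \<Longrightarrow> t \<ge> 0 \<Longrightarrow> \<alpha> d t \<in> feedbacks C"
    and \<delta>_pos: "\<And>k. \<delta> k > 0"
    and \<delta>_lim: "\<delta> \<longlonglongrightarrow> 0"
    and \<nu>: "\<nu> \<in> space (prob_algebra (PE_borel C))"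
    and \<nu>_lim: "weak_limit C (\<lambda>k. occupation C (\<delta> k) (m (\<delta> k)) (\<alpha> (\<delta> k))) \<nu>"
    and \<mu>: "\<mu> = distr \<nu> borel fst"
    and \<kappa>: "disintegration C \<nu> \<mu> \<kappa>"
  shows "Mather_measure H F \<mu> (limit_flux \<mu> \<kappa>)"
proof -
  note fibred = \<nu> \<mu> \<kappa>
  obtain g where g: "is_flat_deriv F g" using F unfolding potential_assms_def C2_def C1_def by blast
  have Fc: "continuous_on UNIV F" by (rule flat_deriv_continuous [OF g])
  obtain BF where BF: "\<And>m. \<bar>F m\<bar> \<le> BF" by (rule flat_deriv_bounded [OF g]) (rule that)
  have adm: "admissible (\<delta> k) m0 (m (\<delta> k)) (\<lambda>t. apply_bcontfun (\<alpha> (\<delta> k) t))" for k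
    using optimal [OF \<delta>_pos] by (simp add: minimizer_def)
  have mc: "continuous_on {0..} (m (\<delta> k))"
    and FP: "fokker_planck (m (\<delta> k)) (\<lambda>t. apply_bcontfun (\<alpha> (\<delta> k) t))" for k
    using adm [of k] by (simp_all add: admissible_def)
  have ac: "continuous_on {0..} (\<alpha> (\<delta> k))" for k
    by (rule continuous_feedback_path [OF \<alpha>_cont [OF \<delta>_pos]])
  have occ: "(LINT z|occupation C (\<delta> k) (m (\<delta> k)) (\<alpha> (\<delta> k)). f z)
      = (LINT s:{0..}|lborel. \<delta> k * exp (- \<delta> k * s) * f (m (\<delta> k) s, \<alpha> (\<delta> k) s))"
    if "continuous_on UNIV f" for f k
    by (rule integral_occupation [OF \<delta>_pos mc ac \<alpha>_E [OF \<delta>_pos] that])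
  have lim: "(\<lambda>k. LINT s:{0..}|lborel. \<delta> k * exp (- \<delta> k * s) * f (m (\<delta> k) s, \<alpha> (\<delta> k) s)) \<longlonglongrightarrow> (LINT z|\<nu>. f z)"
    if f: "continuous_on UNIV f" and b: "\<exists>K. \<forall>m \<alpha>. norm \<alpha> \<le> C \<longrightarrow> \<bar>f (m, \<alpha>)\<bar> \<le> K" for f
  proof -
    obtain K where K: "\<And>m \<alpha>. norm \<alpha> \<le> C \<Longrightarrow> \<bar>f (m, \<alpha>)\<bar> \<le> K" using b by blast
    have "bounded (f ` (UNIV \<times> feedbacks C))"
      unfolding bounded_iff by (intro exI [of _ K]) (auto intro!: K feedbacks_norm_le)
    moreover have "continuous_on (UNIV \<times> feedbacks C) f" using f by (rule continuous_on_subset) simp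
    ultimately have "(\<lambda>k. LINT z|occupation C (\<delta> k) (m (\<delta> k)) (\<alpha> (\<delta> k)). f z) \<longlonglongrightarrow> (LINT z|\<nu>. f z)"
      using \<nu>_lim unfolding weak_limit_def by blast
    then show ?thesis unfolding occ [OF f] .
  qed
  \<comment> \<open>The discounted average of a time derivative along the trajectory is of order \<open>\<delta>\<close>, so the generator
    has integral 0 in the limit.\<close>
  have closed: "closed_couple \<mu> (limit_flux \<mu> \<kappa>)"
    unfolding closed_couple_def
  proof (intro conjI allI impI prob_mu [OF fibred] sets_mu_borel [OF fibred]
      vector_measure_limit_flux [OF fibred] abs_continuous_limit_flux [OF fibred])
    fix \<Phi> :: "'n ptorus \<Rightarrow> real" assume \<Phi>: "C11 \<Phi>"
    obtain B where B: "\<And>m. \<bar>\<Phi> m\<bar> \<le> B" by (rule flat_deriv_bounded [OF C11_is_flat_deriv [OF \<Phi>]]) (rule that)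
    obtain K where K: "\<And>m \<alpha>. norm \<alpha> \<le> C \<Longrightarrow> \<bar>generator \<Phi> m (m, \<alpha>)\<bar> \<le> K"
      using generator_bounded [OF \<Phi>] by blast
    define G where "G z = generator \<Phi> (fst z) z" for z
    have cG: "continuous_on UNIV G"
      using continuous_on_compose2 [OF continuous_generator [OF \<Phi>]
          continuous_on_Pair [OF continuous_on_fst [OF continuous_on_id] continuous_on_id]]
      by (simp add: G_def [abs_def])
    have bG: "\<exists>K. \<forall>m \<alpha>. norm \<alpha> \<le> C \<longrightarrow> \<bar>G (m, \<alpha>)\<bar> \<le> K"
      using K by (auto simp: G_def)
    have "\<bar>LINT s:{0..}|lborel. \<delta> k * exp (- \<delta> k * s) * G (m (\<delta> k) s, \<alpha> (\<delta> k) s)\<bar> \<le> 2 * \<delta> k * B" for k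
    proof (rule discounted_derivative_bound [OF \<delta>_pos, where f = "\<lambda>s. \<Phi> (m (\<delta> k) s)" and B' = K])
      show "continuous_on {0..} (\<lambda>s. \<Phi> (m (\<delta> k) s))"
        using continuous_on_compose2 [OF flat_deriv_continuous [OF C11_is_flat_deriv [OF \<Phi>]] mc] by simp
      show "continuous_on {0..} (\<lambda>s. G (m (\<delta> k) s, \<alpha> (\<delta> k) s))"
        using continuous_on_compose2 [OF cG continuous_on_Pair [OF mc ac]] by simp
      show "\<bar>\<Phi> (m (\<delta> k) s)\<bar> \<le> B" for s by (rule B)
      show "\<bar>G (m (\<delta> k) s, \<alpha> (\<delta> k) s)\<bar> \<le> K" if "0 \<le> s" for s
        using K [OF feedbacks_norm_le [OF \<alpha>_E [OF \<delta>_pos that]]] by (simp add: G_def)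
      show "((\<lambda>s. \<Phi> (m (\<delta> k) s)) has_real_derivative G (m (\<delta> k) s, \<alpha> (\<delta> k) s)) (at s)" if "0 < s" for s
        using chain_rule [OF \<Phi> FP mc ac that] by (simp add: G_def)
    qed
    then have le: "norm (LINT s:{0..}|lborel. \<delta> k * exp (- \<delta> k * s) * G (m (\<delta> k) s, \<alpha> (\<delta> k) s)) \<le> 2 * \<delta> k * B" for k
      unfolding real_norm_def .
    have "(\<lambda>k. 2 * \<delta> k * B) \<longlonglongrightarrow> 2 * 0 * B" by (intro tendsto_intros \<delta>_lim)
    then have to0: "(\<lambda>k. 2 * \<delta> k * B) \<longlonglongrightarrow> 0" by simp
    have "(\<lambda>k. LINT s:{0..}|lborel. \<delta> k * exp (- \<delta> k * s) * G (m (\<delta> k) s, \<alpha> (\<delta> k) s)) \<longlonglongrightarrow> 0"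
      by (rule Lim_null_comparison [OF always_eventually to0]) (intro allI le)
    from LIMSEQ_unique [OF lim [OF cG bG] this] have "(LINT z|\<nu>. G z) = 0" .
    then have "(LINT z|\<nu>. generator \<Phi> (fst z) z) = 0" by (simp add: G_def)
    then    show "- (LINT z|dm_otimes \<mu>. Dm \<Phi> (fst z) (snd z) \<bullet> vec_RN_deriv (dm_otimes \<mu>) (limit_flux \<mu> \<kappa>) z)
        + (LINT z|dm_otimes \<mu>. tdiv (Dm \<Phi> (fst z)) (snd z)) = 0"
      unfolding closedness_defect [OF fibred \<Phi>] .
  qed
  \<comment> \<open>The occupation measure integrates the running cost to \<open>\<delta>\<close> times the optimal discounted value.\<close>
  have "(LINT z|\<nu>. running_cost H F z) = - lam"
  proof -
    have opt_value: "discounted_value H F (\<delta> k) m0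
        = discounted_cost H F (\<delta> k) (m (\<delta> k)) (\<lambda>t. apply_bcontfun (\<alpha> (\<delta> k) t))" for k
      unfolding discounted_value_def
      by (rule cInf_eq_minimum) (use adm optimal [OF \<delta>_pos] in \<open>auto simp: minimizer_def\<close>)
    have "\<delta> k * discounted_value H F (\<delta> k) m0
        = (LINT s:{0..}|lborel. \<delta> k * exp (- \<delta> k * s) * running_cost H F (m (\<delta> k) s, \<alpha> (\<delta> k) s))" for k
      unfolding opt_value discounted_cost_def running_cost_def fst_conv snd_conv mult.assoc
      by (rule set_integral_mult_right [symmetric])
    moreover have "(\<lambda>k. \<delta> k * discounted_value H F (\<delta> k) m0) \<longlonglongrightarrow> - lam"
    proof -
      have "((\<lambda>d. d * discounted_value H F d m0) \<longlongrightarrow> - lam) (at_right 0)"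
        using tendsto_uniform_limitI [OF lam [unfolded critical_value_def] UNIV_I] .
      moreover have "filterlim \<delta> (at_right 0) sequentially"
        using \<delta>_lim \<delta>_pos by (intro tendsto_imp_filterlim_at_right) auto
      ultimately show ?thesis by (rule filterlim_compose)
    qed
    ultimately show ?thesis
      using LIMSEQ_unique [OF lim [OF continuous_running_cost [OF H Fc] running_cost_bounded [OF H BF]]] by simp
  qed
  then have "action H F \<mu> (limit_flux \<mu> \<kappa>) \<le> min_action H F"
    using action_limit_flux_le [OF fibred H Fc BF] min_action by simp
  moreover have "min_action H F \<le> action H F \<mu>' p'" if "closed_couple \<mu>' p'" for \<mu>' p'
    unfolding min_action_def by (rule Inf_lower) (use that in blast)
  ultimately show ?thesis unfolding Mather_measure_def using closed order_trans by blast
qed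

end
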